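(* Let $(H,G)$ be a crossed module of topological groups and let $EG\to BG$ be the universal $G$-bundle. Then the bibundle $EG\times H\to EG\times_GH$ is a classifying bibundle in the sense that, for any paracompact space $M$, there is a bijection $$\pi_0\mathbf{Bibun}_{(H,G)}(M)\;\cong\;[M,EG\times_GH]_{H/t(G)}$$ induced by sending the isomorphism class of a bibundle $P$ on $M$ to the homotopy class over $H/t(G)$ of the map $\Gamma\colon M\to EG\times_GH$.
   Context: A crossed module $(H,G)$ consists of topological groups $G,H$ and homomorphisms $t\colon G\to H$ (continuous) and $\alpha\colon H\to\operatorname{Aut}(G)$ (giving a continuous action of $H$ on $G$) with $t(\alpha(h)(g))=h\,t(g)\,h^{-1}$ and $\alpha(t(g))(g')=gg'g^{-1}$. Then $G_1=\ker t$ is central in $G$ and $t(G)$ is normal in $H$. Standing assumptions: the projections $G\to G/G_1$ and $H\to H/t(G)$ admit local sections, and $t(G)$ is identified with $G/G_1$ as a topological group. Paracompact spaces are understood to be Hausdorff. An $(H,G)$ bibundle on $M$ is a (locally trivial, right) principal $G$-bundle $P\to M$ with a continuous structure map $\psi\colon P\to H$ satisfying $\psi(pg)=\psi(p)t(g)$. An isomorphism of bibundles on $M$ is an isomorphism of principal $G$-bundles over the identity of $M$ commuting with structure maps; $\pi_0\mathbf{Bibun}_{(H,G)}(M)$ is the set of isomorphism classes. $EG\to BG$ is a universal principal $G$-bundle; in particular $EG$ is contractible. $EG\times H$ carries the right $G$-action $(e,h)g=(eg,ht(g))$, with quotient $EG\times_GH$; with structure map the projection $EG\times H\to H$ this is an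 $(H,G)$ bibundle over $EG\times_GH$, with type map $\Phi\colon EG\times_GH\to H/t(G)$, $[e,h]\mapsto[h]$. Given a bibundle $P\to M$ with structure map $\psi$, choose a classifying map $M\to BG$ of the underlying $G$-bundle, covered by a $G$-equivariant map $\hat f\colon P\to EG$; then $\Gamma\colon M\to EG\times_GH$ is the map induced on quotients by $\hat\Gamma\colon P\to EG\times H$, $p\mapsto(\hat f(p),\psi(p))$. $[M,EG\times_GH]_{H/t(G)}$ denotes the set of continuous maps $M\to EG\times_GH$ modulo homotopy over $H/t(G)$: $f_0\sim f_1$ if there is a homotopy $h\colon M\times I\to EG\times_GH$ from $f_0$ to $f_1$ such that $\Phi\circ h(m,s)$ is independent of $s\in I$ for each $m$. *)

theory Defs
  imports "HOL-Analysis.Analysis" "HOL-Algebra.Coset" "HOL-Algebra.Bij"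
begin

section \<open>Point-set topology\<close>

definition paracompact_space :: "'a topology \<Rightarrow> bool" where
  "paracompact_space X \<longleftrightarrow>
     Hausdorff_space X \<and>
     (\<forall>\<U>. (\<forall>U\<in>\<U>. openin X U) \<and> \<Union>\<U> = topspace X \<longrightarrow>
        (\<exists>\<V>. (\<forall>V\<in>\<V>. openin X V) \<and> \<Union>\<V> = topspace X \<and> locally_finite_in X \<V> \<and>
             (\<forall>V\<in>\<V>. \<exists>U\<in>\<U>. V \<subseteq> U)))"

definition quotient_topology :: "'a topology \<Rightarrow> ('a \<Rightarrow> 'b) \<Rightarrow> 'b topology" where
  "quotient_topology X q =
     topology (\<lambda>U. U \<subseteq> q ` topspace X \<and> openin X {x \<in> topspace X. q x \<in> U})"

lemma openin_quotient_topology: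
  "openin (quotient_topology X q) U \<longleftrightarrow>
     U \<subseteq> q ` topspace X \<and> openin X {x \<in> topspace X. q x \<in> U}"
proof -
  have "istopology (\<lambda>U. U \<subseteq> q ` topspace X \<and> openin X {x \<in> topspace X. q x \<in> U})"
    unfolding istopology_def
  proof (intro conjI allI impI)
    fix S T
    assume S: "S \<subseteq> q ` topspace X \<and> openin X {x \<in> topspace X. q x \<in> S}"
      and T: "T \<subseteq> q ` topspace X \<and> openin X {x \<in> topspace X. q x \<in> T}"
    show "S \<inter> T \<subseteq> q ` topspace X" using S by blast
    have "{x \<in> topspace X. q x \<in> S \<inter> T} = {x \<in> topspace X. q x \<in> S} \<inter> {x \<in> topspace X. q x \<in> T}"
      by blast
    then show "openin X {x \<in> topspace X. q x \<in> S \<inter> T}" using S T by auto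
  next
    fix \<K>
    assume K: "\<forall>K\<in>\<K>. K \<subseteq> q ` topspace X \<and> openin X {x \<in> topspace X. q x \<in> K}"
    then show "\<Union>\<K> \<subseteq> q ` topspace X" by blast
    have "{x \<in> topspace X. q x \<in> \<Union>\<K>} = \<Union>((\<lambda>K. {x \<in> topspace X. q x \<in> K}) ` \<K>)"
      by blast
    then show "openin X {x \<in> topspace X. q x \<in> \<Union>\<K>}" using K by auto
  qed
  then show ?thesis
    by (simp add: quotient_topology_def)
qed

lemma topspace_quotient_topology [simp]:
  "topspace (quotient_topology X q) = q ` topspace X"
proof
  show "topspace (quotient_topology X q) \<subseteq> q ` topspace X"
    using openin_quotient_topology[of X q "topspace (quotient_topology X q)"] by simp
  have "{x \<in> topspace X. q x \<in> q ` topspace X} = topspace X" by auto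
  then have "openin (quotient_topology X q) (q ` topspace X)"
    by (simp add: openin_quotient_topology)
  then show "q ` topspace X \<subseteq> topspace (quotient_topology X q)"
    by (rule openin_subset)
qed

lemma quotient_map_quotient_topology: "quotient_map X (quotient_topology X q) q"
  by (auto simp: quotient_map_def openin_quotient_topology)

definition admits_local_sections :: "'a topology \<Rightarrow> 'b topology \<Rightarrow> ('a \<Rightarrow> 'b) \<Rightarrow> bool" where
  "admits_local_sections X Y q \<longleftrightarrow>
     (\<forall>y\<in>topspace Y. \<exists>U s. openin Y U \<and> y \<in> U \<and>
        continuous_map (subtopology Y U) X s \<and> (\<forall>u\<in>U. q (s u) = u))"


section \<open>Crossed modules of topological groups\<close>

locale topological_group = group G for G (structure) and T +
  assumes topspace_eq_carrier: "topspace T = carrier G"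
    and continuous_mult: "continuous_map (prod_topology T T) T (\<lambda>(x, y). x \<otimes> y)"
    and continuous_inv: "continuous_map T T (\<lambda>x. inv x)"

text \<open>The homomorphism \<open>\<alpha>\<close> is only required to be continuous as an action
  \<open>H \<times> G \<rightarrow> G\<close>; no topology is put on the automorphism group.\<close>

locale crossed_module =
  G: topological_group G TG + H: topological_group H TH
  for G :: "('g, 'x) monoid_scheme" and TG :: "'g topology"
    and H :: "('h, 'y) monoid_scheme" and TH :: "'h topology" +
  fixes t :: "'g \<Rightarrow> 'h" and \<alpha> :: "'h \<Rightarrow> 'g \<Rightarrow> 'g"
  assumes t_hom: "t \<in> hom G H"
    and t_continuous: "continuous_map TG TH t"
    and \<alpha>_hom: "\<alpha> \<in> hom H (AutoGroup G)"
    and \<alpha>_continuous: "continuous_map (prod_topology TH TG) TG (\<lambda>(h, g). \<alpha> h g)"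
    and equivariance: "\<lbrakk>h \<in> carrier H; g \<in> carrier G\<rbrakk> \<Longrightarrow>
           t (\<alpha> h g) = h \<otimes>\<^bsub>H\<^esub> t g \<otimes>\<^bsub>H\<^esub> inv\<^bsub>H\<^esub> h"
    and Peiffer: "\<lbrakk>g \<in> carrier G; g' \<in> carrier G\<rbrakk> \<Longrightarrow>
           \<alpha> (t g) g' = g \<otimes>\<^bsub>G\<^esub> g' \<otimes>\<^bsub>G\<^esub> inv\<^bsub>G\<^esub> g"

text \<open>The quotient \<open>K/N\<close>, as a space, is the set of left cosets \<open>k N\<close> with the quotient
  topology.\<close>

definition coset_space ::
  "('k, 'z) monoid_scheme \<Rightarrow> 'k topology \<Rightarrow> 'k set \<Rightarrow> 'k set topology" where
  "coset_space K TK N = quotient_topology TK (\<lambda>k. k <#\<^bsub>K\<^esub> N)"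

text \<open>The last assumption says that the bijection \<open>G/ker t \<rightarrow> t(G)\<close> induced by \<open>t\<close>, which sends
  a coset \<open>c\<close> to the only element of \<open>t ` c\<close>, is a homeomorphism for the subspace topology
  on \<open>t(G)\<close>.\<close>

locale admissible_crossed_module = crossed_module G TG H TH t \<alpha>
  for G :: "('g, 'x) monoid_scheme" and TG :: "'g topology"
    and H :: "('h, 'y) monoid_scheme" and TH :: "'h topology"
    and t :: "'g \<Rightarrow> 'h" and \<alpha> :: "'h \<Rightarrow> 'g \<Rightarrow> 'g" +
  assumes local_sections_G: "admits_local_sections TG
            (coset_space G TG (kernel G H t)) (\<lambda>g. g <#\<^bsub>G\<^esub> kernel G H t)"
    and local_sections_H: "admits_local_sections TH
            (coset_space H TH (t ` carrier G)) (\<lambda>h. h <#\<^bsub>H\<^esub> (t ` carrier G))"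
    and image_identification: "homeomorphic_map (coset_space G TG (kernel G H t))
            (subtopology TH (t ` carrier G)) (\<lambda>c. the_elem (t ` c))"


section \<open>Principal bundles and bibundles\<close>

record ('p, 'g, 'm) gbundle =
  total_space :: "'p topology"
  proj :: "'p \<Rightarrow> 'm"
  act :: "'p \<Rightarrow> 'g \<Rightarrow> 'p"

record ('p, 'g, 'm, 'h) bibundle = "('p, 'g, 'm) gbundle" +
  structure_map :: "'p \<Rightarrow> 'h"

definition principal_bundle ::
  "('g, 'x) monoid_scheme \<Rightarrow> 'g topology \<Rightarrow> 'm topology \<Rightarrow> ('p, 'g, 'm, 'z) gbundle_scheme \<Rightarrow> bool"
  where
  "principal_bundle G TG M P \<longleftrightarrow>
     continuous_map (total_space P) M (proj P) \<and>
     continuous_map (prod_topology (total_space P) TG) (total_space P) (\<lambda>(p, g). act P p g) \<and>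
     (\<forall>p\<in>topspace (total_space P). act P p \<one>\<^bsub>G\<^esub> = p) \<and>
     (\<forall>p\<in>topspace (total_space P). \<forall>g\<in>carrier G. \<forall>g'\<in>carrier G.
        act P (act P p g) g' = act P p (g \<otimes>\<^bsub>G\<^esub> g')) \<and>
     (\<forall>p\<in>topspace (total_space P). \<forall>g\<in>carrier G. proj P (act P p g) = proj P p) \<and>
     (\<forall>m\<in>topspace M. \<exists>U \<phi>. openin M U \<and> m \<in> U \<and>
        homeomorphic_map (prod_topology (subtopology M U) TG)
          (subtopology (total_space P) {p \<in> topspace (total_space P). proj P p \<in> U}) \<phi> \<and>
        (\<forall>u\<in>U. \<forall>g\<in>carrier G. proj P (\<phi> (u, g)) = u \<and>
           (\<forall>g'\<in>carrier G. \<phi> (u, g \<otimes>\<^bsub>G\<^esub> g') = act P (\<phi> (u, g)) g')))"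

definition is_bibundle ::
  "('g, 'x) monoid_scheme \<Rightarrow> 'g topology \<Rightarrow> ('h, 'y) monoid_scheme \<Rightarrow> 'h topology \<Rightarrow> ('g \<Rightarrow> 'h) \<Rightarrow>
   'm topology \<Rightarrow> ('p, 'g, 'm, 'h) bibundle \<Rightarrow> bool" where
  "is_bibundle G TG H TH t M P \<longleftrightarrow>
     principal_bundle G TG M P \<and>
     continuous_map (total_space P) TH (structure_map P) \<and>
     (\<forall>p\<in>topspace (total_space P). \<forall>g\<in>carrier G.
        structure_map P (act P p g) = structure_map P p \<otimes>\<^bsub>H\<^esub> t g)"

definition equivariant_map ::
  "('g, 'x) monoid_scheme \<Rightarrow> ('p, 'g, 'm, 'z) gbundle_scheme \<Rightarrow> ('q, 'g, 'n, 'w) gbundle_scheme \<Rightarrow>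
   ('p \<Rightarrow> 'q) \<Rightarrow> bool" where
  "equivariant_map G P Q f \<longleftrightarrow>
     continuous_map (total_space P) (total_space Q) f \<and>
     (\<forall>p\<in>topspace (total_space P). \<forall>g\<in>carrier G. f (act P p g) = act Q (f p) g)"

definition bibundle_iso ::
  "('g, 'x) monoid_scheme \<Rightarrow> ('p, 'g, 'm, 'h) bibundle \<Rightarrow> ('q, 'g, 'm, 'h) bibundle \<Rightarrow>
   ('p \<Rightarrow> 'q) \<Rightarrow> bool" where
  "bibundle_iso G P Q f \<longleftrightarrow>
     equivariant_map G P Q f \<and>
     homeomorphic_map (total_space P) (total_space Q) f \<and>
     (\<forall>p\<in>topspace (total_space P).
        proj Q (f p) = proj P p \<and> structure_map Q (f p) = structure_map P p)"

text \<open>The collection of all bibundles on \<open>M\<close> is not a set.  Below, total spaces range over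
  all topological spaces whose points are taken from a fixed type \<open>'u\<close>.  The total
  space of a principal \<open>G\<close>-bundle on \<open>M\<close> is in bijection with \<open>M \<times> G\<close>, so every isomorphism
  class of bibundles is represented as soon as \<open>M \<times> G\<close> injects into \<open>'u\<close>.\<close>

definition Bibun ::
  "('g, 'x) monoid_scheme \<Rightarrow> 'g topology \<Rightarrow> ('h, 'y) monoid_scheme \<Rightarrow> 'h topology \<Rightarrow> ('g \<Rightarrow> 'h) \<Rightarrow>
   'm topology \<Rightarrow> ('u, 'g, 'm, 'h) bibundle set" where
  "Bibun G TG H TH t M = {P. is_bibundle G TG H TH t M P}"

definition Bibun_iso_rel ::
  "('g, 'x) monoid_scheme \<Rightarrow> 'g topology \<Rightarrow> ('h, 'y) monoid_scheme \<Rightarrow> 'h topology \<Rightarrow> ('g \<Rightarrow> 'h) \<Rightarrow>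
   'm topology \<Rightarrow> ('u, 'g, 'm, 'h) bibundle rel" where
  "Bibun_iso_rel G TG H TH t M =
     {(P, Q). P \<in> Bibun G TG H TH t M \<and> Q \<in> Bibun G TG H TH t M \<and> (\<exists>f. bibundle_iso G P Q f)}"

definition pi0_Bibun ::
  "('g, 'x) monoid_scheme \<Rightarrow> 'g topology \<Rightarrow> ('h, 'y) monoid_scheme \<Rightarrow> 'h topology \<Rightarrow> ('g \<Rightarrow> 'h) \<Rightarrow>
   'm topology \<Rightarrow> ('u, 'g, 'm, 'h) bibundle set set" where
  "pi0_Bibun G TG H TH t M = Bibun G TG H TH t M // Bibun_iso_rel G TG H TH t M"


section \<open>The classifying bibundle\<close>

text \<open>A universal bundle is one whose total space is contractible; the empty space is excluded
  explicitly because \<open>contractible_space\<close> holds of it.  Numerability of \<open>EG \<rightarrow> BG\<close> is not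
  required.\<close>

definition universal_bundle ::
  "('g, 'x) monoid_scheme \<Rightarrow> 'g topology \<Rightarrow> 'b topology \<Rightarrow> ('e, 'g, 'b) gbundle \<Rightarrow> bool" where
  "universal_bundle G TG BG EG \<longleftrightarrow>
     principal_bundle G TG BG EG \<and>
     topspace (total_space EG) \<noteq> {} \<and> contractible_space (total_space EG)"

definition EGH_act ::
  "('h, 'y) monoid_scheme \<Rightarrow> ('g \<Rightarrow> 'h) \<Rightarrow> ('e, 'g, 'b) gbundle \<Rightarrow> 'e \<times> 'h \<Rightarrow> 'g \<Rightarrow> 'e \<times> 'h" where
  "EGH_act H t EG = (\<lambda>(e, h) g. (act EG e g, h \<otimes>\<^bsub>H\<^esub> t g))"

definition EGH_class ::
  "('g, 'x) monoid_scheme \<Rightarrow> ('h, 'y) monoid_scheme \<Rightarrow> ('g \<Rightarrow> 'h) \<Rightarrow> ('e, 'g, 'b) gbundle \<Rightarrow>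
   'e \<times> 'h \<Rightarrow> ('e \<times> 'h) set" where
  "EGH_class G H t EG x = EGH_act H t EG x ` carrier G"

definition EGH_quotient ::
  "('g, 'x) monoid_scheme \<Rightarrow> ('h, 'y) monoid_scheme \<Rightarrow> 'h topology \<Rightarrow> ('g \<Rightarrow> 'h) \<Rightarrow>
   ('e, 'g, 'b) gbundle \<Rightarrow> ('e \<times> 'h) set topology" where
  "EGH_quotient G H TH t EG =
     quotient_topology (prod_topology (total_space EG) TH) (EGH_class G H t EG)"

definition classifying_bibundle ::
  "('g, 'x) monoid_scheme \<Rightarrow> ('h, 'y) monoid_scheme \<Rightarrow> 'h topology \<Rightarrow> ('g \<Rightarrow> 'h) \<Rightarrow>
   ('e, 'g, 'b) gbundle \<Rightarrow> ('e \<times> 'h, 'g, ('e \<times> 'h) set, 'h) bibundle" where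
  "classifying_bibundle G H TH t EG =
     \<lparr>total_space = prod_topology (total_space EG) TH, proj = EGH_class G H t EG,
      act = EGH_act H t EG, structure_map = snd\<rparr>"

text \<open>The type map \<open>[e, h] \<mapsto> [h]\<close>.  Classes are literally orbits and cosets, and the image of
  the orbit of \<open>(e, h)\<close> under \<open>snd\<close> is the coset \<open>h t(G)\<close>.\<close>

definition type_map :: "('e \<times> 'h) set \<Rightarrow> 'h set" where
  "type_map c = snd ` c"

lemma type_map_EGH_class:
  "type_map (EGH_class G H t EG (e, h)) = h <#\<^bsub>H\<^esub> (t ` carrier G)"
  by (auto simp: type_map_def EGH_class_def EGH_act_def l_coset_def image_iff)

text \<open>\<open>classifies G H t BG EG M P \<Gamma>\<close>: the map \<open>\<Gamma>\<close> is obtained from the bibundle \<open>P\<close> by some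
  choice of a classifying map \<open>f\<close> and of an equivariant map \<open>F\<close> covering it.\<close>

definition classifies ::
  "('g, 'x) monoid_scheme \<Rightarrow> ('h, 'y) monoid_scheme \<Rightarrow> ('g \<Rightarrow> 'h) \<Rightarrow> 'b topology \<Rightarrow>
   ('e, 'g, 'b) gbundle \<Rightarrow> 'm topology \<Rightarrow> ('p, 'g, 'm, 'h) bibundle \<Rightarrow>
   ('m \<Rightarrow> ('e \<times> 'h) set) \<Rightarrow> bool" where
  "classifies G H t BG EG M P \<Gamma> \<longleftrightarrow>
     (\<exists>f F. continuous_map M BG f \<and> equivariant_map G P EG F \<and>
        (\<forall>p\<in>topspace (total_space P).
           proj EG (F p) = f (proj P p) \<and>
           \<Gamma> (proj P p) = EGH_class G H t EG (F p, structure_map P p)))"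

definition homotopic_over ::
  "('x \<Rightarrow> 'c) \<Rightarrow> 'm topology \<Rightarrow> 'x topology \<Rightarrow> ('m \<Rightarrow> 'x) \<Rightarrow> ('m \<Rightarrow> 'x) \<Rightarrow> bool" where
  "homotopic_over \<Phi> M X f\<^sub>0 f\<^sub>1 \<longleftrightarrow>
     homotopic_with (\<lambda>k. \<forall>m\<in>topspace M. \<Phi> (k m) = \<Phi> (f\<^sub>0 m)) M X f\<^sub>0 f\<^sub>1"

definition homotopy_rel_over ::
  "('x \<Rightarrow> 'c) \<Rightarrow> 'm topology \<Rightarrow> 'x topology \<Rightarrow> ('m \<Rightarrow> 'x) rel" where
  "homotopy_rel_over \<Phi> M X =
     {(f\<^sub>0, f\<^sub>1). continuous_map M X f\<^sub>0 \<and> continuous_map M X f\<^sub>1 \<and> homotopic_over \<Phi> M X f\<^sub>0 f\<^sub>1}"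

definition homotopy_classes_over ::
  "('x \<Rightarrow> 'c) \<Rightarrow> 'm topology \<Rightarrow> 'x topology \<Rightarrow> ('m \<Rightarrow> 'x) set set" where
  "homotopy_classes_over \<Phi> M X = {f. continuous_map M X f} // homotopy_rel_over \<Phi> M X"

end

theory Submission
  imports Defs
begin

text \<open>Choose cutoff functions for a locally finite trivializing cover of the paracompact base such
  that at every point at least one of them equals \<open>1\<close>.  To each member of the cover belongs a
  fibrewise self-map which is the identity where its cutoff vanishes, and composing these maps in
  some fixed linear order of the index set gives a continuous global map.  Used with a contraction
  of \<open>EG\<close>, this contracts \<open>EG\<close> equivariantly over any principal bundle on \<open>M\<close>, so equivariant
  maps to \<open>EG\<close> exist and are unique up to equivariant homotopy.  Used with local horizontal lifts
  of a homotopy \<open>M \<times> I \<rightarrow> EG \<times>\<^sub>G H\<close> of constant type, it transports the bibundle at time \<open>0\<close> to the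
  one at time \<open>1\<close>.  Horizontal lifts exist because the structure map varies only by elements of
  \<open>t(G)\<close>, which lift to \<open>G\<close> near the identity.\<close>

section \<open>Cutoff functions on paracompact spaces\<close>

text \<open>Points of EG or of a fibre cannot be averaged, so local data are combined by applying
  maps one after another instead of by a partition of unity. Hence the cutoffs have maximum 1 rather
  than sum 1: one factor whose cutoff is 1 completes the job, provided that no other factor undoes
  it. A composite that has forgotten its argument cannot recover it, and a time that has reached 1
  is kept there by \<open>max\<close>. The order is fixed because the factors do not commute.

  The bijection itself is reduced to bundle maps. A map \<Gamma> obtained from P amounts to a bundle
  map from P to EG x H over \<Gamma> that preserves structure maps (\<open>classifies_iff\<close>).
  Every P has a \<Gamma> because equivariant maps exist; every \<Gamma> occurs because bibundles can
  be pulled back; isomorphic bibundles have homotopic maps by uniqueness of equivariant maps up to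
  homotopy; homotopic maps come from isomorphic bibundles by transport. Constancy of the type lets
  transport preserve the structure map and not only the principal bundle.\<close>

lemma continuous_map_locally:
  assumes "\<And>x. x \<in> topspace X \<Longrightarrow>
    \<exists>U. openin X U \<and> x \<in> U \<and> continuous_map (subtopology X U) Y f"
  shows "continuous_map X Y f"
proof -
  obtain U where U: "\<And>x. x \<in> topspace X \<Longrightarrow>
      openin X (U x) \<and> x \<in> U x \<and> continuous_map (subtopology X (U x)) Y f"
    using assms by metis
  show ?thesis
    by (rule pasting_lemma[where I = "topspace X" and T = U and f = "\<lambda>_. f"])
      (use U in auto)
qed

section \<open>Separation, normality and shrinking in paracompact spaces\<close>

lemma paracompact_space_refinement:
  assumes "paracompact_space M" "\<forall>U\<in>\<U>. openin M U" "\<Union>\<U> = topspace M"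
  shows "\<exists>\<V>. (\<forall>V\<in>\<V>. openin M V) \<and> \<Union>\<V> = topspace M \<and> locally_finite_in M \<V> \<and>
    (\<forall>V\<in>\<V>. \<exists>U\<in>\<U>. V \<subseteq> U)"
  using assms by (simp add: paracompact_space_def)

text \<open>Closures commute with locally finite unions, so neighbourhoods of the single points of
  \<open>C\<close> whose closures avoid \<open>K\<close> can be refined and united. With
  \<open>K\<close> a point this gives regularity from the Hausdorff property, with \<open>K\<close>
  closed it gives normality from regularity.\<close>

lemma paracompact_space_separation:
  assumes M: "paracompact_space M" and C: "closedin M C"
    and sep: "\<And>y. y \<in> C \<Longrightarrow> \<exists>V. openin M V \<and> y \<in> V \<and> M closure_of V \<inter> K = {}"
  shows "\<exists>V. openin M V \<and> C \<subseteq> V \<and> M closure_of V \<inter> K = {}"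
proof -
  define \<U> where "\<U> = insert (topspace M - C) {V. openin M V \<and> M closure_of V \<inter> K = {}}"
  have op: "\<forall>U\<in>\<U>. openin M U"
    using C by (auto simp: \<U>_def)
  have cover: "\<Union>\<U> = topspace M"
  proof
    show "\<Union>\<U> \<subseteq> topspace M" using op openin_subset[of M] by blast
    show "topspace M \<subseteq> \<Union>\<U>" using sep unfolding \<U>_def by blast
  qed
  obtain \<W> where W: "\<forall>V\<in>\<W>. openin M V" "\<Union>\<W> = topspace M" "locally_finite_in M \<W>"
      "\<forall>V\<in>\<W>. \<exists>U\<in>\<U>. V \<subseteq> U"
    using paracompact_space_refinement[OF M op cover] by blast
  \<comment> \<open>The member \<open>topspace M - C\<close> of the cover says nothing about
    \<open>K\<close>; a set that meets \<open>C\<close> cannot have been refined from it.\<close>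
  let ?W = "{V\<in>\<W>. V \<inter> C \<noteq> {}}"
  have "locally_finite_in M ?W"
    by (rule locally_finite_in_subset[OF W(3)]) blast
  then have cl: "M closure_of \<Union>?W = (\<Union>V\<in>?W. M closure_of V)"
    by (rule closure_of_locally_finite_Union)
  have "M closure_of V \<inter> K = {}" if V: "V \<in> \<W>" "V \<inter> C \<noteq> {}" for V
  proof -
    obtain U where U: "U \<in> \<U>" "V \<subseteq> U" using W(4) V(1) by blast
    then have "U \<noteq> topspace M - C" using V(2) by blast
    then have "M closure_of U \<inter> K = {}" using U(1) by (simp add: \<U>_def)
    then show ?thesis using closure_of_mono[OF U(2), of M] by blast
  qed
  then have "M closure_of \<Union>?W \<inter> K = {}"
    unfolding cl by blast
  moreover have "C \<subseteq> \<Union>?W"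
    using W(2) closedin_subset[OF C] by blast
  moreover have "openin M (\<Union>?W)"
    using W(1) by blast
  ultimately show ?thesis by blast
qed

lemma disjoint_open_closure_of:
  assumes "openin M U" "disjnt U V"
  shows "U \<inter> M closure_of V = {}"
  using assms openin_Int_closure_of_eq_empty[of M U V] by (auto simp: disjnt_def)

lemma paracompact_space_point_separation:
  assumes M: "paracompact_space M" and C: "closedin M C" and x: "x \<in> topspace M - C"
  shows "\<exists>V. openin M V \<and> C \<subseteq> V \<and> x \<notin> M closure_of V"
proof -
  have "\<exists>V. openin M V \<and> y \<in> V \<and> M closure_of V \<inter> {x} = {}" if "y \<in> C" for y
  proof -
    have "Hausdorff_space M" using M by (simp add: paracompact_space_def)
    moreover have "y \<in> topspace M" "x \<noteq> y" using that x closedin_subset[OF C] by auto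
    ultimately obtain U V where "openin M U" "openin M V" "x \<in> U" "y \<in> V" "disjnt U V"
      using x unfolding Hausdorff_space_def by blast
    then show ?thesis using disjoint_open_closure_of[of M U V] by blast
  qed
  from paracompact_space_separation[OF M C this] show ?thesis by auto
qed

lemma paracompact_space_imp_normal_space:
  assumes M: "paracompact_space M"
  shows "normal_space M"
  unfolding normal_space_def
proof (intro allI impI)
  fix S T assume ST: "closedin M S \<and> closedin M T \<and> disjnt S T"
  have "\<exists>V. openin M V \<and> y \<in> V \<and> M closure_of V \<inter> T = {}" if "y \<in> S" for y
  proof -
    have "y \<in> topspace M - T" using ST that closedin_subset[of M S] by (auto simp: disjnt_iff)
    then obtain V where V: "openin M V" "T \<subseteq> V" "y \<notin> M closure_of V"
      using paracompact_space_point_separation[OF M, of T y] ST by blast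
    let ?O = "topspace M - M closure_of V"
    have "openin M ?O" by auto
    moreover have "M closure_of ?O \<inter> V = {}"
      using disjoint_open_closure_of[OF V(1), of ?O] closure_of_subset[OF openin_subset[OF V(1)]]
      by (auto simp: disjnt_iff)
    ultimately show ?thesis
      using V \<open>y \<in> topspace M - T\<close> by (intro exI[of _ ?O]) auto
  qed
  then obtain V where V: "openin M V" "S \<subseteq> V" "M closure_of V \<inter> T = {}"
    using paracompact_space_separation[OF M, of S T] ST by blast
  have "openin M (topspace M - M closure_of V)" by auto
  moreover have "T \<subseteq> topspace M - M closure_of V"
    using V ST closedin_subset[of M T] by auto
  moreover have "disjnt V (topspace M - M closure_of V)"
    using closure_of_subset[OF openin_subset[OF V(1)]] by (auto simp: disjnt_iff)
  ultimately show "\<exists>U V. openin M U \<and> openin M V \<and> S \<subseteq> U \<and> T \<subseteq> V \<and> disjnt U V"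
    using V by blast
qed

text \<open>A Urysohn function is only known to vanish off \<open>U\<close>. Cutting it at 1/2 and
  rescaling makes it vanish off a closed \<open>C\<close> inside \<open>U\<close>, hence on an open
  set that covers the space together with \<open>U\<close>; a map defined over \<open>U\<close> can
  then be extended by the identity.\<close>

lemma normal_space_cutoff:
  assumes "normal_space M" "closedin M B" "openin M U" "B \<subseteq> U"
  shows "\<exists>C \<sigma>. closedin M C \<and> C \<subseteq> U \<and> continuous_map M (top_of_set {0..1::real}) \<sigma> \<and>
    (\<forall>m\<in>topspace M - C. \<sigma> m = 0) \<and> (\<forall>m\<in>B. \<sigma> m = 1)"
proof -
  have "closedin M (topspace M - U)" "disjnt (topspace M - U) B"
    using assms by (auto simp: disjnt_iff)
  then obtain f where f: "continuous_map M (top_of_set {0..1::real}) f"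
      "f \<in> (topspace M - U) \<rightarrow> {0}" "f \<in> B \<rightarrow> {1}"
    using Urysohn_lemma[OF assms(1) _ assms(2), of "topspace M - U" 0 1]
    by (metis image_subset_iff_funcset zero_le_one)
  define C where "C = {m \<in> topspace M. f m \<in> {1/2..}}"
  have fR: "continuous_map M euclideanreal f" and fr: "\<And>m. m \<in> topspace M \<Longrightarrow> f m \<in> {0..1}"
    using f(1) by (auto simp: continuous_map_in_subtopology Pi_iff)
  have "closedin M C"
    unfolding C_def by (rule closedin_continuous_map_preimage[OF fR]) auto
  moreover have "C \<subseteq> U"
  proof
    fix m assume "m \<in> C"
    then have "m \<in> topspace M" "f m \<noteq> 0" by (auto simp: C_def)
    then show "m \<in> U" using f(2) by (auto simp: Pi_iff)
  qed
  moreover have "continuous_map M (top_of_set {0..1::real}) (\<lambda>m. max 0 (2 * f m - 1))"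
    unfolding continuous_map_in_subtopology
  proof
    show "continuous_map M euclideanreal (\<lambda>m. max 0 (2 * f m - 1))"
      by (intro continuous_intros fR)
  qed (use fr in \<open>auto simp: Pi_iff\<close>)
  moreover have "\<forall>m\<in>topspace M - C. max 0 (2 * f m - 1) = 0"
    by (auto simp: C_def)
  moreover have "\<forall>m\<in>B. max 0 (2 * f m - 1) = 1"
    using f(3) by (auto simp: Pi_iff)
  ultimately show ?thesis by blast
qed

text \<open>A shrinking argument: the members of \<O> get closed subsets that still cover the space,
  and each cutoff is made 1 on its closed subset.\<close>

lemma paracompact_space_cutoffs:
  assumes M: "paracompact_space M" and U: "\<forall>U\<in>\<U>. openin M U" "\<Union>\<U> = topspace M"
  obtains \<O> C \<sigma> where "locally_finite_in M \<O>"
    and "\<And>W. W \<in> \<O> \<Longrightarrow> openin M W" and "\<And>W. W \<in> \<O> \<Longrightarrow> \<exists>U\<in>\<U>. W \<subseteq> U"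
    and "\<And>W. W \<in> \<O> \<Longrightarrow> closedin M (C W)" and "\<And>W. W \<in> \<O> \<Longrightarrow> C W \<subseteq> W"
    and "\<And>W. W \<in> \<O> \<Longrightarrow> continuous_map M (top_of_set {0..1::real}) (\<sigma> W)"
    and "\<And>W m. W \<in> \<O> \<Longrightarrow> m \<in> topspace M - C W \<Longrightarrow> \<sigma> W m = 0"
    and "\<And>m. m \<in> topspace M \<Longrightarrow> \<exists>W\<in>\<O>. m \<in> W \<and> \<sigma> W m = 1"
proof -
  obtain \<O> where O: "\<forall>V\<in>\<O>. openin M V" "\<Union>\<O> = topspace M" "locally_finite_in M \<O>"
      "\<forall>V\<in>\<O>. \<exists>U\<in>\<U>. V \<subseteq> U"
    using paracompact_space_refinement[OF M U] by blast
  define \<W> where "\<W> = {V. openin M V \<and> (\<exists>W\<in>\<O>. M closure_of V \<subseteq> W)}"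
  have pts: "\<exists>V\<in>\<W>. x \<in> V" if x: "x \<in> topspace M" for x
  proof -
    obtain W where W: "W \<in> \<O>" "x \<in> W" using O(2) x by blast
    have cl: "closedin M (topspace M - W)" using O(1) W by auto
    have "x \<in> topspace M - (topspace M - W)" using x W by auto
    then obtain V where V: "openin M V" "topspace M - W \<subseteq> V" "x \<notin> M closure_of V"
      using paracompact_space_point_separation[OF M cl] by blast
    let ?V = "topspace M - M closure_of V"
    have "M closure_of ?V \<inter> V = {}"
      using disjoint_open_closure_of[OF V(1), of ?V] closure_of_subset[OF openin_subset[OF V(1)]]
      by (auto simp: disjnt_iff)
    then have "M closure_of ?V \<subseteq> W"
      using V(2) closure_of_subset_topspace[of M ?V] by blast
    then show ?thesis using V(3) x W(1) by (intro bexI[of _ ?V]) (auto simp: \<W>_def)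
  qed
  have op: "\<forall>V\<in>\<W>. openin M V"
    by (simp add: \<W>_def)
  have cover: "\<Union>\<W> = topspace M"
  proof
    show "\<Union>\<W> \<subseteq> topspace M" using op openin_subset[of M] by blast
    show "topspace M \<subseteq> \<Union>\<W>" using pts by blast
  qed
  obtain \<V> where V: "\<forall>V\<in>\<V>. openin M V" "\<Union>\<V> = topspace M"
      "locally_finite_in M \<V>" "\<forall>V\<in>\<V>. \<exists>U\<in>\<W>. V \<subseteq> U"
    using paracompact_space_refinement[OF M op cover] by blast
  have "\<exists>W\<in>\<O>. M closure_of V \<subseteq> W" if V': "V \<in> \<V>" for V
  proof -
    obtain U where U: "U \<in> \<W>" "V \<subseteq> U" using V(4) V' by blast
    then obtain W where "W \<in> \<O>" "M closure_of U \<subseteq> W" by (auto simp: \<W>_def)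
    then show ?thesis using closure_of_mono[OF U(2), of M] by blast
  qed
  then obtain w where w: "\<And>V. V \<in> \<V> \<Longrightarrow> w V \<in> \<O> \<and> M closure_of V \<subseteq> w V"
    by metis
  \<comment> \<open>Each member of the finer cover is charged to one set \<open>w V\<close> that
    contains its closure. Grouping by \<open>w\<close> keeps \<O> as the index set, and local
    finiteness keeps the closure of a whole group inside \<open>W\<close>.\<close>
  define B where "B W = M closure_of \<Union>{V\<in>\<V>. w V = W}" for W
  have B: "B W \<subseteq> W" for W
  proof -
    have "locally_finite_in M {V\<in>\<V>. w V = W}"
      by (rule locally_finite_in_subset[OF V(3)]) blast
    from closure_of_locally_finite_Union[OF this] show ?thesis
      using w by (auto simp: B_def)
  qed
  have "\<exists>C \<sigma>. closedin M C \<and> C \<subseteq> W \<and> continuous_map M (top_of_set {0..1::real}) \<sigma> \<and>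
      (\<forall>m\<in>topspace M - C. \<sigma> m = 0) \<and> (\<forall>m\<in>B W. \<sigma> m = 1)" if "W \<in> \<O>" for W
    using normal_space_cutoff[OF paracompact_space_imp_normal_space[OF M], of "B W" W] O(1) that B
    by (simp add: B_def)
  then obtain C \<sigma> where *: "\<And>W. W \<in> \<O> \<Longrightarrow> closedin M (C W) \<and> C W \<subseteq> W \<and>
      continuous_map M (top_of_set {0..1::real}) (\<sigma> W) \<and>
      (\<forall>m\<in>topspace M - C W. \<sigma> W m = 0) \<and> (\<forall>m\<in>B W. \<sigma> W m = 1)"
    by metis
  show thesis
  proof (rule that[of \<O> C \<sigma>])
    fix m assume "m \<in> topspace M"
    then obtain V where "V \<in> \<V>" "m \<in> V" using V(2) by blast
    then have "m \<in> B (w V)"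
      unfolding B_def using V(2) by (intro subsetD[OF closure_of_subset]) auto
    moreover have "w V \<in> \<O>"
      using w \<open>V \<in> \<V>\<close> by simp
    ultimately show "\<exists>W\<in>\<O>. m \<in> W \<and> \<sigma> W m = 1"
      using * B[of "w V"] by (intro bexI[of _ "w V"]) auto
  qed (use O * in auto)
qed

section \<open>Ordered composition of a locally finite family of fibrewise maps\<close>

lemma fold_fixpoint:
  assumes "\<And>i. i \<in> set L \<Longrightarrow> f i x = x"
  shows "fold f L x = x"
  using assms by (induction L) auto

lemma fold_in:
  assumes "\<And>i x. i \<in> set L \<Longrightarrow> x \<in> S \<Longrightarrow> f i x \<in> S" "x \<in> S"
  shows "fold f L x \<in> S"
  using assms by (induction L arbitrary: x) auto

text \<open>One constant factor makes the composite constant, wherever it stands: earlier factors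
  only move the arguments inside \<open>S\<close>, later ones receive equal arguments. This gives
  the final stage of the contraction of \<open>EG\<close>.\<close>

lemma fold_forgets:
  assumes "\<And>i x. i \<in> set L \<Longrightarrow> x \<in> S \<Longrightarrow> f i x \<in> S"
    and "i \<in> set L" "\<And>x y. x \<in> S \<Longrightarrow> y \<in> S \<Longrightarrow> f i x = f i y" and "x \<in> S" "y \<in> S"
  shows "fold f L x = fold f L y"
  using assms
proof (induction L arbitrary: x y)
  case (Cons j L)
  show ?case
  proof (cases "i = j")
    case True
    then show ?thesis using Cons.prems(3)[OF Cons.prems(4,5)] by simp
  next
    case False
    have "fold f L (f j x) = fold f L (f j y)"
    proof (rule Cons.IH)
      show "f j x \<in> S" "f j y \<in> S"
        using Cons.prems(1)[of j] Cons.prems(4,5) by simp_all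
      show "i \<in> set L" using False Cons.prems(2) by simp
      show "f k z \<in> S" if "k \<in> set L" "z \<in> S" for k z
        using Cons.prems(1)[of k z] that by simp
      show "f i z = f i w" if "z \<in> S" "w \<in> S" for z w
        by (rule Cons.prems(3)[OF that])
    qed
    then show ?thesis by simp
  qed
qed simp

text \<open>With \<open>h\<close> the right translation by a group element, this passes equivariance
  from the factors to the composite.\<close>

lemma fold_intertwine:
  assumes "\<And>i x. i \<in> set L \<Longrightarrow> x \<in> S \<Longrightarrow> f i x \<in> S"
    and "\<And>i x. i \<in> set L \<Longrightarrow> x \<in> S \<Longrightarrow> f' i (h x) = h (f i x)" and "x \<in> S"
  shows "fold f' L (h x) = h (fold f L x)"
  using assms by (induction L arbitrary: x) auto

text \<open>Split the list at \<open>i\<close>: the factors before it stay in \<open>S\<close>,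
  \<open>i\<close> enters \<open>Q\<close>, and those after it cannot leave \<open>Q\<close>. In the
  transport, \<open>Q\<close> says that time 1 has been reached.\<close>

lemma fold_reaches:
  assumes "\<And>j x. j \<in> set L \<Longrightarrow> x \<in> S \<Longrightarrow> f j x \<in> S"
    and "\<And>j x. j \<in> set L \<Longrightarrow> x \<in> S \<Longrightarrow> x \<in> Q \<Longrightarrow> f j x \<in> Q"
    and "i \<in> set L" "\<And>x. x \<in> S \<Longrightarrow> f i x \<in> Q" and "x \<in> S"
  shows "fold f L x \<in> Q"
proof -
  obtain L1 L2 where L: "L = L1 @ i # L2"
    using split_list[OF assms(3)] by blast
  have 1: "fold f L1 x \<in> S"
    by (rule fold_in) (use assms(1,5) L in auto)
  have "fold f L2 (f i (fold f L1 x)) \<in> S \<inter> Q"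
    by (rule fold_in) (use assms(1,2) assms(1)[of i, OF _ 1] assms(4)[OF 1] L in auto)
  then show ?thesis by (simp add: L)
qed

text \<open>Lets the list at a point, which varies with the point, be compared with one longer list
  that is valid on a whole neighbourhood.\<close>

lemma fold_filter:
  assumes "\<And>i y. i \<in> set L \<Longrightarrow> y \<in> S \<Longrightarrow> f i y \<in> S"
    and "\<And>i y. i \<in> set L \<Longrightarrow> \<not> P i \<Longrightarrow> y \<in> S \<Longrightarrow> f i y = y" and "y \<in> S"
  shows "fold f (filter P L) y = fold f L y"
  using assms by (induction L arbitrary: y) auto

lemma continuous_map_fold:
  assumes "\<And>i. i \<in> set L \<Longrightarrow> continuous_map Y Y (f i)"
  shows "continuous_map Y Y (fold f L)"
  using assms
proof (induction L)
  case (Cons i L)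
  then have "continuous_map Y Y (fold f L \<circ> f i)"
    by (intro continuous_map_compose[of _ Y]) auto
  then show ?case by (simp add: o_def)
qed (simp add: id_def)

lemma locally_finite_inD:
  assumes "locally_finite_in M \<O>" "m \<in> topspace M"
  shows "\<exists>V. openin M V \<and> m \<in> V \<and> finite {W \<in> \<O>. W \<inter> V \<noteq> {}}"
  using assms by (simp add: locally_finite_in_def)

text \<open>Near a given point only finitely many members of \<O> matter, and the composite along
  all of them is a fixed composite of continuous maps. It agrees with the composite along
  \<open>L (\<pi> y)\<close>, since the surplus factors act trivially on the fibre. For this the
  short list must be a sublist of the long one, in the same order.\<close>

lemma locally_finite_fold_continuous:
  fixes M :: "'m topology"
  assumes lf: "locally_finite_in M \<O>"
    and op: "\<And>W. W \<in> \<O> \<Longrightarrow> openin M W"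
    and cl: "\<And>W. W \<in> \<O> \<Longrightarrow> closedin M (C W)" "\<And>W. W \<in> \<O> \<Longrightarrow> C W \<subseteq> W"
    and \<pi>: "continuous_map Y M \<pi>"
    and f: "\<And>W. W \<in> \<O> \<Longrightarrow> continuous_map (subtopology Y {y \<in> topspace Y. \<pi> y \<in> W}) Y (f W)"
    and fib: "\<And>W y. W \<in> \<O> \<Longrightarrow> y \<in> topspace Y \<Longrightarrow> \<pi> y \<in> W \<Longrightarrow> \<pi> (f W y) = \<pi> y"
    and triv: "\<And>W y. W \<in> \<O> \<Longrightarrow> y \<in> topspace Y \<Longrightarrow> \<pi> y \<notin> C W \<Longrightarrow> f W y = y"
  obtains L where "\<And>m. m \<in> topspace M \<Longrightarrow> set (L m) = {W \<in> \<O>. m \<in> W}"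
    and "continuous_map Y Y (\<lambda>y. fold f (L (\<pi> y)) y)"
proof -
  \<comment> \<open>A linear order on the whole type of index sets, so that sorted lists of nested
    finite sets are sublists of each other; orders chosen point by point would not fit
    together.\<close>
  obtain r :: "'m set rel" where r: "well_order_on UNIV r"
    using well_order_on by blast
  then have "refl r" "trans r" "antisym r" "total r"
    by (auto simp: well_order_on_def linear_order_on_def partial_order_on_def preorder_on_def)
  then have "(x, x) \<in> r" "(x, y) \<in> r \<Longrightarrow> (y, z) \<in> r \<Longrightarrow> (x, z) \<in> r"
      "(x, y) \<in> r \<Longrightarrow> (y, x) \<in> r \<Longrightarrow> x = y" "(x, y) \<in> r \<or> (y, x) \<in> r" for x y z
    by (metis UNIV_I reflD transD antisymD total_on_def)+
  then have lin: "class.linorder (\<lambda>x y. (x, y) \<in> r) (\<lambda>x y. (x, y) \<in> r \<and> x \<noteq> y)"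
    by unfold_locales metis+
  interpret r: linorder "\<lambda>x y. (x, y) \<in> r" "\<lambda>x y. (x, y) \<in> r \<and> x \<noteq> y"
    by (rule lin)
  define sl where "sl = r.sorted_list_of_set"
  have set_sl: "set (sl S) = S" if "finite S" for S
    using that by (simp add: sl_def)
  have filter_sl: "filter (\<lambda>i. i \<in> S) (sl T) = sl S" if "finite T" "S \<subseteq> T" for S T
  proof -
    have "finite S" using that finite_subset by blast
    moreover have "sorted_wrt (\<lambda>x y. (x, y) \<in> r \<and> x \<noteq> y) (filter (\<lambda>i. i \<in> S) (sl T))"
      unfolding sl_def by (intro sorted_wrt_filter r.strict_sorted_list_of_set)
    moreover have "set (filter (\<lambda>i. i \<in> S) (sl T)) = S"
      using that set_sl by auto
    ultimately show ?thesis
      using r.strict_sorted_equal[OF _ r.strict_sorted_list_of_set, of "filter (\<lambda>i. i \<in> S) (sl T)" S]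
      by (simp add: sl_def)
  qed
  define L where "L m = sl {W \<in> \<O>. m \<in> W}" for m
  have fin: "finite {W \<in> \<O>. m \<in> W}" if m: "m \<in> topspace M" for m
  proof -
    obtain V where "m \<in> V" "finite {W \<in> \<O>. W \<inter> V \<noteq> {}}"
      using locally_finite_inD[OF lf m] by blast
    moreover have "{W \<in> \<O>. m \<in> W} \<subseteq> {W \<in> \<O>. W \<inter> V \<noteq> {}}" using \<open>m \<in> V\<close> by blast
    ultimately show ?thesis using finite_subset by blast
  qed
  \<comment> \<open>Two open pieces cover \<open>Y\<close>: over \<open>W\<close> continuity is
    assumed, over the complement of \<open>C W\<close> the map is the identity.\<close>
  have f': "continuous_map Y Y (f W)" if W: "W \<in> \<O>" for W
  proof (rule continuous_map_locally)
    fix y assume y: "y \<in> topspace Y"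
    show "\<exists>U. openin Y U \<and> y \<in> U \<and> continuous_map (subtopology Y U) Y (f W)"
    proof (cases "\<pi> y \<in> W")
      case True
      then show ?thesis
        using f[OF W] y openin_continuous_map_preimage[OF \<pi> op[OF W]] by blast
    next
      case False
      let ?U = "{y \<in> topspace Y. \<pi> y \<in> topspace M - C W}"
      have "openin Y ?U"
        using openin_continuous_map_preimage[OF \<pi>, of "topspace M - C W"] cl(1)[OF W] by blast
      moreover have "y \<in> ?U"
        using False cl(2)[OF W] y continuous_map_image_subset_topspace[OF \<pi>] by auto
      moreover have "continuous_map (subtopology Y ?U) Y (f W)"
        by (rule continuous_map_eq[of _ _ "\<lambda>y. y"])
          (use triv[OF W] in \<open>auto intro!: continuous_map_from_subtopology\<close>)
      ultimately show ?thesis by blast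
    qed
  qed
  have fib': "\<pi> (f W y) = \<pi> y" if "W \<in> \<O>" "y \<in> topspace Y" for W y
    using fib[OF that] triv[OF that] cl(2)[OF that(1)] by (metis subsetD)
  have "continuous_map Y Y (\<lambda>y. fold f (L (\<pi> y)) y)"
  proof (rule continuous_map_locally)
    fix y assume y: "y \<in> topspace Y"
    then have m: "\<pi> y \<in> topspace M"
      using continuous_map_image_subset_topspace[OF \<pi>] by auto
    obtain V where V: "openin M V" "\<pi> y \<in> V" and T: "finite {W \<in> \<O>. W \<inter> V \<noteq> {}}" (is "finite ?T")
      using locally_finite_inD[OF lf m] by (elim exE conjE) (rule that)
    let ?U = "{y \<in> topspace Y. \<pi> y \<in> V}"
    have "continuous_map (subtopology Y ?U) Y (fold f (sl ?T))"
      by (intro continuous_map_from_subtopology continuous_map_fold f') (simp add: set_sl[OF T])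
    moreover have "fold f (sl ?T) z = fold f (L (\<pi> z)) z" if z: "z \<in> topspace (subtopology Y ?U)" for z
    proof -
      have z': "z \<in> topspace Y" "\<pi> z \<in> V" using z by auto
      have "L (\<pi> z) = filter (\<lambda>W. W \<in> {W \<in> \<O>. \<pi> z \<in> W}) (sl ?T)"
        unfolding L_def using z' by (intro filter_sl[symmetric] T) auto
      \<comment> \<open>The fibre over \<open>\<pi> z\<close> is invariant, so the factor of a
        \<open>W\<close> that does not contain \<open>\<pi> z\<close> is trivial at every
        intermediate point and not only at \<open>z\<close>.\<close>
      moreover have "fold f (filter (\<lambda>W. W \<in> {W \<in> \<O>. \<pi> z \<in> W}) (sl ?T)) z = fold f (sl ?T) z"
      proof (rule fold_filter[where S = "{y \<in> topspace Y. \<pi> y = \<pi> z}"])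
        fix W y assume "W \<in> set (sl ?T)" "y \<in> {y \<in> topspace Y. \<pi> y = \<pi> z}"
        then show "f W y \<in> {y \<in> topspace Y. \<pi> y = \<pi> z}"
          using fib' f'[THEN continuous_map_image_subset_topspace] by (force simp: set_sl[OF T])
      next
        fix W y assume "W \<in> set (sl ?T)" "W \<notin> {W \<in> \<O>. \<pi> z \<in> W}" "y \<in> {y \<in> topspace Y. \<pi> y = \<pi> z}"
        then show "f W y = y"
          using triv[of W y] cl(2)[of W] by (auto simp: set_sl[OF T])
      qed (use z' in auto)
      ultimately show ?thesis by simp
    qed
    ultimately have "continuous_map (subtopology Y ?U) Y (\<lambda>y. fold f (L (\<pi> y)) y)"
      by (rule continuous_map_eq)
    then show "\<exists>U. openin Y U \<and> y \<in> U \<and> continuous_map (subtopology Y U) Y (\<lambda>y. fold f (L (\<pi> y)) y)"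
      using openin_continuous_map_preimage[OF \<pi> V(1)] y V(2) by (intro exI[of _ ?U]) auto
  qed
  then show thesis
    using that[of L] fin set_sl by (simp add: L_def)
qed

section \<open>Principal bundles\<close>

lemma continuous_map_comp:
  assumes "continuous_map Y Z g" "continuous_map X Y f"
  shows "continuous_map X Z (\<lambda>x. g (f x))"
  using continuous_map_compose[OF assms(2,1)] by (simp add: o_def)

lemma continuous_map_comp_pair:
  assumes "continuous_map (prod_topology X Y) Z (\<lambda>(x, y). h x y)"
    and "continuous_map W X f" "continuous_map W Y g"
  shows "continuous_map W Z (\<lambda>w. h (f w) (g w))"
  using continuous_map_comp[OF assms(1) continuous_map_pairedI[OF assms(2,3)]] by simp

lemma continuous_map_fst': "continuous_map X (prod_topology Y Z) f \<Longrightarrow> continuous_map X Y (\<lambda>x. fst (f x))"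
  by (rule continuous_map_comp[OF continuous_map_fst])

lemma continuous_map_snd': "continuous_map X (prod_topology Y Z) f \<Longrightarrow> continuous_map X Z (\<lambda>x. snd (f x))"
  by (rule continuous_map_comp[OF continuous_map_snd])

lemma continuous_map_in:
  "continuous_map X Y f \<Longrightarrow> x \<in> topspace X \<Longrightarrow> f x \<in> topspace Y"
  using continuous_map_image_subset_topspace by blast

lemma continuous_map_restrict_preimage:
  assumes "continuous_map (subtopology Y U) Z g" "continuous_map X Y f"
  shows "continuous_map (subtopology X {x \<in> topspace X. f x \<in> U}) Z (\<lambda>x. g (f x))"
  by (rule continuous_map_comp[OF assms(1)], rule continuous_map_into_subtopology)
    (auto intro: continuous_map_from_subtopology assms(2))

lemma (in topological_group) continuous_map_mult:
  assumes "continuous_map X T f" "continuous_map X T g"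
  shows "continuous_map X T (\<lambda>x. f x \<otimes> g x)"
  by (rule continuous_map_comp_pair[OF continuous_mult assms])

lemma (in topological_group) continuous_map_inv:
  assumes "continuous_map X T f"
  shows "continuous_map X T (\<lambda>x. inv (f x))"
  by (rule continuous_map_comp[OF continuous_inv assms])

text \<open>A local section s and a continuous division d give the trivialization (u, g) -> s(u) g
  with inverse p -> (proj p, d (s (proj p)) p). For pullbacks and for EG x H both ingredients are
  inherited from a bundle at hand.\<close>

lemma (in topological_group) principal_bundleI:
  fixes P :: "('p, 'a, 'm, 'z) gbundle_scheme"
  assumes proj: "continuous_map (total_space P) M (proj P)"
    and act: "continuous_map (prod_topology (total_space P) T) (total_space P) (\<lambda>(p, g). act P p g)"
    and one: "\<And>p. p \<in> topspace (total_space P) \<Longrightarrow> act P p \<one> = p"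
    and assoc: "\<And>p g g'. p \<in> topspace (total_space P) \<Longrightarrow> g \<in> carrier G \<Longrightarrow> g' \<in> carrier G \<Longrightarrow>
        act P (act P p g) g' = act P p (g \<otimes> g')"
    and fib: "\<And>p g. p \<in> topspace (total_space P) \<Longrightarrow> g \<in> carrier G \<Longrightarrow> proj P (act P p g) = proj P p"
    and sec: "\<And>m. m \<in> topspace M \<Longrightarrow> \<exists>U s. openin M U \<and> m \<in> U \<and>
        continuous_map (subtopology M U) (total_space P) s \<and> (\<forall>u\<in>U. proj P (s u) = u)"
    and d: "continuous_map (subtopology (prod_topology (total_space P) (total_space P))
        {z. proj P (fst z) = proj P (snd z)}) T (\<lambda>z. d (fst z) (snd z))"
    and d_act: "\<And>p g. p \<in> topspace (total_space P) \<Longrightarrow> g \<in> carrier G \<Longrightarrow> d p (act P p g) = g"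
    and act_d: "\<And>p q. p \<in> topspace (total_space P) \<Longrightarrow> q \<in> topspace (total_space P) \<Longrightarrow>
        proj P p = proj P q \<Longrightarrow> act P p (d p q) = q"
  shows "principal_bundle G T M P"
proof -
  have triv: "\<exists>U \<phi>. openin M U \<and> m \<in> U \<and>
        homeomorphic_map (prod_topology (subtopology M U) T)
          (subtopology (total_space P) {p \<in> topspace (total_space P). proj P p \<in> U}) \<phi> \<and>
        (\<forall>u\<in>U. \<forall>g\<in>carrier G. proj P (\<phi> (u, g)) = u \<and>
           (\<forall>g'\<in>carrier G. \<phi> (u, g \<otimes> g') = act P (\<phi> (u, g)) g'))" if m: "m \<in> topspace M" for m
  proof -
    obtain U s where U: "openin M U" "m \<in> U" and s: "continuous_map (subtopology M U) (total_space P) s"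
      and ps: "\<And>u. u \<in> U \<Longrightarrow> proj P (s u) = u"
      using sec[OF m] by blast
    have UM: "U \<subseteq> topspace M" using U(1) by (rule openin_subset)
    have sE: "s u \<in> topspace (total_space P)" if "u \<in> U" for u
      using continuous_map_in[OF s, of u] that UM by auto
    define \<phi> where "\<phi> = (\<lambda>(u, g). act P (s u) g)"
    define \<psi> where "\<psi> = (\<lambda>p. (proj P p, d (s (proj P p)) p))"
    let ?E = "subtopology (total_space P) {p \<in> topspace (total_space P). proj P p \<in> U}"
    have "continuous_map (prod_topology (subtopology M U) T) (total_space P) \<phi>"
      unfolding \<phi>_def case_prod_unfold
      by (rule continuous_map_comp_pair[OF act])
        (auto intro: continuous_map_comp[OF s] continuous_map_fst continuous_map_snd)
    moreover have "\<phi> z \<in> {p \<in> topspace (total_space P). proj P p \<in> U}"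
      if z: "z \<in> topspace (prod_topology (subtopology M U) T)" for z
      using z continuous_map_in[OF calculation z] fib sE ps
      by (auto simp: \<phi>_def topspace_eq_carrier)
    ultimately have \<phi>: "continuous_map (prod_topology (subtopology M U) T) ?E \<phi>"
      by (auto intro: continuous_map_into_subtopology)
    have sp: "continuous_map ?E (total_space P) (\<lambda>p. s (proj P p))"
      by (rule continuous_map_restrict_preimage[OF s proj])
    have "continuous_map ?E (total_space P) (\<lambda>p. p)"
      by (simp add: continuous_map_from_subtopology)
    with sp have "continuous_map ?E (prod_topology (total_space P) (total_space P)) (\<lambda>p. (s (proj P p), p))"
      by (rule continuous_map_pairedI)
    then have "continuous_map ?E (subtopology (prod_topology (total_space P) (total_space P))
        {z. proj P (fst z) = proj P (snd z)}) (\<lambda>p. (s (proj P p), p))"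
      by (rule continuous_map_into_subtopology) (simp add: ps)
    from continuous_map_comp[OF d this] have "continuous_map ?E T (\<lambda>p. d (s (proj P p)) p)"
      by simp
    moreover have "continuous_map ?E (subtopology M U) (proj P)"
      by (rule continuous_map_into_subtopology[OF continuous_map_from_subtopology[OF proj]]) auto
    ultimately have \<psi>: "continuous_map ?E (prod_topology (subtopology M U) T) \<psi>"
      unfolding \<psi>_def by (intro continuous_map_pairedI)
    have "homeomorphic_maps (prod_topology (subtopology M U) T) ?E \<phi> \<psi>"
      unfolding homeomorphic_maps_def using \<phi> \<psi>
      by (auto simp: \<phi>_def \<psi>_def fib sE ps d_act act_d topspace_eq_carrier)
    then have "homeomorphic_map (prod_topology (subtopology M U) T) ?E \<phi>"
      by (auto simp: homeomorphic_map_maps)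
    moreover have "\<phi> (u, g \<otimes> g') = act P (\<phi> (u, g)) g'" "proj P (\<phi> (u, g)) = u"
      if "u \<in> U" "g \<in> carrier G" "g' \<in> carrier G" for u g g'
      using that by (auto simp: \<phi>_def fib sE ps assoc)
    ultimately show ?thesis using U by (intro exI[of _ U] exI[of _ \<phi>]) blast
  qed
  show ?thesis
    unfolding principal_bundle_def by (intro conjI ballI proj act one assoc fib triv)
qed

section \<open>Sections, coordinates and division in a principal bundle\<close>

locale principal = topological_group G TG
  for G :: "('g, 'x) monoid_scheme" (structure) and TG :: "'g topology" +
  fixes M :: "'m topology" and P :: "('p, 'g, 'm, 'z) gbundle_scheme"
  assumes principal: "principal_bundle G TG M P"
begin

lemma proj_continuous: "continuous_map (total_space P) M (proj P)"
  and act_one [simp]: "p \<in> topspace (total_space P) \<Longrightarrow> act P p \<one> = p"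
  and act_act [simp]: "p \<in> topspace (total_space P) \<Longrightarrow> g \<in> carrier G \<Longrightarrow> g' \<in> carrier G \<Longrightarrow>
    act P (act P p g) g' = act P p (g \<otimes> g')"
  and proj_act [simp]: "p \<in> topspace (total_space P) \<Longrightarrow> g \<in> carrier G \<Longrightarrow>
    proj P (act P p g) = proj P p"
  and act_continuous: "continuous_map (prod_topology (total_space P) TG) (total_space P) (\<lambda>(p, g). act P p g)"
  and triv: "\<forall>m\<in>topspace M. \<exists>U \<phi>. openin M U \<and> m \<in> U \<and>
        homeomorphic_map (prod_topology (subtopology M U) TG)
          (subtopology (total_space P) {p \<in> topspace (total_space P). proj P p \<in> U}) \<phi> \<and>
        (\<forall>u\<in>U. \<forall>g\<in>carrier G. proj P (\<phi> (u, g)) = u \<and>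
           (\<forall>g'\<in>carrier G. \<phi> (u, g \<otimes> g') = act P (\<phi> (u, g)) g'))"
  using principal unfolding principal_bundle_def by simp_all

lemma proj_in [simp]: "p \<in> topspace (total_space P) \<Longrightarrow> proj P p \<in> topspace M"
  by (rule continuous_map_in[OF proj_continuous])

lemma act_in [simp]:
  "p \<in> topspace (total_space P) \<Longrightarrow> g \<in> carrier G \<Longrightarrow> act P p g \<in> topspace (total_space P)"
  using continuous_map_in[OF act_continuous, of "(p, g)"] by (simp add: topspace_eq_carrier)

lemma continuous_map_act:
  "continuous_map X (total_space P) f \<Longrightarrow> continuous_map X TG g \<Longrightarrow>
   continuous_map X (total_space P) (\<lambda>x. act P (f x) (g x))"
  by (rule continuous_map_comp_pair[OF act_continuous])

lemma continuous_map_proj: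
  "continuous_map X (total_space P) f \<Longrightarrow> continuous_map X M (\<lambda>x. proj P (f x))"
  by (rule continuous_map_comp[OF proj_continuous])

text \<open>The section is the trivialization at the unit, and the equivariant coordinate \<gamma>
  is the group component of its inverse. Later arguments use trivializations only in this
  form.\<close>

lemma local_trivialization:
  assumes m: "m \<in> topspace M"
  shows "\<exists>U s \<gamma>. openin M U \<and> m \<in> U \<and> continuous_map (subtopology M U) (total_space P) s \<and>
    (\<forall>u\<in>U. s u \<in> topspace (total_space P) \<and> proj P (s u) = u) \<and>
    continuous_map (subtopology (total_space P) {p \<in> topspace (total_space P). proj P p \<in> U}) TG \<gamma> \<and>
    (\<forall>p\<in>topspace (total_space P). proj P p \<in> U \<longrightarrow>
       \<gamma> p \<in> carrier G \<and> act P (s (proj P p)) (\<gamma> p) = p \<and>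
       (\<forall>g\<in>carrier G. \<gamma> (act P p g) = \<gamma> p \<otimes> g))"
proof -
  obtain U \<phi> where U: "openin M U" "m \<in> U"
    and hom: "homeomorphic_map (prod_topology (subtopology M U) TG)
          (subtopology (total_space P) {p \<in> topspace (total_space P). proj P p \<in> U}) \<phi>"
    and \<phi>': "\<forall>u\<in>U. \<forall>g\<in>carrier G. proj P (\<phi> (u, g)) = u \<and>
           (\<forall>g'\<in>carrier G. \<phi> (u, g \<otimes> g') = act P (\<phi> (u, g)) g')"
    using bspec[OF triv m] by (elim exE conjE) (rule that)
  have \<phi>: "\<And>u g. u \<in> U \<Longrightarrow> g \<in> carrier G \<Longrightarrow> proj P (\<phi> (u, g)) = u"
      "\<And>u g g'. u \<in> U \<Longrightarrow> g \<in> carrier G \<Longrightarrow> g' \<in> carrier G \<Longrightarrow> \<phi> (u, g \<otimes> g') = act P (\<phi> (u, g)) g'"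
    using \<phi>' by simp_all
  let ?E = "subtopology (total_space P) {p \<in> topspace (total_space P). proj P p \<in> U}"
  obtain \<psi> where "homeomorphic_maps (prod_topology (subtopology M U) TG) ?E \<phi> \<psi>"
    using hom by (auto simp: homeomorphic_map_maps)
  then have c: "continuous_map (prod_topology (subtopology M U) TG) ?E \<phi>"
      "continuous_map ?E (prod_topology (subtopology M U) TG) \<psi>"
    and \<psi>\<phi>: "\<And>u g. u \<in> U \<Longrightarrow> g \<in> carrier G \<Longrightarrow> \<psi> (\<phi> (u, g)) = (u, g)"
    and \<phi>\<psi>: "\<And>p. p \<in> topspace (total_space P) \<Longrightarrow> proj P p \<in> U \<Longrightarrow> \<phi> (\<psi> p) = p"
    using openin_subset[OF U(1)] by (auto simp: homeomorphic_maps_def topspace_eq_carrier)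
  have \<phi>in: "\<phi> (u, g) \<in> topspace (total_space P)" if "u \<in> U" "g \<in> carrier G" for u g
    using continuous_map_in[OF c(1), of "(u, g)"] that openin_subset[OF U(1)]
    by (auto simp: topspace_eq_carrier)
  have \<psi>in: "fst (\<psi> p) \<in> U" "snd (\<psi> p) \<in> carrier G"
    if "p \<in> topspace (total_space P)" "proj P p \<in> U" for p
    using continuous_map_in[OF c(2), of p] that by (auto simp: topspace_eq_carrier)
  have fst\<psi>: "fst (\<psi> p) = proj P p" if "p \<in> topspace (total_space P)" "proj P p \<in> U" for p
    using \<phi>(1)[OF \<psi>in[OF that]] \<phi>\<psi>[OF that] by simp
  have sc: "continuous_map (subtopology M U) (total_space P) (\<lambda>u. \<phi> (u, \<one>))"
    by (rule continuous_map_comp[OF continuous_map_into_fulltopology[OF c(1)]])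
      (auto intro: continuous_map_pairedI simp: topspace_eq_carrier)
  have \<gamma>c: "continuous_map ?E TG (\<lambda>p. snd (\<psi> p))"
    by (rule continuous_map_snd'[OF c(2)])
  have \<gamma>: "snd (\<psi> p) \<in> carrier G \<and> act P (\<phi> (proj P p, \<one>)) (snd (\<psi> p)) = p \<and>
       (\<forall>g\<in>carrier G. snd (\<psi> (act P p g)) = snd (\<psi> p) \<otimes> g)"
    if p: "p \<in> topspace (total_space P)" "proj P p \<in> U" for p
  proof (intro conjI ballI)
    show "snd (\<psi> p) \<in> carrier G" using \<psi>in[OF p] by simp
    have "\<phi> (proj P p, \<one> \<otimes> snd (\<psi> p)) = act P (\<phi> (proj P p, \<one>)) (snd (\<psi> p))"
      using \<psi>in[OF p] p by (intro \<phi>(2)) auto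
    moreover have "(proj P p, snd (\<psi> p)) = \<psi> p" using fst\<psi>[OF p] by (simp add: prod_eq_iff)
    ultimately show "act P (\<phi> (proj P p, \<one>)) (snd (\<psi> p)) = p"
      using \<psi>in[OF p] \<phi>\<psi>[OF p] by simp
    fix g assume g: "g \<in> carrier G"
    have "act P p g = act P (\<phi> (fst (\<psi> p), snd (\<psi> p))) g" using \<phi>\<psi>[OF p] by simp
    also have "\<dots> = \<phi> (fst (\<psi> p), snd (\<psi> p) \<otimes> g)" using \<psi>in[OF p] g by (intro \<phi>(2)[symmetric]) auto
    finally show "snd (\<psi> (act P p g)) = snd (\<psi> p) \<otimes> g"
      using \<psi>\<phi> \<psi>in[OF p] g by simp
  qed
  show ?thesis
    by (rule exI[of _ U], rule exI[of _ "\<lambda>u. \<phi> (u, \<one>)"], rule exI[of _ "\<lambda>p. snd (\<psi> p)"])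
      (intro conjI ballI impI U sc \<gamma>c; simp add: \<phi> \<phi>in \<gamma>)
qed

lemma local_section:
  assumes m: "m \<in> topspace M"
  shows "\<exists>U s. openin M U \<and> m \<in> U \<and> continuous_map (subtopology M U) (total_space P) s \<and>
    (\<forall>u\<in>U. s u \<in> topspace (total_space P) \<and> proj P (s u) = u)"
  using local_trivialization[OF m] by blast

lemma local_coordinate:
  assumes m: "m \<in> topspace M"
  shows "\<exists>U s \<gamma>. openin M U \<and> m \<in> U \<and> (\<forall>u\<in>U. s u \<in> topspace (total_space P)) \<and>
    continuous_map (subtopology (total_space P) {p \<in> topspace (total_space P). proj P p \<in> U}) TG \<gamma> \<and>
    (\<forall>p\<in>topspace (total_space P). proj P p \<in> U \<longrightarrow>
       \<gamma> p \<in> carrier G \<and> act P (s (proj P p)) (\<gamma> p) = p)"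
  and "\<exists>U \<gamma>. openin M U \<and> m \<in> U \<and>
    (\<forall>p\<in>topspace (total_space P). proj P p \<in> U \<longrightarrow>
       \<gamma> p \<in> carrier G \<and> (\<forall>g\<in>carrier G. \<gamma> (act P p g) = \<gamma> p \<otimes> g))"
  using local_trivialization[OF m] by blast+

lemma ex_point_over: "m \<in> topspace M \<Longrightarrow> \<exists>p\<in>topspace (total_space P). proj P p = m"
  using local_section[of m] by blast

text \<open>Freeness of the action is not an axiom of \<open>principal_bundle\<close>; it follows by
  cancelling in an equivariant coordinate.\<close>

lemma act_eq_iff:
  assumes "p \<in> topspace (total_space P)" "g \<in> carrier G" "g' \<in> carrier G"
  shows "act P p g = act P p g' \<longleftrightarrow> g = g'"
proof
  assume eq: "act P p g = act P p g'"
  obtain U \<gamma> where "proj P p \<in> U" and "\<forall>p\<in>topspace (total_space P). proj P p \<in> U \<longrightarrow>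
       \<gamma> p \<in> carrier G \<and> (\<forall>g\<in>carrier G. \<gamma> (act P p g) = \<gamma> p \<otimes> g)"
    using local_coordinate(2)[OF proj_in[OF assms(1)]] by blast
  then have "\<gamma> p \<in> carrier G" "\<gamma> p \<otimes> g = \<gamma> p \<otimes> g'"
    using assms eq by metis+
  then show "g = g'" using assms by simp
qed simp

text \<open>The division map of the bundle, also called its translation function: on two points of
  one fibre it is the quotient p^-1 q.\<close>

definition tr :: "'p \<Rightarrow> 'p \<Rightarrow> 'g" where
  "tr p q = (THE g. g \<in> carrier G \<and> act P p g = q)"

lemma tr_act [simp]:
  "p \<in> topspace (total_space P) \<Longrightarrow> g \<in> carrier G \<Longrightarrow> tr p (act P p g) = g"
  unfolding tr_def by (rule the_equality) (auto simp: act_eq_iff)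

text \<open>With p = s \<gamma>(p) and q = s \<gamma>(q), the common section point s cancels. The
  resulting formula uses only continuous operations, which is how \<open>tr\<close> is seen to be
  continuous.\<close>

lemma tr_eq_local:
  assumes p: "p \<in> topspace (total_space P)" "q \<in> topspace (total_space P)" "proj P p = proj P q" "proj P q \<in> U"
    and \<gamma>: "\<forall>p\<in>topspace (total_space P). proj P p \<in> U \<longrightarrow>
       \<gamma> p \<in> carrier G \<and> act P (s (proj P p)) (\<gamma> p) = p"
    and s: "\<forall>u\<in>U. s u \<in> topspace (total_space P)"
  shows "tr p q = inv (\<gamma> p) \<otimes> \<gamma> q" "act P p (inv (\<gamma> p) \<otimes> \<gamma> q) = q"
proof -
  have *: "act P (s (proj P q)) (\<gamma> p) = p" "act P (s (proj P q)) (\<gamma> q) = q"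
    "\<gamma> p \<in> carrier G" "\<gamma> q \<in> carrier G"
    using bspec[OF \<gamma> p(1)] bspec[OF \<gamma> p(2)] p by auto
  have "act P p (inv (\<gamma> p) \<otimes> \<gamma> q) = act P (act P (s (proj P q)) (\<gamma> p)) (inv (\<gamma> p) \<otimes> \<gamma> q)"
    using * by simp
  also have "\<dots> = act P (s (proj P q)) (\<gamma> p \<otimes> (inv (\<gamma> p) \<otimes> \<gamma> q))"
    using *(3,4) bspec[OF s p(4)] by simp
  also have "\<gamma> p \<otimes> (inv (\<gamma> p) \<otimes> \<gamma> q) = \<gamma> q"
    using *(3,4) by (simp add: m_assoc[symmetric])
  finally show "act P p (inv (\<gamma> p) \<otimes> \<gamma> q) = q" using * by simp
  then show "tr p q = inv (\<gamma> p) \<otimes> \<gamma> q"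
    using tr_act[OF p(1), of "inv (\<gamma> p) \<otimes> \<gamma> q"] * by simp
qed

lemma act_tr [simp]:
  assumes "p \<in> topspace (total_space P)" "q \<in> topspace (total_space P)" "proj P p = proj P q"
  shows "act P p (tr p q) = q" and "tr p q \<in> carrier G"
proof -
  obtain U s \<gamma> where U: "proj P q \<in> U" and s: "\<forall>u\<in>U. s u \<in> topspace (total_space P)"
    and \<gamma>: "\<forall>p\<in>topspace (total_space P). proj P p \<in> U \<longrightarrow>
       \<gamma> p \<in> carrier G \<and> act P (s (proj P p)) (\<gamma> p) = p"
    using local_coordinate(1)[OF proj_in[OF assms(2)]] by blast
  note * = tr_eq_local[OF assms U \<gamma> s]
  show "act P p (tr p q) = q" using * by simp
  show "tr p q \<in> carrier G" using * bspec[OF \<gamma> assms(1)] bspec[OF \<gamma> assms(2)] assms U by simp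
qed

lemma continuous_map_tr:
  assumes f: "continuous_map X (total_space P) f" and g: "continuous_map X (total_space P) g"
    and fg: "\<And>x. x \<in> topspace X \<Longrightarrow> proj P (f x) = proj P (g x)"
  shows "continuous_map X TG (\<lambda>x. tr (f x) (g x))"
proof (rule continuous_map_locally)
  fix x assume x: "x \<in> topspace X"
  then have gx: "proj P (g x) \<in> topspace M" using continuous_map_in[OF g] by simp
  obtain U s \<gamma> where U: "openin M U" "proj P (g x) \<in> U"
    and s: "\<forall>u\<in>U. s u \<in> topspace (total_space P)"
    and \<gamma>c: "continuous_map (subtopology (total_space P) {p \<in> topspace (total_space P). proj P p \<in> U}) TG \<gamma>"
    and \<gamma>: "\<forall>p\<in>topspace (total_space P). proj P p \<in> U \<longrightarrow>
       \<gamma> p \<in> carrier G \<and> act P (s (proj P p)) (\<gamma> p) = p"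
    using local_coordinate(1)[OF gx] by blast
  let ?V = "{x \<in> topspace X. proj P (g x) \<in> U}"
  have V: "openin X ?V"
    by (rule openin_continuous_map_preimage[OF continuous_map_proj[OF g] U(1)])
  have "continuous_map (subtopology X ?V) TG (\<lambda>x. inv (\<gamma> (f x)) \<otimes> \<gamma> (g x))"
    using fg continuous_map_in[OF f] continuous_map_in[OF g]
    by (intro continuous_map_mult continuous_map_inv continuous_map_comp[OF \<gamma>c]
        continuous_map_into_subtopology continuous_map_from_subtopology f g) auto
  then have "continuous_map (subtopology X ?V) TG (\<lambda>x. tr (f x) (g x))"
    by (rule continuous_map_eq)
      (use fg continuous_map_in[OF f] continuous_map_in[OF g] tr_eq_local(1)[OF _ _ _ _ \<gamma> s]
        in auto)
  then show "\<exists>V. openin X V \<and> x \<in> V \<and> continuous_map (subtopology X V) TG (\<lambda>x. tr (f x) (g x))"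
    using V x U(2) by blast
qed

text \<open>A local section writes \<open>h\<close> as \<open>F\<close> after a continuous map.
  Descending in this way avoids the question whether the product of \<open>Z\<close> with a quotient
  map is a quotient map; \<open>Z\<close> serves as the interval of a homotopy.\<close>

lemma proj_descends:
  assumes F: "continuous_map (prod_topology Z (total_space P)) Y F"
    and h: "\<And>z p. z \<in> topspace Z \<Longrightarrow> p \<in> topspace (total_space P) \<Longrightarrow> h (z, proj P p) = F (z, p)"
  shows "continuous_map (prod_topology Z M) Y h"
proof (rule continuous_map_locally)
  fix x assume x: "x \<in> topspace (prod_topology Z M)"
  then have "snd x \<in> topspace M" by auto
  then obtain U s where U: "openin M U" "snd x \<in> U"
    and sc: "continuous_map (subtopology M U) (total_space P) s"
    and s: "\<forall>u\<in>U. s u \<in> topspace (total_space P) \<and> proj P (s u) = u"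
    using local_section by blast
  let ?V = "{y \<in> topspace (prod_topology Z M). snd y \<in> U}"
  have "openin (prod_topology Z M) ?V"
    by (rule openin_continuous_map_preimage[OF continuous_map_snd U(1)])
  moreover have "continuous_map (subtopology (prod_topology Z M) ?V) Y (\<lambda>y. F (fst y, s (snd y)))"
    by (rule continuous_map_comp[OF F])
      (intro continuous_map_pairedI continuous_map_from_subtopology[OF continuous_map_fst]
        continuous_map_restrict_preimage[OF sc continuous_map_snd])
  then have "continuous_map (subtopology (prod_topology Z M) ?V) Y h"
  proof (rule continuous_map_eq)
    fix y assume "y \<in> topspace (subtopology (prod_topology Z M) ?V)"
    then show "F (fst y, s (snd y)) = h y"
      using h[of "fst y" "s (snd y)"] bspec[OF s, of "snd y"] by auto
  qed
  ultimately show "\<exists>V. openin (prod_topology Z M) V \<and> x \<in> V \<and>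
      continuous_map (subtopology (prod_topology Z M) V) Y h"
    using x U(2) by blast
qed

lemma proj_descends':
  assumes F: "continuous_map (total_space P) Y F"
    and h: "\<And>p. p \<in> topspace (total_space P) \<Longrightarrow> h (proj P p) = F p"
  shows "continuous_map M Y h"
proof -
  let ?Z = "discrete_topology {()}"
  have "continuous_map (prod_topology ?Z M) Y (\<lambda>z. h (snd z))"
    by (rule proj_descends[where F = "\<lambda>z. F (snd z)"])
      (auto intro: continuous_map_comp[OF F continuous_map_snd] simp: h)
  then have "continuous_map M Y (\<lambda>m. h (snd ((), m)))"
    by (rule continuous_map_comp) (auto intro: continuous_map_pairedI)
  then show ?thesis by simp
qed

end

text \<open>Free and transitive actions on the fibres make such a map bijective. The inverse is
  continuous because, with a local section s, it sends q over m to s(m) g, where g is q divided by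
  f(s(m)).\<close>

lemma equivariant_map_over_homeomorphic:
  fixes G (structure)
  assumes "principal G TG M P" "principal G TG M Q" and f: "equivariant_map G P Q f"
    and over: "\<And>p. p \<in> topspace (total_space P) \<Longrightarrow> proj Q (f p) = proj P p"
  shows "homeomorphic_map (total_space P) (total_space Q) f"
proof -
  interpret P: principal G TG M P by fact
  interpret Q: principal G TG M Q by fact
  have fc: "continuous_map (total_space P) (total_space Q) f"
    and eq: "\<And>p g. p \<in> topspace (total_space P) \<Longrightarrow> g \<in> carrier G \<Longrightarrow> f (act P p g) = act Q (f p) g"
    using f by (auto simp: equivariant_map_def)
  have fin: "f p \<in> topspace (total_space Q)" if "p \<in> topspace (total_space P)" for p
    using continuous_map_in[OF fc that] .
  have inj: "inj_on f (topspace (total_space P))"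
  proof (rule inj_onI)
    fix p q assume p: "p \<in> topspace (total_space P)" and q: "q \<in> topspace (total_space P)" and "f p = f q"
    then have pr: "proj P p = proj P q" using over by metis
    have "f q = act Q (f p) (P.tr p q)"
      using eq[OF p P.act_tr(2)[OF p q pr]] P.act_tr(1)[OF p q pr] by simp
    then have "P.tr p q = \<one>"
      using Q.act_eq_iff[OF fin[OF p] P.act_tr(2)[OF p q pr], of \<one>] \<open>f p = f q\<close> fin[OF p] by simp
    then show "p = q" using P.act_tr(1)[OF p q pr] p by simp
  qed
  define k where "k = inv_into (topspace (total_space P)) f"
  have surj: "f ` topspace (total_space P) = topspace (total_space Q)"
  proof (intro equalityI subsetI)
    fix q assume q: "q \<in> topspace (total_space Q)"
    then obtain p where p: "p \<in> topspace (total_space P)" "proj P p = proj Q q"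
      using P.ex_point_over[of "proj Q q"] by auto
    then have "f (act P p (Q.tr (f p) q)) = q"
      using eq over q fin by simp
    moreover have "act P p (Q.tr (f p) q) \<in> topspace (total_space P)"
      using p q over fin by simp
    ultimately show "q \<in> f ` topspace (total_space P)" by force
  qed (use fin in auto)
  have "continuous_map (total_space Q) (total_space P) k"
  proof (rule continuous_map_locally)
    fix q assume q: "q \<in> topspace (total_space Q)"
    obtain U s where U: "openin M U" "proj Q q \<in> U"
      and sc: "continuous_map (subtopology M U) (total_space P) s"
      and s: "\<forall>u\<in>U. s u \<in> topspace (total_space P) \<and> proj P (s u) = u"
      using P.local_section[OF Q.proj_in[OF q]] by blast
    let ?V = "{q \<in> topspace (total_space Q). proj Q q \<in> U}"
    have "openin (total_space Q) ?V"
      by (rule openin_continuous_map_preimage[OF Q.proj_continuous U(1)])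
    moreover have "continuous_map (subtopology (total_space Q) ?V) (total_space P)
        (\<lambda>q. act P (s (proj Q q)) (Q.tr (f (s (proj Q q))) q))"
      using s over
      by (intro P.continuous_map_act Q.continuous_map_tr continuous_map_comp[OF fc]
          continuous_map_restrict_preimage[OF sc Q.proj_continuous]) (auto intro: continuous_map_from_subtopology)
    then have "continuous_map (subtopology (total_space Q) ?V) (total_space P) k"
    proof (rule continuous_map_eq)
      fix z assume "z \<in> topspace (subtopology (total_space Q) ?V)"
      then have z: "z \<in> topspace (total_space Q)" "proj Q z \<in> U" by auto
      then have "f (act P (s (proj Q z)) (Q.tr (f (s (proj Q z))) z)) = z"
        using s over fin by (simp add: eq)
      then show "act P (s (proj Q z)) (Q.tr (f (s (proj Q z))) z) = k z"
        unfolding k_def using z s over fin by (intro inv_into_f_eq[OF inj, symmetric]) auto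
    qed
    ultimately show "\<exists>V. openin (total_space Q) V \<and> q \<in> V \<and>
        continuous_map (subtopology (total_space Q) V) (total_space P) k"
      using q U(2) by blast
  qed
  then have "homeomorphic_maps (total_space P) (total_space Q) f k"
    unfolding homeomorphic_maps_def k_def using fc inj surj
    by (auto simp: f_inv_into_f)
  then show ?thesis by (auto simp: homeomorphic_map_maps)
qed

section \<open>Equivariant maps into a contractible space\<close>

lemma contractible_space_contraction:
  assumes "contractible_space X"
  obtains c a where "continuous_map (prod_topology (top_of_set {0..1::real}) X) X c"
    and "\<And>x. c (0, x) = x" and "\<And>x. c (1, x) = a"
  using assms unfolding contractible_space_def homotopic_with_def by auto

text \<open>Over a trivializing set \<open>W\<close> with equivariant coordinate \<open>g\<close>, the contraction \<open>c\<close> yields the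
  equivariant self-map \<open>e \<mapsto> c(r \<sigma>(m), e g\<^sup>-\<^sup>1) g\<close>, which is the identity where the cutoff \<open>\<sigma>\<close>
  vanishes and forgets its argument where \<open>r \<sigma> = 1\<close>.  Composing these maps over a locally finite
  cover contracts the whole space equivariantly.\<close>

lemma equivariant_contraction:
  fixes G (structure) and P :: "('p, 'g, 'm, 'z) gbundle_scheme"
    and EG :: "('e, 'g, 'b, 'w) gbundle_scheme"
  assumes M: "paracompact_space M"
    and P: "principal G TG M P" and EG: "principal G TG BG EG"
    and contr: "contractible_space (total_space EG)"
  obtains A where
    "continuous_map (prod_topology (total_space P) (prod_topology (total_space EG) (top_of_set {0..1::real})))
       (total_space EG) A"
    and "\<And>p e. p \<in> topspace (total_space P) \<Longrightarrow> e \<in> topspace (total_space EG) \<Longrightarrow> A (p, e, 0) = e"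
    and "\<And>p e e'. p \<in> topspace (total_space P) \<Longrightarrow> e \<in> topspace (total_space EG) \<Longrightarrow>
        e' \<in> topspace (total_space EG) \<Longrightarrow> A (p, e, 1) = A (p, e', 1)"
    and "\<And>p e r g. p \<in> topspace (total_space P) \<Longrightarrow> e \<in> topspace (total_space EG) \<Longrightarrow> r \<in> {0..1} \<Longrightarrow>
        g \<in> carrier G \<Longrightarrow> A (act P p g, act EG e g, r) = act EG (A (p, e, r)) g"
proof -
  interpret P: principal G TG M P by fact
  interpret E: principal G TG BG EG by fact
  let ?I = "top_of_set {0..1::real}"
  let ?Y = "prod_topology (total_space P) (prod_topology (total_space EG) ?I)"
  obtain c e0 where c: "continuous_map (prod_topology ?I (total_space EG)) (total_space EG) c"
    and c0: "\<And>x. c (0, x) = x" and c1: "\<And>x. c (1, x) = e0"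
    by (rule contractible_space_contraction[OF contr]) (rule that)
  have c_in: "c (r, e) \<in> topspace (total_space EG)" if "r \<in> {0..1}" "e \<in> topspace (total_space EG)" for r e
    using continuous_map_in[OF c, of "(r, e)"] that by simp
  define \<U> where "\<U> = {U. openin M U \<and> (\<exists>s. continuous_map (subtopology M U) (total_space P) s \<and>
    (\<forall>u\<in>U. s u \<in> topspace (total_space P) \<and> proj P (s u) = u))}"
  have op: "\<forall>U\<in>\<U>. openin M U" by (simp add: \<U>_def)
  have "\<Union>\<U> = topspace M"
  proof
    show "\<Union>\<U> \<subseteq> topspace M" using op openin_subset[of M] by blast
    show "topspace M \<subseteq> \<Union>\<U>"
      using P.local_section unfolding \<U>_def by blast
  qed
  then obtain \<O> C \<sigma> where lf: "locally_finite_in M \<O>"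
    and opW: "\<And>W. W \<in> \<O> \<Longrightarrow> openin M W" and ref: "\<And>W. W \<in> \<O> \<Longrightarrow> \<exists>U\<in>\<U>. W \<subseteq> U"
    and cl: "\<And>W. W \<in> \<O> \<Longrightarrow> closedin M (C W)" and CW: "\<And>W. W \<in> \<O> \<Longrightarrow> C W \<subseteq> W"
    and \<sigma>c: "\<And>W. W \<in> \<O> \<Longrightarrow> continuous_map M ?I (\<sigma> W)"
    and \<sigma>0: "\<And>W m. W \<in> \<O> \<Longrightarrow> m \<in> topspace M - C W \<Longrightarrow> \<sigma> W m = 0"
    and \<sigma>1: "\<And>m. m \<in> topspace M \<Longrightarrow> \<exists>W\<in>\<O>. m \<in> W \<and> \<sigma> W m = 1"
    by (rule paracompact_space_cutoffs[OF M op]) (rule that)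
  have \<sigma>I: "\<sigma> W m \<in> {0..1}" if "W \<in> \<O>" "m \<in> topspace M" for W m
    using continuous_map_in[OF \<sigma>c[OF that(1)] that(2)] by simp
  have "\<exists>s. continuous_map (subtopology M W) (total_space P) s \<and>
      (\<forall>u\<in>W. s u \<in> topspace (total_space P) \<and> proj P (s u) = u)" if W: "W \<in> \<O>" for W
  proof -
    obtain U where U: "U \<in> \<U>" "W \<subseteq> U" using ref[OF W] by blast
    then obtain s where "continuous_map (subtopology M U) (total_space P) s"
      "\<forall>u\<in>U. s u \<in> topspace (total_space P) \<and> proj P (s u) = u" by (auto simp: \<U>_def)
    then show ?thesis
      using U(2) continuous_map_from_subtopology_mono[of M U "total_space P" s W]
      by (intro exI[of _ s]) auto
  qed
  then obtain s where sc: "\<And>W. W \<in> \<O> \<Longrightarrow> continuous_map (subtopology M W) (total_space P) (s W)"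
    and s: "\<And>W u. W \<in> \<O> \<Longrightarrow> u \<in> W \<Longrightarrow> s W u \<in> topspace (total_space P) \<and> proj P (s W u) = u"
    by metis
  define g where "g W p = P.tr (s W (proj P p)) p" for W p
  have g_in: "g W p \<in> carrier G" if "W \<in> \<O>" "p \<in> topspace (total_space P)" "proj P p \<in> W" for W p
    unfolding g_def using s[OF that(1,3)] that(2) by simp
  have g_act: "g W (act P p a) = g W p \<otimes>\<^bsub>G\<^esub> a"
    if "W \<in> \<O>" "p \<in> topspace (total_space P)" "proj P p \<in> W" "a \<in> carrier G" for W p a
  proof -
    have "act P (s W (proj P p)) (g W p \<otimes>\<^bsub>G\<^esub> a) = act P p a"
      using s[OF that(1,3)] that g_in[OF that(1-3)]
      by (simp add: P.act_act[symmetric] del: P.act_act) (simp add: g_def)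
    then show ?thesis
      using P.tr_act[of "s W (proj P p)" "g W p \<otimes>\<^bsub>G\<^esub> a"] s[OF that(1,3)] that g_in[OF that(1-3)]
      by (simp add: g_def)
  qed
  define k where "k W p r e = act EG (c (r * \<sigma> W (proj P p), act EG e (inv\<^bsub>G\<^esub> (g W p)))) (g W p)" for W p r e
  have r\<sigma>: "r * \<sigma> W m \<in> {0..1}" if "W \<in> \<O>" "m \<in> topspace M" "r \<in> {0..1}" for W m r
    using \<sigma>I[OF that(1,2)] that(3) by (auto simp: mult_le_one)
  have k_in: "k W p r e \<in> topspace (total_space EG)"
    if "W \<in> \<O>" "p \<in> topspace (total_space P)" "proj P p \<in> W" "r \<in> {0..1}" "e \<in> topspace (total_space EG)" for W p r e
    unfolding k_def using that r\<sigma>[of W "proj P p" r] g_in[of W p] by (intro E.act_in c_in) auto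
  have k_0: "k W p r e = e"
    if "W \<in> \<O>" "p \<in> topspace (total_space P)" "proj P p \<in> W" "r * \<sigma> W (proj P p) = 0" "e \<in> topspace (total_space EG)" for W p r e
    unfolding k_def that(4) c0 using that g_in[of W p] by simp
  have k_1: "k W p 1 e = k W p 1 e'" if "\<sigma> W (proj P p) = 1" for W p e e'
    using that by (simp add: k_def c1)
  have k_act: "k W (act P p a) r (act EG e a) = act EG (k W p r e) a"
    if "W \<in> \<O>" "p \<in> topspace (total_space P)" "proj P p \<in> W" "r \<in> {0..1}" "e \<in> topspace (total_space EG)"
      "a \<in> carrier G" for W p r e a
  proof -
    have 1: "g W p \<in> carrier G" using g_in that by simp
    \<comment> \<open>Replacing p by p a turns g into g a, and e a (g a)^-1 = e g^-1. So the point
      fed to \<open>c\<close> is unchanged and only the last translation acquires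
      \<open>a\<close>.\<close>
    have "a \<otimes>\<^bsub>G\<^esub> inv\<^bsub>G\<^esub> (g W p \<otimes>\<^bsub>G\<^esub> a) = inv\<^bsub>G\<^esub> (g W p)"
      using 1 that(6) by (simp add: P.inv_mult_group P.m_assoc[symmetric])
    then have "act EG (act EG e a) (inv\<^bsub>G\<^esub> (g W p \<otimes>\<^bsub>G\<^esub> a)) = act EG e (inv\<^bsub>G\<^esub> (g W p))"
      using that 1 by simp
    then show ?thesis
      unfolding k_def using that 1 r\<sigma>[OF that(1) _ that(4), of "proj P p"]
      by (simp add: g_act c_in)
  qed
  \<comment> \<open>\<open>r\<close> rides along unchanged, so that the fold lemma yields continuity
    jointly in p, e and r. The default off \<open>W\<close> is the identity, in agreement with
    \<open>k\<close> where the cutoff is 0.\<close>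
  define f where "f = (\<lambda>W (p, e, r). if proj P p \<in> W then (p, k W p r e, r) else (p, e, r))"
  define \<pi> where "\<pi> y = proj P (fst y)" for y :: "'p \<times> 'e \<times> real"
  have \<pi>: "continuous_map ?Y M \<pi>"
    unfolding \<pi>_def by (intro P.continuous_map_proj continuous_map_fst)
  have fc: "continuous_map (subtopology ?Y {y \<in> topspace ?Y. \<pi> y \<in> W}) ?Y (f W)" if W: "W \<in> \<O>" for W
  proof -
    let ?S = "subtopology ?Y {y \<in> topspace ?Y. \<pi> y \<in> W}"
    have 1: "continuous_map ?S (total_space P) (\<lambda>y. fst y)"
      and 2: "continuous_map ?S (total_space EG) (\<lambda>y. fst (snd y))"
      and 3: "continuous_map ?S ?I (\<lambda>y. snd (snd y))"
      by (rule continuous_map_from_subtopology, rule continuous_map_fst continuous_map_fst'[OF continuous_map_snd]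
        continuous_map_snd'[OF continuous_map_snd])+
    have 4: "continuous_map ?S (total_space P) (\<lambda>y. s W (\<pi> y))"
      by (rule continuous_map_restrict_preimage[OF sc[OF W] \<pi>])
    have 5: "continuous_map ?S TG (\<lambda>y. g W (fst y))"
      unfolding g_def using 4 1
      by (intro P.continuous_map_tr) (use s[OF W] in \<open>auto simp: \<pi>_def\<close>)
    have 6: "continuous_map ?S ?I (\<lambda>y. snd (snd y) * \<sigma> W (\<pi> y))"
    proof (rule continuous_map_into_subtopology)
      have "continuous_map ?S euclideanreal (\<lambda>y. \<sigma> W (\<pi> y))"
        using continuous_map_comp[OF \<sigma>c[OF W] \<pi>]
        by (auto simp: continuous_map_in_subtopology intro: continuous_map_from_subtopology)
      then show "continuous_map ?S euclideanreal (\<lambda>y. snd (snd y) * \<sigma> W (\<pi> y))"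
        using 3 by (intro continuous_map_real_mult) (auto simp: continuous_map_in_subtopology)
      show "(\<lambda>y. snd (snd y) * \<sigma> W (\<pi> y)) \<in> topspace ?S \<rightarrow> {0..1}"
        using r\<sigma>[OF W] continuous_map_in[OF \<pi>] by (auto simp: \<pi>_def)
    qed
    have "continuous_map ?S ?Y (\<lambda>y. (fst y, act EG (c (snd (snd y) * \<sigma> W (\<pi> y),
        act EG (fst (snd y)) (inv\<^bsub>G\<^esub> (g W (fst y))))) (g W (fst y)), snd (snd y)))"
      by (intro continuous_map_pairedI E.continuous_map_act continuous_map_comp[OF c]
          P.continuous_map_inv 1 2 3 5 6)
    then show ?thesis
      by (rule continuous_map_eq) (auto simp: f_def k_def \<pi>_def)
  qed
  have fib: "\<pi> (f W y) = \<pi> y" for W y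
    by (auto simp: f_def \<pi>_def split: prod.splits)
  have triv: "f W y = y" if "W \<in> \<O>" "y \<in> topspace ?Y" "\<pi> y \<notin> C W" for W y
  proof -
    have "\<sigma> W (\<pi> y) = 0" using \<sigma>0[OF that(1)] that(3) continuous_map_in[OF \<pi> that(2)] by simp
    then show ?thesis
      using that k_0[OF that(1)] by (auto simp: f_def \<pi>_def)
  qed
  obtain L where L: "\<And>m. m \<in> topspace M \<Longrightarrow> set (L m) = {W \<in> \<O>. m \<in> W}"
    and Lc: "continuous_map ?Y ?Y (\<lambda>y. fold f (L (\<pi> y)) y)"
    by (rule locally_finite_fold_continuous[OF lf opW cl CW \<pi> fc fib triv]; (assumption | rule that))
  define A where "A y = fst (snd (fold f (L (\<pi> y)) y))" for y
  have fold_f: "fold f Ws (p, e, r) = (p, fold (\<lambda>W. k W p r) Ws e, r)"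
    if "\<forall>W\<in>set Ws. proj P p \<in> W" for Ws p e r
    using that by (induction Ws arbitrary: e) (auto simp: f_def)
  have A: "A (p, e, r) = fold (\<lambda>W. k W p r) (L (proj P p)) e" if "p \<in> topspace (total_space P)" for p e r
    using L[of "proj P p"] that by (simp add: A_def \<pi>_def fold_f)
  show thesis
  proof (rule that[of A])
    show "continuous_map ?Y (total_space EG) A"
      unfolding A_def by (rule continuous_map_fst'[OF continuous_map_snd'[OF Lc]])
  next
    fix p e assume *: "p \<in> topspace (total_space P)" "e \<in> topspace (total_space EG)"
    show "A (p, e, 0) = e"
      unfolding A[OF *(1)] by (rule fold_fixpoint) (use L[of "proj P p"] * k_0 in auto)
  next
    fix p e e' assume p: "p \<in> topspace (total_space P)"
      and e: "e \<in> topspace (total_space EG)" "e' \<in> topspace (total_space EG)"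
    obtain W where W: "W \<in> \<O>" "proj P p \<in> W" "\<sigma> W (proj P p) = 1"
      using \<sigma>1[of "proj P p"] p by auto
    show "A (p, e, 1) = A (p, e', 1)"
      unfolding A[OF p]
      by (rule fold_forgets[where S = "topspace (total_space EG)" and i = W])
        (use L[of "proj P p"] p e W k_in k_1[OF W(3)] in auto)
  next
    fix p e g and r :: real
    assume *: "p \<in> topspace (total_space P)" "e \<in> topspace (total_space EG)" "r \<in> {0..1}" "g \<in> carrier G"
    have "fold (\<lambda>W. k W (act P p g) r) (L (proj P p)) (act EG e g) =
        act EG (fold (\<lambda>W. k W p r) (L (proj P p)) e) g"
      by (rule fold_intertwine[where S = "topspace (total_space EG)" and h = "\<lambda>e. act EG e g"])
        (use L[of "proj P p"] * k_in k_act in auto)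
    then show "A (act P p g, act EG e g, r) = act EG (A (p, e, r)) g"
      using * by (simp add: A)
  qed
qed

section \<open>Parallel transport along homotopies of constant type\<close>

lemma openin_prod_topology_box:
  assumes "openin (prod_topology X Y) N" "(x, y) \<in> N"
  shows "\<exists>U V. openin X U \<and> openin Y V \<and> x \<in> U \<and> y \<in> V \<and> U \<times> V \<subseteq> N"
  using assms by (simp add: openin_prod_topology_alt)

text \<open>Phrased for short intervals containing \<open>r\<close>, the form in which
  \<open>Bolzano\<close> asks for local information.\<close>

lemma openin_unit_interval_ball:
  assumes "openin (top_of_set {0..1::real}) V" "r \<in> V"
  shows "\<exists>d>0. \<forall>a b. 0 \<le> a \<and> b \<le> 1 \<and> a \<le> r \<and> r \<le> b \<and> b - a < d \<longrightarrow> {a..b} \<subseteq> V"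
proof -
  obtain d where d: "d > 0" "ball r d \<inter> {0..1} \<subseteq> V"
    using assms unfolding openin_contains_ball by blast
  have "{a..b} \<subseteq> V" if "0 \<le> a" "b \<le> 1" "a \<le> r" "r \<le> b" "b - a < d" for a b
    using that d(2) by (auto simp: dist_real_def subset_iff)
  then show ?thesis using d(1) by blast
qed

context admissible_crossed_module
begin

section \<open>Lifting elements of t(G) to G near the identity\<close>

lemma group_hom_t: "group_hom G H t"
  by unfold_locales (rule t_hom)

lemma t_in [simp]: "g \<in> carrier G \<Longrightarrow> t g \<in> carrier H"
  and t_one [simp]: "t \<one>\<^bsub>G\<^esub> = \<one>\<^bsub>H\<^esub>"
  and t_mult [simp]: "g \<in> carrier G \<Longrightarrow> g' \<in> carrier G \<Longrightarrow> t (g \<otimes>\<^bsub>G\<^esub> g') = t g \<otimes>\<^bsub>H\<^esub> t g'"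
  and t_inv [simp]: "g \<in> carrier G \<Longrightarrow> t (inv\<^bsub>G\<^esub> g) = inv\<^bsub>H\<^esub> t g"
  using group_hom.hom_closed[OF group_hom_t] group_hom.hom_one[OF group_hom_t]
    group_hom.hom_mult[OF group_hom_t] group_hom.hom_inv[OF group_hom_t] by auto

lemma t_coset_kernel:
  assumes "g \<in> carrier G"
  shows "t ` (g <#\<^bsub>G\<^esub> kernel G H t) = {t g}"
proof -
  have "\<one>\<^bsub>G\<^esub> \<in> kernel G H t" by (simp add: kernel_def)
  then show ?thesis
    using assms by (auto simp: l_coset_def kernel_def image_iff)
qed

text \<open>Near 1, \<open>image_identification\<close> carries points of t(G) to cosets close to
  the trivial one, where G -> G/ker t has a local section. Only t(\<beta>(x)) = x is claimed, so
  \<beta>(1) may be any element of ker t.\<close>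

lemma local_lift_through_t:
  "\<exists>N \<beta>. openin TH N \<and> \<one>\<^bsub>H\<^esub> \<in> N \<and>
    continuous_map (subtopology TH (N \<inter> t ` carrier G)) TG \<beta> \<and>
    (\<forall>x\<in>N \<inter> t ` carrier G. t (\<beta> x) = x)"
proof -
  let ?K = "kernel G H t"
  let ?q = "\<lambda>g. g <#\<^bsub>G\<^esub> ?K"
  let ?C = "coset_space G TG ?K"
  let ?T = "subtopology TH (t ` carrier G)"
  have topC: "topspace ?C = ?q ` carrier G"
    by (simp add: coset_space_def G.topspace_eq_carrier)
  obtain r where r: "homeomorphic_maps ?C ?T (\<lambda>c. the_elem (t ` c)) r"
    using image_identification by (auto simp: homeomorphic_map_maps)
  have topT: "topspace ?T = t ` carrier G"
    unfolding topspace_subtopology H.topspace_eq_carrier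
    by (rule inf_absorb2) (simp add: image_subset_iff)
  have one: "?q \<one>\<^bsub>G\<^esub> \<in> topspace ?C" using topC by simp
  obtain U s where U: "openin ?C U" "?q \<one>\<^bsub>G\<^esub> \<in> U"
    and s: "continuous_map (subtopology ?C U) TG s" and qs: "\<forall>u\<in>U. ?q (s u) = u"
    using bspec[OF local_sections_G[unfolded admits_local_sections_def] one] by blast
  have rc: "continuous_map ?T ?C r" and qr: "\<And>x. x \<in> t ` carrier G \<Longrightarrow> the_elem (t ` r x) = x"
    and rq: "\<And>c. c \<in> topspace ?C \<Longrightarrow> r (the_elem (t ` c)) = c"
    using r topT unfolding homeomorphic_maps_def by auto
  have "openin ?T {x \<in> topspace ?T. r x \<in> U}"
    by (rule openin_continuous_map_preimage[OF rc U(1)])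
  then obtain N where N: "openin TH N" "{x \<in> topspace ?T. r x \<in> U} = N \<inter> t ` carrier G"
    unfolding openin_subtopology by blast
  have "r (the_elem (t ` ?q \<one>\<^bsub>G\<^esub>)) = ?q \<one>\<^bsub>G\<^esub>"
    by (rule rq[OF one])
  then have "r \<one>\<^bsub>H\<^esub> \<in> U"
    using U(2) by (simp add: t_coset_kernel)
  moreover have "\<one>\<^bsub>H\<^esub> \<in> t ` carrier G"
    by (rule image_eqI[of _ _ "\<one>\<^bsub>G\<^esub>"]) auto
  ultimately have 1: "\<one>\<^bsub>H\<^esub> \<in> N" using N(2) topT by blast
  have "subtopology ?T {x \<in> topspace ?T. r x \<in> U} = subtopology TH (N \<inter> t ` carrier G)"
    unfolding N(2) by (simp add: subtopology_subtopology inf_commute inf_left_commute)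
  moreover have "continuous_map (subtopology ?T {x \<in> topspace ?T. r x \<in> U}) TG (\<lambda>x. s (r x))"
    by (rule continuous_map_restrict_preimage[OF s rc])
  ultimately have 2: "continuous_map (subtopology TH (N \<inter> t ` carrier G)) TG (\<lambda>x. s (r x))"
    by simp
  have "t (s (r x)) = x" if x: "x \<in> N \<inter> t ` carrier G" for x
  proof -
    have rx: "r x \<in> U" using x N(2) by blast
    have "s (r x) \<in> carrier G"
      using continuous_map_in[OF 2, of x] x N(1) openin_subset[of TH N]
      by (auto simp: G.topspace_eq_carrier)
    then have "the_elem (t ` ?q (s (r x))) = t (s (r x))"
      by (simp add: t_coset_kernel)
    then show ?thesis using qs rx qr x by simp
  qed
  with N(1) 1 2 show ?thesis by blast
qed

section \<open>Horizontal lifts of homotopies of constant type\<close>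

lemma bibundleD:
  assumes "is_bibundle G TG H TH t M P"
  shows "principal G TG M P"
    and "continuous_map (total_space P) TH (structure_map P)"
    and "\<And>p. p \<in> topspace (total_space P) \<Longrightarrow> structure_map P p \<in> carrier H"
    and "\<And>p g. p \<in> topspace (total_space P) \<Longrightarrow> g \<in> carrier G \<Longrightarrow>
      structure_map P (act P p g) = structure_map P p \<otimes>\<^bsub>H\<^esub> t g"
proof -
  show "principal G TG M P"
    using assms by unfold_locales (simp add: is_bibundle_def)
  show *: "continuous_map (total_space P) TH (structure_map P)"
    using assms by (simp add: is_bibundle_def)
  show "structure_map P p \<in> carrier H" if "p \<in> topspace (total_space P)" for p
    using continuous_map_in[OF * that] by (simp add: H.topspace_eq_carrier)
  show "structure_map P (act P p g) = structure_map P p \<otimes>\<^bsub>H\<^esub> t g"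
    if "p \<in> topspace (total_space P)" "g \<in> carrier G" for p g
    using assms that by (simp add: is_bibundle_def)
qed

text \<open>Says that the coset modulo t(G) of the structure map over h(r, m) does not change with
  r. Phrasing it through points over h makes it meaningful for every bibundle \<open>E\<close>, so
  transport is proved without reference to EG x H.\<close>

definition constant_type ::
  "('p, 'g, 'n, 'h) bibundle \<Rightarrow> 'm topology \<Rightarrow> (real \<times> 'm \<Rightarrow> 'n) \<Rightarrow> bool" where
  "constant_type E M h \<longleftrightarrow> (\<forall>m\<in>topspace M. \<forall>r\<in>{0..1}. \<forall>r'\<in>{0..1}.
     \<forall>y\<in>topspace (total_space E). \<forall>y'\<in>topspace (total_space E).
       proj E y = h (r, m) \<longrightarrow> proj E y' = h (r', m) \<longrightarrow>
       inv\<^bsub>H\<^esub> structure_map E y \<otimes>\<^bsub>H\<^esub> structure_map E y' \<in> t ` carrier G)"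

lemma constant_typeD:
  assumes "constant_type E M h" "m \<in> topspace M" "r \<in> {0..1}" "r' \<in> {0..1}"
    "y \<in> topspace (total_space E)" "y' \<in> topspace (total_space E)"
    "proj E y = h (r, m)" "proj E y' = h (r', m)"
  shows "inv\<^bsub>H\<^esub> structure_map E y \<otimes>\<^bsub>H\<^esub> structure_map E y' \<in> t ` carrier G"
  using assms unfolding constant_type_def by blast

text \<open>The structure map of any local lift s(h(r, m)) differs from its value at r0 by some
  \<delta>(r, m) in t(G), and \<delta> = 1 at r0. Near r0 the discrepancy lifts to G through
  \<beta>, and translating by the inverse of the lifted element removes it.\<close>

lemma horizontal_local_lift:
  assumes E: "is_bibundle G TG H TH t X E"
    and h: "continuous_map (prod_topology (top_of_set {0..1::real}) M) X h"
    and const: "constant_type E M h"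
    and m0: "m0 \<in> topspace M" and r0: "r0 \<in> {0..1}"
  shows "\<exists>V U y. openin (top_of_set {0..1}) V \<and> r0 \<in> V \<and> openin M U \<and> m0 \<in> U \<and>
    continuous_map (subtopology (prod_topology (top_of_set {0..1}) M) (V \<times> U)) (total_space E) y \<and>
    (\<forall>r\<in>V. \<forall>m\<in>U. proj E (y (r, m)) = h (r, m) \<and>
       structure_map E (y (r, m)) = structure_map E (y (r0, m)))"
proof -
  interpret E: principal G TG X E by (rule bibundleD(1)[OF E])
  note \<psi> = bibundleD(2-4)[OF E]
  let ?I = "top_of_set {0..1::real}"
  let ?Z = "prod_topology ?I M"
  have "h (r0, m0) \<in> topspace X"
    using continuous_map_in[OF h, of "(r0, m0)"] m0 r0 by simp
  then obtain D s where D: "openin X D" "h (r0, m0) \<in> D"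
    and sc: "continuous_map (subtopology X D) (total_space E) s"
    and s: "\<forall>u\<in>D. s u \<in> topspace (total_space E) \<and> proj E (s u) = u"
    using E.local_section by blast
  let ?D = "{z \<in> topspace ?Z. h z \<in> D}"
  have Dop: "openin ?Z ?D" by (rule openin_continuous_map_preimage[OF h D(1)])
  have "(r0, m0) \<in> ?D" using D(2) m0 r0 by simp
  from openin_prod_topology_box[OF Dop this]
  obtain V1 U1 where V1: "openin ?I V1" "r0 \<in> V1" and U1: "openin M U1" "m0 \<in> U1" and VU1: "V1 \<times> U1 \<subseteq> ?D"
    by blast
  let ?B = "subtopology ?Z (V1 \<times> U1)"
  have topB: "topspace ?B = V1 \<times> U1"
    using VU1 by auto
  have y0: "continuous_map ?B (total_space E) (\<lambda>z. s (h z))"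
    using continuous_map_from_subtopology_mono[OF continuous_map_restrict_preimage[OF sc h] VU1] .
  have y0_in: "s (h z) \<in> topspace (total_space E)" "proj E (s (h z)) = h z" if "z \<in> V1 \<times> U1" for z
    using s VU1 that by auto
  have "continuous_map ?B ?I (\<lambda>z. r0)"
    using r0 by simp
  then have "continuous_map ?B ?Z (\<lambda>z. (r0, snd z))"
    by (rule continuous_map_pairedI) (rule continuous_map_from_subtopology[OF continuous_map_snd])
  moreover have "(\<lambda>z. (r0, snd z)) \<in> topspace ?B \<rightarrow> V1 \<times> U1"
    unfolding topB using V1(2) by auto
  ultimately have "continuous_map ?B ?B (\<lambda>z. (r0, snd z))"
    by (rule continuous_map_into_subtopology)
  from continuous_map_comp[OF y0 this]
  have y00: "continuous_map ?B (total_space E) (\<lambda>z. s (h (r0, snd z)))" .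
  define \<delta> where "\<delta> z = inv\<^bsub>H\<^esub> structure_map E (s (h (r0, snd z))) \<otimes>\<^bsub>H\<^esub> structure_map E (s (h z))" for z
  have \<delta>c: "continuous_map ?B TH \<delta>"
    unfolding \<delta>_def
    by (intro H.continuous_map_mult H.continuous_map_inv continuous_map_comp[OF \<psi>(1)] y0 y00)
  have \<delta>t: "\<delta> z \<in> t ` carrier G" if z: "z \<in> V1 \<times> U1" for z
    unfolding \<delta>_def
    by (rule constant_typeD[OF const, of "snd z" r0 "fst z"])
      (use z V1(2) y0_in[of z] y0_in[of "(r0, snd z)"] VU1 in \<open>auto simp: subset_iff\<close>)
  obtain N \<beta> where N: "openin TH N" "\<one>\<^bsub>H\<^esub> \<in> N"
    and \<beta>c: "continuous_map (subtopology TH (N \<inter> t ` carrier G)) TG \<beta>"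
    and \<beta>: "\<forall>x\<in>N \<inter> t ` carrier G. t (\<beta> x) = x"
    using local_lift_through_t by blast
  have \<delta>1: "\<delta> (r0, m) = \<one>\<^bsub>H\<^esub>" if "m \<in> U1" for m
    using y0_in[of "(r0, m)"] that V1(2) \<psi>(2) by (simp add: \<delta>_def)
  have "openin ?B {z \<in> topspace ?B. \<delta> z \<in> N}"
    by (rule openin_continuous_map_preimage[OF \<delta>c N(1)])
  moreover have "openin ?Z (V1 \<times> U1)"
    using V1(1) U1(1) by (simp add: openin_prod_Times_iff)
  ultimately have "openin ?Z {z \<in> topspace ?B. \<delta> z \<in> N}"
    using openin_open_subtopology by blast
  moreover have "(r0, m0) \<in> {z \<in> topspace ?B. \<delta> z \<in> N}"
    unfolding topB using V1(2) U1(2) \<delta>1 N(2) by simp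
  ultimately obtain V U where V: "openin ?I V" "r0 \<in> V" and U: "openin M U" "m0 \<in> U"
    and VU: "V \<times> U \<subseteq> {z \<in> topspace ?B. \<delta> z \<in> N}"
    using openin_prod_topology_box[of ?I M "{z \<in> topspace ?B. \<delta> z \<in> N}" r0 m0] by blast
  have VU': "z \<in> V1 \<times> U1" "\<delta> z \<in> N \<inter> t ` carrier G" if "z \<in> V \<times> U" for z
    using VU that \<delta>t[of z] unfolding topB by blast+
  have \<beta>_in: "\<beta> (\<delta> z) \<in> carrier G" if "z \<in> V \<times> U" for z
    using continuous_map_in[OF \<beta>c, of "\<delta> z"] VU'[OF that] openin_subset[OF N(1)]
    by (auto simp: G.topspace_eq_carrier)
  define y where "y z = act E (s (h z)) (inv\<^bsub>G\<^esub> \<beta> (\<delta> z))" for z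
  let ?C = "subtopology ?Z (V \<times> U)"
  have CB: "V \<times> U \<subseteq> V1 \<times> U1" using VU' by blast
  have "continuous_map ?C (subtopology TH (N \<inter> t ` carrier G)) \<delta>"
    using continuous_map_from_subtopology_mono[OF \<delta>c CB] VU'(2)
    by (intro continuous_map_into_subtopology) auto
  then have "continuous_map ?C TG (\<lambda>z. inv\<^bsub>G\<^esub> \<beta> (\<delta> z))"
    by (intro G.continuous_map_inv continuous_map_comp[OF \<beta>c])
  then have "continuous_map ?C (total_space E) y"
    unfolding y_def using continuous_map_from_subtopology_mono[OF y0 CB]
    by (intro E.continuous_map_act)
  moreover have "proj E (y z) = h z" "structure_map E (y z) = structure_map E (s (h (r0, snd z)))"
    if z: "z \<in> V \<times> U" for z
  proof -
    note 1 = VU'[OF z] \<beta>_in[OF z] y0_in[OF VU'(1)[OF z]]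
    show "proj E (y z) = h z" using 1 by (simp add: y_def)
    have 2: "s (h (r0, snd z)) \<in> topspace (total_space E)"
      using y0_in(1)[of "(r0, snd z)"] 1(1) V1(2) by auto
    have "structure_map E (y z) = structure_map E (s (h z)) \<otimes>\<^bsub>H\<^esub> inv\<^bsub>H\<^esub> \<delta> z"
      using 1 \<beta> by (simp add: y_def \<psi>(3))
    also have "inv\<^bsub>H\<^esub> \<delta> z = inv\<^bsub>H\<^esub> structure_map E (s (h z)) \<otimes>\<^bsub>H\<^esub> structure_map E (s (h (r0, snd z)))"
      unfolding \<delta>_def using 1 2 \<psi>(2) by (simp add: H.inv_mult_group)
    also have "structure_map E (s (h z)) \<otimes>\<^bsub>H\<^esub> \<dots> = structure_map E (s (h (r0, snd z)))"
      using 1 2 \<psi>(2) by (simp add: H.m_assoc[symmetric])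
    finally show "structure_map E (y z) = structure_map E (s (h (r0, snd z)))" .
  qed
  \<comment> \<open>The value just computed is that of s(h(r0, m)). Taking r = r0 shows that it is
    also the value at y(r0, m), even if \<beta>(1) is a nontrivial element of ker t.\<close>
  ultimately show ?thesis
    using V U by (intro exI[of _ V] exI[of _ U] exI[of _ y]) simp
qed

text \<open>Compactness of the interval in the form of \<open>Bolzano\<close>: lifts exist over
  short intervals, and lifts over two adjacent intervals can be joined at the price of intersecting
  their neighbourhoods of \<open>m0\<close>.\<close>

lemma horizontal_lift:
  assumes E: "is_bibundle G TG H TH t X E"
    and h: "continuous_map (prod_topology (top_of_set {0..1::real}) M) X h"
    and const: "constant_type E M h"
    and m0: "m0 \<in> topspace M"
  shows "\<exists>U y. openin M U \<and> m0 \<in> U \<and>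
    continuous_map (subtopology (prod_topology (top_of_set {0..1}) M) ({0..1} \<times> U)) (total_space E) y \<and>
    (\<forall>r\<in>{0..1}. \<forall>m\<in>U. proj E (y (r, m)) = h (r, m) \<and>
       structure_map E (y (r, m)) = structure_map E (y (0, m)))"
proof -
  interpret E: principal G TG X E by (rule bibundleD(1)[OF E])
  note \<psi> = bibundleD(2-4)[OF E]
  let ?I = "top_of_set {0..1::real}"
  let ?Z = "prod_topology ?I M"
  \<comment> \<open>Constancy is measured from the left end \<open>a\<close>, so each interval has
    its own reference time and joining two of them only has to match values at the common
    end.\<close>
  define lifts where "lifts a b U y \<longleftrightarrow> openin M U \<and> m0 \<in> U \<and>
      continuous_map (subtopology ?Z ({a..b} \<times> U)) (total_space E) y \<and>
      (\<forall>r\<in>{a..b}. \<forall>m\<in>U. proj E (y (r, m)) = h (r, m) \<and>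
         structure_map E (y (r, m)) = structure_map E (y (a, m)))" for a b U y
  \<comment> \<open>\<open>Bolzano\<close> also asks about short intervals that reach outside
    [0, 1], where \<open>h\<close> has no meaning; the guard on \<open>a\<close> and
    \<open>b\<close> makes the property vacuous there.\<close>
  have "0 \<le> (0::real) \<and> (0::real) \<le> 1 \<and> (1::real) \<le> 1 \<longrightarrow> (\<exists>U y. lifts 0 1 U y)"
  proof (rule Bolzano[where P = "\<lambda>a b. 0 \<le> a \<and> a \<le> b \<and> b \<le> 1 \<longrightarrow> (\<exists>U y. lifts a b U y)"])
    fix a b c :: real
    assume ab: "0 \<le> a \<and> a \<le> b \<and> b \<le> 1 \<longrightarrow> (\<exists>U y. lifts a b U y)"
      and bc: "0 \<le> b \<and> b \<le> c \<and> c \<le> 1 \<longrightarrow> (\<exists>U y. lifts b c U y)" and "a \<le> b" "b \<le> c"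
    show "0 \<le> a \<and> a \<le> c \<and> c \<le> 1 \<longrightarrow> (\<exists>U y. lifts a c U y)"
    proof
      assume ac: "0 \<le> a \<and> a \<le> c \<and> c \<le> 1"
      obtain U1 y1 U2 y2 where 1: "lifts a b U1 y1" and 2: "lifts b c U2 y2"
        using ab bc ac \<open>a \<le> b\<close> \<open>b \<le> c\<close> by auto
      have y1: "continuous_map (subtopology ?Z ({a..b} \<times> U1)) (total_space E) y1"
        and y2: "continuous_map (subtopology ?Z ({b..c} \<times> U2)) (total_space E) y2"
        and py1: "\<And>r m. r \<in> {a..b} \<Longrightarrow> m \<in> U1 \<Longrightarrow> proj E (y1 (r, m)) = h (r, m)"
        and py2: "\<And>r m. r \<in> {b..c} \<Longrightarrow> m \<in> U2 \<Longrightarrow> proj E (y2 (r, m)) = h (r, m)"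
        and sy1: "\<And>r m. r \<in> {a..b} \<Longrightarrow> m \<in> U1 \<Longrightarrow> structure_map E (y1 (r, m)) = structure_map E (y1 (a, m))"
        and sy2: "\<And>r m. r \<in> {b..c} \<Longrightarrow> m \<in> U2 \<Longrightarrow> structure_map E (y2 (r, m)) = structure_map E (y2 (b, m))"
        using 1 2 unfolding lifts_def by blast+
      define U where "U = U1 \<inter> U2"
      have U: "openin M U" "m0 \<in> U" using 1 2 unfolding lifts_def U_def by auto
      have UM: "m \<in> topspace M" if "m \<in> U" for m using openin_subset[OF U(1)] that by auto
      have y1_in: "y1 (r, m) \<in> topspace (total_space E)" if "r \<in> {a..b}" "m \<in> U" for r m
        using continuous_map_in[OF y1, of "(r, m)"] that ac \<open>b \<le> c\<close> UM by (auto simp: U_def)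
      have y2_in: "y2 (r, m) \<in> topspace (total_space E)" if "r \<in> {b..c}" "m \<in> U" for r m
        using continuous_map_in[OF y2, of "(r, m)"] that ac \<open>a \<le> b\<close> UM by (auto simp: U_def)
      \<comment> \<open>At time \<open>b\<close> the two lifts lie in the same fibre but need not
        agree. Translating the second by \<open>\<gamma> m\<close>, which depends on m and not on
        the time, makes them agree and keeps its structure map constant in time.\<close>
      define \<gamma> where "\<gamma> m = E.tr (y2 (b, m)) (y1 (b, m))" for m
      have bb: "b \<in> {a..b}" "b \<in> {b..c}" using \<open>a \<le> b\<close> \<open>b \<le> c\<close> by auto
      have \<gamma>: "\<gamma> m \<in> carrier G" "act E (y2 (b, m)) (\<gamma> m) = y1 (b, m)" if "m \<in> U" for m
        using y1_in[OF bb(1) that] y2_in[OF bb(2) that] py1[OF bb(1), of m] py2[OF bb(2), of m] that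
        by (auto simp: \<gamma>_def U_def)
      define y where "y z = (if fst z \<le> b then y1 z else act E (y2 z) (\<gamma> (snd z)))" for z
      let ?S = "subtopology ?Z ({a..c} \<times> U)"
      let ?L = "{z \<in> topspace ?S. fst z \<in> {..b}}" and ?R = "{z \<in> topspace ?S. fst z \<in> {b..}}"
      have topS: "topspace ?S = {a..c} \<times> U"
        using ac UM by auto
      have fstc: "continuous_map ?S euclideanreal fst"
        using continuous_map_fst[of ?I M]
        by (intro continuous_map_from_subtopology) (auto simp: continuous_map_in_subtopology)
      have clL: "closedin ?S ?L" by (rule closedin_continuous_map_preimage[OF fstc]) auto
      have clR: "closedin ?S ?R" by (rule closedin_continuous_map_preimage[OF fstc]) auto
      have cL: "continuous_map (subtopology ?S ?L) (total_space E) y1"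
        unfolding subtopology_subtopology
        by (rule continuous_map_from_subtopology_mono[OF y1]) (auto simp: U_def)
      have cR0: "continuous_map (subtopology ?S ?R) (total_space E) y2"
        unfolding subtopology_subtopology
        by (rule continuous_map_from_subtopology_mono[OF y2]) (auto simp: U_def)
      have "continuous_map (subtopology ?S ?R) ?Z (\<lambda>z. (b, snd z))"
        unfolding subtopology_subtopology using ac \<open>a \<le> b\<close> \<open>b \<le> c\<close>
        by (intro continuous_map_pairedI continuous_map_from_subtopology[OF continuous_map_snd]) auto
      then have cb: "continuous_map (subtopology ?S ?R) (subtopology ?Z ({a..b} \<times> U1)) (\<lambda>z. (b, snd z))"
        "continuous_map (subtopology ?S ?R) (subtopology ?Z ({b..c} \<times> U2)) (\<lambda>z. (b, snd z))"
        using \<open>a \<le> b\<close> \<open>b \<le> c\<close> by (auto simp: continuous_map_in_subtopology U_def)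
      have "continuous_map (subtopology ?S ?R) TG (\<lambda>z. \<gamma> (snd z))"
        unfolding \<gamma>_def
        by (rule E.continuous_map_tr[OF continuous_map_comp[OF y2 cb(2)] continuous_map_comp[OF y1 cb(1)]])
          (use bb py1 py2 in \<open>auto simp: U_def\<close>)
      then have cR: "continuous_map (subtopology ?S ?R) (total_space E) (\<lambda>z. act E (y2 z) (\<gamma> (snd z)))"
        by (rule E.continuous_map_act[OF cR0])
      have "continuous_map ?S (total_space E) y"
      proof (rule pasting_lemma_closed[where I = UNIV and T = "\<lambda>l. if l then ?L else ?R"
            and f = "\<lambda>l z. if l then y1 z else act E (y2 z) (\<gamma> (snd z))"])
        fix i j :: bool and z
        assume "z \<in> topspace ?S \<inter> (if i then ?L else ?R) \<inter> (if j then ?L else ?R)"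
        then show "(if i then y1 z else act E (y2 z) (\<gamma> (snd z))) =
            (if j then y1 z else act E (y2 z) (\<gamma> (snd z)))"
          using \<gamma>(2)[of "snd z"] by (cases z) (auto split: if_splits)
      next
        fix z assume "z \<in> topspace ?S"
        then show "\<exists>j. j \<in> UNIV \<and> z \<in> (if j then ?L else ?R) \<and>
            y z = (if j then y1 z else act E (y2 z) (\<gamma> (snd z)))"
          by (intro exI[of _ "fst z \<le> b"]) (auto simp: y_def)
      qed (use clL clR cL cR in simp_all)
      moreover have "proj E (y (r, m)) = h (r, m) \<and> structure_map E (y (r, m)) = structure_map E (y (a, m))"
        if r: "r \<in> {a..c}" and m: "m \<in> U" for r m
      proof (cases "r \<le> b")
        case True
        then show ?thesis using py1[of r m] sy1[of r m] r m \<open>a \<le> b\<close> by (simp add: y_def U_def)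
      next
        case False
        then have r': "r \<in> {b..c}" using r by simp
        have "structure_map E (act E (y2 (r, m)) (\<gamma> m)) = structure_map E (act E (y2 (b, m)) (\<gamma> m))"
          using \<gamma>(1)[OF m] y2_in[OF r' m] y2_in[OF bb(2) m] sy2[OF r', of m] m
          by (simp add: \<psi>(3) U_def)
        also have "\<dots> = structure_map E (y1 (a, m))"
          using \<gamma>(2)[OF m] sy1[OF bb(1), of m] m by (simp add: U_def)
        finally show ?thesis
          using False \<gamma>(1)[OF m] y2_in[OF r' m] py2[OF r', of m] m \<open>a \<le> b\<close>
          by (simp add: y_def U_def)
      qed
      ultimately have "lifts a c U y" unfolding lifts_def using U by blast
      then show "\<exists>U y. lifts a c U y" by blast
    qed
  next
    fix x :: real assume "0 \<le> x" "x \<le> 1"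
    then have "x \<in> {0..1}" by simp
    from horizontal_local_lift[OF E h const m0 this]
    obtain V U y where V: "openin ?I V" "x \<in> V" and U: "openin M U" "m0 \<in> U"
      and y: "continuous_map (subtopology ?Z (V \<times> U)) (total_space E) y"
      and py: "\<forall>r\<in>V. \<forall>m\<in>U. proj E (y (r, m)) = h (r, m) \<and>
         structure_map E (y (r, m)) = structure_map E (y (x, m))"
      by blast
    obtain d where d: "d > 0"
      "\<forall>a b. 0 \<le> a \<and> b \<le> 1 \<and> a \<le> x \<and> x \<le> b \<and> b - a < d \<longrightarrow> {a..b} \<subseteq> V"
      using openin_unit_interval_ball[OF V] by blast
    have "lifts a b U y" if "a \<le> x \<and> x \<le> b \<and> b - a < d" "0 \<le> a \<and> a \<le> b \<and> b \<le> 1" for a b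
    proof -
      have abV: "{a..b} \<subseteq> V" using d(2) that by auto
      have "continuous_map (subtopology ?Z ({a..b} \<times> U)) (total_space E) y"
        by (rule continuous_map_from_subtopology_mono[OF y]) (use abV in auto)
      moreover have "proj E (y (r, m)) = h (r, m) \<and> structure_map E (y (r, m)) = structure_map E (y (a, m))"
        if "r \<in> {a..b}" "m \<in> U" for r m
      proof -
        have "r \<in> V" "a \<in> V" using that(1) abV by auto
        then show ?thesis using py that(2) by metis
      qed
      ultimately show ?thesis
        unfolding lifts_def using U by blast
    qed
    then show "\<exists>d>0. \<forall>a b. a \<le> x \<and> x \<le> b \<and> b - a < d \<longrightarrow>
        0 \<le> a \<and> a \<le> b \<and> b \<le> 1 \<longrightarrow> (\<exists>U y. lifts a b U y)"
      using d(1) by blast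
  qed simp
  then obtain U y where "lifts 0 1 U y" by auto
  then show ?thesis unfolding lifts_def by blast
qed

text \<open>Over a set \<open>W\<close> with a horizontal lift \<open>\<eta>\<close>, the fibre over \<open>h(r, m)\<close> is moved to the fibre over
  \<open>h(max r (\<sigma> m), m)\<close>.  Composing these moves over a locally finite cover transports from time
  \<open>0\<close> to time \<open>1\<close>, because some cutoff \<open>\<sigma>\<close> reaches \<open>1\<close> at every point.\<close>

lemma parallel_transport:
  fixes E :: "('p, 'g, 'n, 'h) bibundle" and M :: "'m topology"
  assumes M: "paracompact_space M" and E: "is_bibundle G TG H TH t X E"
    and h: "continuous_map (prod_topology (top_of_set {0..1::real}) M) X h"
    and const: "constant_type E M h"
  shows "\<exists>\<tau>. continuous_map (subtopology (prod_topology M (total_space E)) {z. proj E (snd z) = h (0, fst z)})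
      (total_space E) \<tau> \<and>
    (\<forall>m\<in>topspace M. \<forall>y\<in>topspace (total_space E). proj E y = h (0, m) \<longrightarrow>
       proj E (\<tau> (m, y)) = h (1, m) \<and> structure_map E (\<tau> (m, y)) = structure_map E y \<and>
       (\<forall>g\<in>carrier G. \<tau> (m, act E y g) = act E (\<tau> (m, y)) g))"
proof -
  interpret E: principal G TG X E by (rule bibundleD(1)[OF E])
  note \<psi> = bibundleD(2-4)[OF E]
  let ?I = "top_of_set {0..1::real}"
  let ?Z = "prod_topology ?I M"
  let ?TE = "total_space E"
  define lift where "lift U y \<longleftrightarrow>
    continuous_map (subtopology ?Z ({0..1} \<times> U)) ?TE y \<and>
    (\<forall>r\<in>{0..1}. \<forall>m\<in>U. proj E (y (r, m)) = h (r, m) \<and>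
       structure_map E (y (r, m)) = structure_map E (y (0, m)))" for U y
  define \<U> where "\<U> = {U. openin M U \<and> (\<exists>y. lift U y)}"
  have op: "\<forall>U\<in>\<U>. openin M U" by (simp add: \<U>_def)
  have "\<Union>\<U> = topspace M"
  proof
    show "\<Union>\<U> \<subseteq> topspace M" using op openin_subset[of M] by blast
    show "topspace M \<subseteq> \<Union>\<U>"
    proof
      fix m assume m: "m \<in> topspace M"
      obtain U y where "openin M U" "m \<in> U" "lift U y"
        using horizontal_lift[OF E h const m] unfolding lift_def by blast
      then show "m \<in> \<Union>\<U>" unfolding \<U>_def by blast
    qed
  qed
  then obtain \<O> C \<sigma> where lf: "locally_finite_in M \<O>"
    and opW: "\<And>W. W \<in> \<O> \<Longrightarrow> openin M W" and ref: "\<And>W. W \<in> \<O> \<Longrightarrow> \<exists>U\<in>\<U>. W \<subseteq> U"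
    and cl: "\<And>W. W \<in> \<O> \<Longrightarrow> closedin M (C W)" and CW: "\<And>W. W \<in> \<O> \<Longrightarrow> C W \<subseteq> W"
    and \<sigma>c: "\<And>W. W \<in> \<O> \<Longrightarrow> continuous_map M ?I (\<sigma> W)"
    and \<sigma>0: "\<And>W m. W \<in> \<O> \<Longrightarrow> m \<in> topspace M - C W \<Longrightarrow> \<sigma> W m = 0"
    and \<sigma>1: "\<And>m. m \<in> topspace M \<Longrightarrow> \<exists>W\<in>\<O>. m \<in> W \<and> \<sigma> W m = 1"
    by (rule paracompact_space_cutoffs[OF M op]) (rule that)
  have WM: "m \<in> topspace M" if "W \<in> \<O>" "m \<in> W" for W m
    using openin_subset[OF opW[OF that(1)]] that(2) by auto
  have \<sigma>I: "0 \<le> \<sigma> W m \<and> \<sigma> W m \<le> 1" if "W \<in> \<O>" "m \<in> topspace M" for W m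
    using continuous_map_in[OF \<sigma>c[OF that(1)] that(2)] by simp
  have "\<exists>y. lift W y" if W: "W \<in> \<O>" for W
  proof -
    obtain U where U: "U \<in> \<U>" "W \<subseteq> U" using ref[OF W] by blast
    then obtain y where y: "lift U y" by (auto simp: \<U>_def)
    have "continuous_map (subtopology ?Z ({0..1} \<times> W)) ?TE y"
      by (rule continuous_map_from_subtopology_mono[of _ "{0..1} \<times> U"])
        (use y U(2) in \<open>auto simp: lift_def\<close>)
    then have "lift W y" using y U(2) unfolding lift_def by blast
    then show ?thesis by blast
  qed
  then obtain \<eta> where "\<And>W. W \<in> \<O> \<Longrightarrow> lift W (\<eta> W)" by metis
  then have \<eta>c: "\<And>W. W \<in> \<O> \<Longrightarrow> continuous_map (subtopology ?Z ({0..1} \<times> W)) ?TE (\<eta> W)"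
    and p\<eta>: "\<And>W r m. W \<in> \<O> \<Longrightarrow> r \<in> {0..1} \<Longrightarrow> m \<in> W \<Longrightarrow> proj E (\<eta> W (r, m)) = h (r, m)"
    and \<psi>\<eta>: "\<And>W r m. W \<in> \<O> \<Longrightarrow> r \<in> {0..1} \<Longrightarrow> m \<in> W \<Longrightarrow>
      structure_map E (\<eta> W (r, m)) = structure_map E (\<eta> W (0, m))"
    unfolding lift_def by blast+
  have \<eta>_in: "\<eta> W (r, m) \<in> topspace ?TE" if "W \<in> \<O>" "r \<in> {0..1}" "m \<in> W" for W r m
    using continuous_map_in[OF \<eta>c[OF that(1)], of "(r, m)"] that WM by simp
  \<comment> \<open>Write e as \<eta>(r, m) g and return \<eta>(r', m) g for the later time r' = max
    r \<sigma>. With \<open>max\<close> the times stay in [0, 1], a cutoff 0 moves nothing, and a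
    time that has reached 1 is never lost.\<close>
  define k where "k W m r e = act E (\<eta> W (max r (\<sigma> W m), m)) (E.tr (\<eta> W (r, m)) e)" for W m r e
  have mx: "max r (\<sigma> W m) \<in> {0..1}" if "W \<in> \<O>" "m \<in> W" "r \<in> {0..1}" for W m r
    using \<sigma>I[OF that(1) WM[OF that(1,2)]] that(3) by auto
  have k: "k W m r e \<in> topspace ?TE" "proj E (k W m r e) = h (max r (\<sigma> W m), m)"
      "structure_map E (k W m r e) = structure_map E e"
    if W: "W \<in> \<O>" "m \<in> W" and r: "r \<in> {0..1}" and e: "e \<in> topspace ?TE" "proj E e = h (r, m)" for W m r e
  proof -
    let ?r = "max r (\<sigma> W m)"
    note mx' = mx[OF W r]
    have 1: "\<eta> W (r, m) \<in> topspace ?TE" "\<eta> W (?r, m) \<in> topspace ?TE"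
      using \<eta>_in[OF W(1) r W(2)] \<eta>_in[OF W(1) mx' W(2)] .
    have pe: "proj E (\<eta> W (r, m)) = proj E e" using p\<eta>[OF W(1) r W(2)] e(2) by simp
    note tr = E.act_tr[OF 1(1) e(1) pe]
    show "k W m r e \<in> topspace ?TE" unfolding k_def by (rule E.act_in[OF 1(2) tr(2)])
    show "proj E (k W m r e) = h (?r, m)"
      unfolding k_def E.proj_act[OF 1(2) tr(2)] by (rule p\<eta>[OF W(1) mx' W(2)])
    have "structure_map E (k W m r e) = structure_map E (\<eta> W (?r, m)) \<otimes>\<^bsub>H\<^esub> t (E.tr (\<eta> W (r, m)) e)"
      unfolding k_def by (rule \<psi>(3)[OF 1(2) tr(2)])
    also have "structure_map E (\<eta> W (?r, m)) = structure_map E (\<eta> W (r, m))"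
      using \<psi>\<eta>[OF W(1) mx' W(2)] \<psi>\<eta>[OF W(1) r W(2)] by simp
    also have "\<dots> \<otimes>\<^bsub>H\<^esub> t (E.tr (\<eta> W (r, m)) e) = structure_map E e"
      using \<psi>(3)[OF 1(1) tr(2)] tr(1) by simp
    finally show "structure_map E (k W m r e) = structure_map E e" .
  qed
  have k_id: "k W m r e = e"
    if "W \<in> \<O>" "m \<in> W" "r \<in> {0..1}" "e \<in> topspace ?TE" "proj E e = h (r, m)" "\<sigma> W m = 0" for W m r e
  proof -
    have "max r (\<sigma> W m) = r" using that(3,6) by simp
    then show ?thesis
      unfolding k_def using \<eta>_in[OF that(1,3,2)] p\<eta>[OF that(1,3,2)] that(4,5) by simp
  qed
  have k_act: "k W m r (act E e g) = act E (k W m r e) g"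
    if W: "W \<in> \<O>" "m \<in> W" and r: "r \<in> {0..1}" and e: "e \<in> topspace ?TE" "proj E e = h (r, m)"
      and g: "g \<in> carrier G" for W m r e g
  proof -
    have 1: "\<eta> W (r, m) \<in> topspace ?TE" "\<eta> W (max r (\<sigma> W m), m) \<in> topspace ?TE"
      using \<eta>_in[OF W(1) r W(2)] \<eta>_in[OF W(1) mx[OF W r] W(2)] .
    have pe: "proj E (\<eta> W (r, m)) = proj E e" using p\<eta>[OF W(1) r W(2)] e(2) by simp
    note tr = E.act_tr[OF 1(1) e(1) pe]
    have "act E (\<eta> W (r, m)) (E.tr (\<eta> W (r, m)) e \<otimes>\<^bsub>G\<^esub> g) = act E e g"
      using E.act_act[OF 1(1) tr(2) g] tr(1) by simp
    then have "E.tr (\<eta> W (r, m)) (act E e g) = E.tr (\<eta> W (r, m)) e \<otimes>\<^bsub>G\<^esub> g"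
      using E.tr_act[OF 1(1), of "E.tr (\<eta> W (r, m)) e \<otimes>\<^bsub>G\<^esub> g"] tr(2) g by simp
    then show ?thesis
      unfolding k_def using E.act_act[OF 1(2) tr(2) g] by simp
  qed
  let ?B = "prod_topology M (prod_topology ?I ?TE)"
  \<comment> \<open>Unlike in the contraction, time is part of the state that the factors change.
    The constraint keeps the point over the current time, which is what makes the division in
    \<open>k\<close> meaningful.\<close>
  define F where "F = {z :: 'm \<times> real \<times> 'p. proj E (snd (snd z)) = h (fst (snd z), fst z)}"
  let ?Y = "subtopology ?B F"
  have Y: "(m, r, e) \<in> topspace ?Y \<longleftrightarrow>
      m \<in> topspace M \<and> r \<in> {0..1} \<and> e \<in> topspace ?TE \<and> proj E e = h (r, m)" for m r e
    by (auto simp: F_def)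
  define f where "f = (\<lambda>W (m, r, e). if m \<in> W then (m, max r (\<sigma> W m), k W m r e) else (m, r, e))"
  have f_apply: "f W (m, r, e) = (m, max r (\<sigma> W m), k W m r e)" if "m \<in> W" for W m r e
    using that by (simp add: f_def)
  have \<pi>: "continuous_map ?Y M fst"
    by (rule continuous_map_from_subtopology[OF continuous_map_fst])
  have fc: "continuous_map (subtopology ?Y {y \<in> topspace ?Y. fst y \<in> W}) ?Y (f W)" if W: "W \<in> \<O>" for W
  proof -
    let ?S = "subtopology ?Y {y \<in> topspace ?Y. fst y \<in> W}"
    have S: "fst y \<in> W" "fst (snd y) \<in> {0..1}" "snd (snd y) \<in> topspace ?TE"
        "proj E (snd (snd y)) = h (fst (snd y), fst y)" if "y \<in> topspace ?S" for y
      using that Y[of "fst y" "fst (snd y)" "snd (snd y)"] by auto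
    have 1: "continuous_map ?S M (\<lambda>y. fst y)"
      and 2: "continuous_map ?S ?I (\<lambda>y. fst (snd y))"
      and 3: "continuous_map ?S ?TE (\<lambda>y. snd (snd y))"
      by (rule continuous_map_from_subtopology, rule continuous_map_from_subtopology,
          rule continuous_map_fst continuous_map_fst'[OF continuous_map_snd]
            continuous_map_snd'[OF continuous_map_snd])+
    have 4: "continuous_map ?S ?I (\<lambda>y. max (fst (snd y)) (\<sigma> W (fst y)))"
    proof (rule continuous_map_into_subtopology)
      have "continuous_map ?S euclideanreal (\<lambda>y. \<sigma> W (fst y))"
        using continuous_map_comp[OF \<sigma>c[OF W] 1] by (simp add: continuous_map_in_subtopology)
      moreover have "continuous_map ?S euclideanreal (\<lambda>y. fst (snd y))"
        using 2 by (simp add: continuous_map_in_subtopology)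
      ultimately show "continuous_map ?S euclideanreal (\<lambda>y. max (fst (snd y)) (\<sigma> W (fst y)))"
        by (intro continuous_map_real_max)
      show "(\<lambda>y. max (fst (snd y)) (\<sigma> W (fst y))) \<in> topspace ?S \<rightarrow> {0..1}"
      proof
        fix y assume "y \<in> topspace ?S"
        from S(1,2)[OF this] show "max (fst (snd y)) (\<sigma> W (fst y)) \<in> {0..1}"
          by (rule mx[OF W])
      qed
    qed
    have in_box: "continuous_map ?S (subtopology ?Z ({0..1} \<times> W)) (\<lambda>y. (\<rho> y, fst y))"
      if \<rho>: "continuous_map ?S ?I \<rho>" for \<rho>
    proof (rule continuous_map_into_subtopology)
      show "continuous_map ?S ?Z (\<lambda>y. (\<rho> y, fst y))"
        by (rule continuous_map_pairedI[OF \<rho> 1])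
      show "(\<lambda>y. (\<rho> y, fst y)) \<in> topspace ?S \<rightarrow> {0..1} \<times> W"
      proof
        fix y assume y: "y \<in> topspace ?S"
        show "(\<rho> y, fst y) \<in> {0..1} \<times> W"
          using continuous_map_in[OF \<rho> y] S(1)[OF y] by simp
      qed
    qed
    have 5: "continuous_map ?S ?TE (\<lambda>y. \<eta> W (fst (snd y), fst y))"
      by (rule continuous_map_comp[OF \<eta>c[OF W] in_box[OF 2]])
    have 6: "continuous_map ?S ?TE (\<lambda>y. \<eta> W (max (fst (snd y)) (\<sigma> W (fst y)), fst y))"
      by (rule continuous_map_comp[OF \<eta>c[OF W] in_box[OF 4]])
    have "continuous_map ?S TG (\<lambda>y. E.tr (\<eta> W (fst (snd y), fst y)) (snd (snd y)))"
    proof (rule E.continuous_map_tr[OF 5 3])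
      fix y assume y: "y \<in> topspace ?S"
      show "proj E (\<eta> W (fst (snd y), fst y)) = proj E (snd (snd y))"
        unfolding S(4)[OF y] by (rule p\<eta>[OF W S(2,1)[OF y]])
    qed
    from E.continuous_map_act[OF 6 this]
    have "continuous_map ?S ?TE (\<lambda>y. k W (fst y) (fst (snd y)) (snd (snd y)))"
      unfolding k_def .
    with 1 4 have 7: "continuous_map ?S ?B (\<lambda>y. (fst y, max (fst (snd y)) (\<sigma> W (fst y)),
        k W (fst y) (fst (snd y)) (snd (snd y))))"
      by (intro continuous_map_pairedI)
    have 8: "f W y = (fst y, max (fst (snd y)) (\<sigma> W (fst y)), k W (fst y) (fst (snd y)) (snd (snd y)))"
      if "y \<in> topspace ?S" for y
      using S(1)[OF that] f_apply[of "fst y" W "fst (snd y)" "snd (snd y)"] by simp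
    have "continuous_map ?S ?B (f W)"
      by (rule continuous_map_eq[OF 7]) (simp only: 8)
    moreover have "f W \<in> topspace ?S \<rightarrow> F"
    proof
      fix y assume y: "y \<in> topspace ?S"
      show "f W y \<in> F"
        unfolding 8[OF y] F_def using k(2)[OF W S(1-4)[OF y]] by simp
    qed
    ultimately show ?thesis by (rule continuous_map_into_subtopology)
  qed
  have fib: "fst (f W y) = fst y" for W y
    by (simp add: f_def split: prod.splits)
  have triv: "f W y = y" if W: "W \<in> \<O>" and y: "y \<in> topspace ?Y" and C: "fst y \<notin> C W" for W y
  proof -
    obtain m r e where y': "y = (m, r, e)" by (cases y) auto
    with y have *: "m \<in> topspace M" "r \<in> {0..1}" "e \<in> topspace ?TE" "proj E e = h (r, m)"
      by (simp_all only: Y)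
    have 0: "\<sigma> W m = 0" using \<sigma>0[OF W] C *(1) y' by simp
    then show ?thesis
      using k_id[OF W _ *(2-4)] *(2) by (simp add: f_def y')
  qed
  obtain L where L: "\<And>m. m \<in> topspace M \<Longrightarrow> set (L m) = {W \<in> \<O>. m \<in> W}"
    and Lc: "continuous_map ?Y ?Y (\<lambda>y. fold f (L (fst y)) y)"
    by (rule locally_finite_fold_continuous[OF lf opW cl CW \<pi> fc fib triv]; (assumption | rule that))
  define \<tau> where "\<tau> = (\<lambda>(m, e). snd (snd (fold f (L m) (m, 0, e))))"
  let ?D = "subtopology (prod_topology M ?TE) {z. proj E (snd z) = h (0, fst z)}"
  have 1: "continuous_map ?D ?Y (\<lambda>z. (fst z, 0, snd z))"
  proof (rule continuous_map_into_subtopology)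
    show "continuous_map ?D ?B (\<lambda>z. (fst z, 0, snd z))"
      by (intro continuous_map_pairedI continuous_map_from_subtopology[OF continuous_map_fst]
          continuous_map_from_subtopology[OF continuous_map_snd]) simp
  qed (simp add: F_def)
  have \<tau>c: "continuous_map ?D ?TE \<tau>"
    using continuous_map_snd'[OF continuous_map_snd'[OF
          continuous_map_into_fulltopology[OF continuous_map_comp[OF Lc 1]]]]
    by (simp add: \<tau>_def case_prod_unfold)
  have "proj E (\<tau> (m, y)) = h (1, m) \<and> structure_map E (\<tau> (m, y)) = structure_map E y \<and>
       (\<forall>g\<in>carrier G. \<tau> (m, act E y g) = act E (\<tau> (m, y)) g)"
    if m: "m \<in> topspace M" and y: "y \<in> topspace ?TE" "proj E y = h (0, m)" for m y
  proof -
    \<comment> \<open>The invariant of the composition: the point lies over the current time and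
      keeps the structure map of \<open>y\<close>. At time 1 it gives the claims on projection and
      structure map.\<close>
    define S where "S = {(m', r, e). m' = m \<and> r \<in> {0..1} \<and> e \<in> topspace ?TE \<and> proj E e = h (r, m) \<and>
      structure_map E e = structure_map E y}"
    have Wm: "W \<in> \<O>" "m \<in> W" if "W \<in> set (L m)" for W
      using that L[OF m] by simp_all
    have fS: "f W x \<in> S" if W: "W \<in> set (L m)" and x: "x \<in> S" for W x
    proof -
      obtain r e where x': "x = (m, r, e)" and *: "r \<in> {0..1}" "e \<in> topspace ?TE" "proj E e = h (r, m)"
        "structure_map E e = structure_map E y"
        using x unfolding S_def by blast
      show ?thesis
        unfolding x' f_apply[OF Wm(2)[OF W]]
        using k[OF Wm[OF W] *(1-3)] mx[OF Wm[OF W] *(1)] *(4) by (simp add: S_def)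
    qed
    have yS: "(m, 0, y) \<in> S" using y by (simp add: S_def)
    obtain W1 where W1: "W1 \<in> \<O>" "m \<in> W1" "\<sigma> W1 m = 1" using \<sigma>1[OF m] by blast
    have "fold f (L m) (m, 0, y) \<in> {x. fst (snd x) = 1}"
    proof (rule fold_reaches[where S = S and i = W1])
      show "W1 \<in> set (L m)" using L[OF m] W1 by simp
      show "f W1 x \<in> {x. fst (snd x) = 1}" if x: "x \<in> S" for x
      proof -
        obtain r e where "x = (m, r, e)" "r \<le> 1" using x unfolding S_def by auto
        then show ?thesis using f_apply[OF W1(2), of r e] W1(3) by simp
      qed
      show "f W x \<in> {x. fst (snd x) = 1}" if W: "W \<in> set (L m)" and x: "x \<in> S" "x \<in> {x. fst (snd x) = 1}" for W x
      proof -
        obtain e where "x = (m, 1, e)" using x unfolding S_def by auto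
        then show ?thesis using f_apply[OF Wm(2)[OF W], of 1 e] \<sigma>I[OF Wm(1)[OF W] m] by simp
      qed
    qed (rule fS yS; assumption)+
    moreover have "fold f (L m) (m, 0, y) \<in> S"
      by (rule fold_in) (rule fS yS; assumption)+
    ultimately obtain e where e: "fold f (L m) (m, 0, y) = (m, 1, e)" "proj E e = h (1, m)"
        "structure_map E e = structure_map E y"
      unfolding S_def by auto
    have "\<tau> (m, act E y g) = act E (\<tau> (m, y)) g" if g: "g \<in> carrier G" for g
    proof -
      define ag where "ag = (\<lambda>(m' :: 'm, r :: real, e). (m', r, act E e g))"
      have "fold f (L m) (ag (m, 0, y)) = ag (fold f (L m) (m, 0, y))"
      proof (rule fold_intertwine[where S = S])
        show "f W (ag x) = ag (f W x)" if W: "W \<in> set (L m)" and x: "x \<in> S" for W x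
        proof -
          obtain r e where x': "x = (m, r, e)" and *: "r \<in> {0..1}" "e \<in> topspace ?TE" "proj E e = h (r, m)"
            using x unfolding S_def by blast
          show ?thesis
            using f_apply[OF Wm(2)[OF W]] k_act[OF Wm[OF W] * g] by (simp add: x' ag_def)
        qed
      qed (rule fS yS; assumption)+
      then show ?thesis by (simp add: \<tau>_def ag_def e(1))
    qed
    then show ?thesis using e by (simp add: \<tau>_def)
  qed
  with \<tau>c show ?thesis by blast
qed

text \<open>\<open>A\<close> and \<open>B\<close> exhibit P and Q as pullbacks of E along the same
  \<open>k\<close>. On each fibre \<open>B\<close> is a bijection onto a fibre of E, so
  \<open>B (f p) = A p\<close> determines f; locally f is a section of Q translated by a division in
  E, hence continuous.\<close>

lemma bibundle_iso_of_common_target: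
  fixes E :: "('e, 'g, 'n, 'h) bibundle" and P :: "('p, 'g, 'm, 'h) bibundle"
    and Q :: "('q, 'g, 'm, 'h) bibundle"
  assumes E: "is_bibundle G TG H TH t X E"
    and P: "is_bibundle G TG H TH t M P" and Q: "is_bibundle G TG H TH t M Q"
    and A: "equivariant_map G P E A" and B: "equivariant_map G Q E B"
    and pA: "\<And>p. p \<in> topspace (total_space P) \<Longrightarrow>
      proj E (A p) = k (proj P p) \<and> structure_map E (A p) = structure_map P p"
    and pB: "\<And>q. q \<in> topspace (total_space Q) \<Longrightarrow>
      proj E (B q) = k (proj Q q) \<and> structure_map E (B q) = structure_map Q q"
  shows "\<exists>f. bibundle_iso G P Q f"
proof -
  interpret E: principal G TG X E by (rule bibundleD(1)[OF E])
  interpret P: principal G TG M P by (rule bibundleD(1)[OF P])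
  interpret Q: principal G TG M Q by (rule bibundleD(1)[OF Q])
  have Ac: "continuous_map (total_space P) (total_space E) A"
    and A_act: "\<And>p g. p \<in> topspace (total_space P) \<Longrightarrow> g \<in> carrier G \<Longrightarrow> A (act P p g) = act E (A p) g"
    and Bc: "continuous_map (total_space Q) (total_space E) B"
    and B_act: "\<And>q g. q \<in> topspace (total_space Q) \<Longrightarrow> g \<in> carrier G \<Longrightarrow> B (act Q q g) = act E (B q) g"
    using A B by (auto simp: equivariant_map_def)
  note A_in = continuous_map_in[OF Ac] and B_in = continuous_map_in[OF Bc]
  have B_inj: "q = q'" if q: "q \<in> topspace (total_space Q)" "q' \<in> topspace (total_space Q)"
    and pr: "proj Q q = proj Q q'" and eq: "B q = B q'" for q q'
  proof -
    note tr = Q.act_tr[OF q pr]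
    have "act E (B q) (Q.tr q q') = act E (B q) \<one>\<^bsub>G\<^esub>"
      using B_act[OF q(1) tr(2)] tr(1) eq B_in[OF q(1)] B_in[OF q(2)] by simp
    then have "Q.tr q q' = \<one>\<^bsub>G\<^esub>"
      using E.act_eq_iff[OF B_in[OF q(1)] tr(2), of "\<one>\<^bsub>G\<^esub>"] by simp
    then show ?thesis using tr(1) q(1) by simp
  qed
  have lift: "act Q q (E.tr (B q) (A p)) \<in> topspace (total_space Q)"
      "proj Q (act Q q (E.tr (B q) (A p))) = proj P p" "B (act Q q (E.tr (B q) (A p))) = A p"
      if p: "p \<in> topspace (total_space P)" and q: "q \<in> topspace (total_space Q)"
        and pr: "proj Q q = proj P p" for p q
  proof -
    have "proj E (B q) = proj E (A p)" using pA[OF p] pB[OF q] pr by simp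
    note tr = E.act_tr[OF B_in[OF q] A_in[OF p] this]
    show "act Q q (E.tr (B q) (A p)) \<in> topspace (total_space Q)"
      "proj Q (act Q q (E.tr (B q) (A p))) = proj P p" "B (act Q q (E.tr (B q) (A p))) = A p"
      using tr q pr B_act[OF q tr(2)] by simp_all
  qed
  have "\<exists>q. q \<in> topspace (total_space Q) \<and> proj Q q = proj P p \<and> B q = A p"
    if p: "p \<in> topspace (total_space P)" for p
  proof -
    obtain q where "q \<in> topspace (total_space Q)" "proj Q q = proj P p"
      using Q.ex_point_over[OF P.proj_in[OF p]] by blast
    from lift[OF p this] show ?thesis by blast
  qed
  then obtain f where f: "\<And>p. p \<in> topspace (total_space P) \<Longrightarrow>
      f p \<in> topspace (total_space Q) \<and> proj Q (f p) = proj P p \<and> B (f p) = A p"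
    by metis
  have f_eq: "f p = q" if "p \<in> topspace (total_space P)" "q \<in> topspace (total_space Q)"
    "proj Q q = proj P p" "B q = A p" for p q
    by (rule B_inj) (use f[OF that(1)] that in simp_all)
  have "continuous_map (total_space P) (total_space Q) f"
  proof (rule continuous_map_locally)
    fix p assume p: "p \<in> topspace (total_space P)"
    obtain U s where U: "openin M U" "proj P p \<in> U"
      and sc: "continuous_map (subtopology M U) (total_space Q) s"
      and s: "\<forall>u\<in>U. s u \<in> topspace (total_space Q) \<and> proj Q (s u) = u"
      using Q.local_section[OF P.proj_in[OF p]] by blast
    let ?V = "{p \<in> topspace (total_space P). proj P p \<in> U}"
    have V: "openin (total_space P) ?V"
      by (rule openin_continuous_map_preimage[OF P.proj_continuous U(1)])
    have 1: "continuous_map (subtopology (total_space P) ?V) (total_space Q) (\<lambda>p. s (proj P p))"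
      by (rule continuous_map_restrict_preimage[OF sc P.proj_continuous])
    have "continuous_map (subtopology (total_space P) ?V) TG (\<lambda>p. E.tr (B (s (proj P p))) (A p))"
    proof (rule E.continuous_map_tr[OF continuous_map_comp[OF Bc 1] continuous_map_from_subtopology[OF Ac]])
      fix x assume "x \<in> topspace (subtopology (total_space P) ?V)"
      then have x: "x \<in> topspace (total_space P)" "proj P x \<in> U" by simp_all
      from bspec[OF s x(2)] show "proj E (B (s (proj P x))) = proj E (A x)"
        using pA[OF x(1)] pB[of "s (proj P x)"] by simp
    qed
    from Q.continuous_map_act[OF 1 this]
    have "continuous_map (subtopology (total_space P) ?V) (total_space Q) f"
    proof (rule continuous_map_eq)
      fix x assume "x \<in> topspace (subtopology (total_space P) ?V)"
      then have x: "x \<in> topspace (total_space P)" "proj P x \<in> U" by simp_all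
      from bspec[OF s x(2)] have "s (proj P x) \<in> topspace (total_space Q)" "proj Q (s (proj P x)) = proj P x"
        by simp_all
      from f_eq[OF x(1) lift[OF x(1) this]]
      show "act Q (s (proj P x)) (E.tr (B (s (proj P x))) (A x)) = f x" by simp
    qed
    then show "\<exists>V. openin (total_space P) V \<and> p \<in> V \<and>
        continuous_map (subtopology (total_space P) V) (total_space Q) f"
      using V p U(2) by blast
  qed
  moreover have "f (act P p g) = act Q (f p) g" if "p \<in> topspace (total_space P)" "g \<in> carrier G" for p g
    by (rule f_eq) (use that f[OF that(1)] A_act[OF that] B_act[of "f p" g] in simp_all)
  ultimately have f_equi: "equivariant_map G P Q f"
    by (simp add: equivariant_map_def)
  moreover have "homeomorphic_map (total_space P) (total_space Q) f"
    by (rule equivariant_map_over_homeomorphic[OF P.principal_axioms Q.principal_axioms f_equi])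
      (simp add: f)
  moreover have "structure_map Q (f p) = structure_map P p" if "p \<in> topspace (total_space P)" for p
    using pA[OF that] pB[of "f p"] f[OF that] by simp
  ultimately have "bibundle_iso G P Q f"
    using f by (simp add: bibundle_iso_def)
  then show ?thesis by blast
qed

text \<open>Transport moves the values of \<open>A\<close> to time 1 without changing structure
  maps. After that P and Q map to E over the same map of bases.\<close>

lemma bibundle_iso_of_homotopy:
  fixes E :: "('e, 'g, 'n, 'h) bibundle" and P :: "('p, 'g, 'm, 'h) bibundle"
    and Q :: "('q, 'g, 'm, 'h) bibundle"
  assumes M: "paracompact_space M" and E: "is_bibundle G TG H TH t X E"
    and P: "is_bibundle G TG H TH t M P" and Q: "is_bibundle G TG H TH t M Q"
    and A: "equivariant_map G P E A" and B: "equivariant_map G Q E B"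
    and h: "continuous_map (prod_topology (top_of_set {0..1::real}) M) X h"
    and const: "constant_type E M h"
    and pA: "\<And>p. p \<in> topspace (total_space P) \<Longrightarrow>
      proj E (A p) = h (0, proj P p) \<and> structure_map E (A p) = structure_map P p"
    and pB: "\<And>q. q \<in> topspace (total_space Q) \<Longrightarrow>
      proj E (B q) = h (1, proj Q q) \<and> structure_map E (B q) = structure_map Q q"
  shows "\<exists>f. bibundle_iso G P Q f"
proof -
  interpret P: principal G TG M P by (rule bibundleD(1)[OF P])
  have Ac: "continuous_map (total_space P) (total_space E) A"
    and A_act: "\<And>p g. p \<in> topspace (total_space P) \<Longrightarrow> g \<in> carrier G \<Longrightarrow> A (act P p g) = act E (A p) g"
    using A by (auto simp: equivariant_map_def)
  obtain \<tau> where
    \<tau>c: "continuous_map (subtopology (prod_topology M (total_space E)) {z. proj E (snd z) = h (0, fst z)})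
      (total_space E) \<tau>"
    and \<tau>: "\<forall>m\<in>topspace M. \<forall>y\<in>topspace (total_space E). proj E y = h (0, m) \<longrightarrow>
       proj E (\<tau> (m, y)) = h (1, m) \<and> structure_map E (\<tau> (m, y)) = structure_map E y \<and>
       (\<forall>g\<in>carrier G. \<tau> (m, act E y g) = act E (\<tau> (m, y)) g)"
    using parallel_transport[OF M E h const] by blast
  define D where "D p = \<tau> (proj P p, A p)" for p
  have D: "proj E (D p) = h (1, proj P p) \<and> structure_map E (D p) = structure_map P p"
    and D_act: "g \<in> carrier G \<Longrightarrow> D (act P p g) = act E (D p) g"
    if p: "p \<in> topspace (total_space P)" for p g
    using bspec[OF bspec[OF \<tau> P.proj_in[OF p]] continuous_map_in[OF Ac p]] pA[OF p] A_act[OF p] p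
    by (simp_all add: D_def)
  have "continuous_map (total_space P) (total_space E) D"
    unfolding D_def
  proof (rule continuous_map_comp[OF \<tau>c], rule continuous_map_into_subtopology)
    show "continuous_map (total_space P) (prod_topology M (total_space E)) (\<lambda>p. (proj P p, A p))"
      by (rule continuous_map_pairedI[OF P.proj_continuous Ac])
  qed (simp add: pA)
  then have "equivariant_map G P E D"
    by (simp add: equivariant_map_def D_act)
  from bibundle_iso_of_common_target[OF E P Q this B, of "\<lambda>m. h (1, m)"] D pB
  show ?thesis by simp
qed

section \<open>Pullback bibundles\<close>

text \<open>The points of the pullback are labelled by \<open>M \<times> G\<close>, through a choice of a point in each fibre,
  so that its total space can be realized in any type into which \<open>M \<times> G\<close> injects.\<close>

lemma pullback_bibundle:
  fixes E :: "('e, 'g, 'n, 'h) bibundle" and M :: "'m topology" and \<iota> :: "'m \<times> 'g \<Rightarrow> 'u"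
  assumes E: "is_bibundle G TG H TH t X E" and f: "continuous_map M X f"
    and \<iota>: "inj_on \<iota> (topspace M \<times> carrier G)"
  shows "\<exists>(P :: ('u, 'g, 'm, 'h) bibundle) F. is_bibundle G TG H TH t M P \<and> equivariant_map G P E F \<and>
    (\<forall>p\<in>topspace (total_space P). proj E (F p) = f (proj P p) \<and> structure_map E (F p) = structure_map P p)"
proof -
  interpret E: principal G TG X E by (rule bibundleD(1)[OF E])
  note \<psi> = bibundleD(2-4)[OF E]
  let ?B = "prod_topology M (total_space E)"
  have "\<exists>y\<in>topspace (total_space E). proj E y = f m" if "m \<in> topspace M" for m
    by (rule E.ex_point_over[OF continuous_map_in[OF f that]])
  then obtain y0 where y0: "\<And>m. m \<in> topspace M \<Longrightarrow> y0 m \<in> topspace (total_space E) \<and> proj E (y0 m) = f m"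
    by metis
  define A where "A = \<iota> ` (topspace M \<times> carrier G)"
  \<comment> \<open>\<open>k\<close> decodes the label of (m, g) into the point (m, y0(m) g) of the
    fibre product, and \<open>c\<close> encodes it again. Since \<open>y0\<close> is chosen without
    continuity, the topology is pulled back along \<open>k\<close> and not taken from M x G.\<close>
  define k where "k a = (case inv_into (topspace M \<times> carrier G) \<iota> a of (m, g) \<Rightarrow> (m, act E (y0 m) g))" for a
  define c where "c = (\<lambda>(m, y). \<iota> (m, E.tr (y0 m) y))"
  have k_\<iota>: "k (\<iota> (m, g)) = (m, act E (y0 m) g)" if "m \<in> topspace M" "g \<in> carrier G" for m g
    using inv_into_f_f[OF \<iota>, of "(m, g)"] that by (simp add: k_def)
  have kA: "fst (k a) \<in> topspace M" "snd (k a) \<in> topspace (total_space E)" "proj E (snd (k a)) = f (fst (k a))"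
    and ck: "c (k a) = a" if a: "a \<in> A" for a
  proof -
    obtain m g where a': "a = \<iota> (m, g)" and mg: "m \<in> topspace M" "g \<in> carrier G"
      using a by (auto simp: A_def)
    have "k a = (m, act E (y0 m) g)" unfolding a' by (rule k_\<iota>[OF mg])
    then show "fst (k a) \<in> topspace M" "snd (k a) \<in> topspace (total_space E)"
      "proj E (snd (k a)) = f (fst (k a))" "c (k a) = a"
      using y0[OF mg(1)] mg by (simp_all add: c_def a')
  qed
  have cA: "c (m, y) \<in> A" and kc: "k (c (m, y)) = (m, y)"
    if m: "m \<in> topspace M" and y: "y \<in> topspace (total_space E)" "proj E y = f m" for m y
  proof -
    have "proj E (y0 m) = proj E y" using y0[OF m] y by simp
    note tr = E.act_tr[OF conjunct1[OF y0[OF m]] y(1) this]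
    show "c (m, y) \<in> A" using m tr(2) by (auto simp: c_def A_def)
    show "k (c (m, y)) = (m, y)" using k_\<iota>[OF m tr(2)] tr(1) by (simp add: c_def)
  qed
  define P :: "('u, 'g, 'm, 'h) bibundle" where
    "P = \<lparr>total_space = pullback_topology A k ?B, proj = \<lambda>a. fst (k a),
      act = \<lambda>a g. c (fst (k a), act E (snd (k a)) g), structure_map = \<lambda>a. structure_map E (snd (k a))\<rparr>"
  let ?P = "pullback_topology A k ?B"
  have P_simps [simp]: "total_space P = ?P" "proj P a = fst (k a)"
    "act P a g = c (fst (k a), act E (snd (k a)) g)" "structure_map P a = structure_map E (snd (k a))" for a g
    by (simp_all add: P_def)
  have topP: "topspace ?P = A"
    using kA by (auto simp: topspace_pullback_topology mem_Times_iff)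
  have kc1: "continuous_map ?P ?B k"
    using continuous_map_pullback[OF continuous_map_id, of A k ?B] by (simp add: o_def)
  have k1: "continuous_map ?P M (\<lambda>a. fst (k a))" and k2: "continuous_map ?P (total_space E) (\<lambda>a. snd (k a))"
    by (rule continuous_map_fst'[OF kc1], rule continuous_map_snd'[OF kc1])
  have into_P: "continuous_map Z ?P (\<lambda>z. c (u z, v z))"
    if "continuous_map Z M u" "continuous_map Z (total_space E) v"
      "\<And>z. z \<in> topspace Z \<Longrightarrow> proj E (v z) = f (u z)" for Z u v
  proof (rule continuous_map_pullback')
    have *: "u z \<in> topspace M" "v z \<in> topspace (total_space E)" "proj E (v z) = f (u z)" if "z \<in> topspace Z" for z
      using continuous_map_in[OF \<open>continuous_map Z M u\<close> that]
        continuous_map_in[OF \<open>continuous_map Z (total_space E) v\<close> that]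
        \<open>\<And>z. z \<in> topspace Z \<Longrightarrow> proj E (v z) = f (u z)\<close>[OF that] .
    show "continuous_map Z ?B (k \<circ> (\<lambda>z. c (u z, v z)))"
      by (rule continuous_map_eq[OF continuous_map_pairedI[OF that(1,2)]]) (simp add: kc *)
    show "topspace Z \<subseteq> (\<lambda>z. c (u z, v z)) -` A"
      using cA * by auto
  qed
  have act_k: "k (c (fst (k a), act E (snd (k a)) g)) = (fst (k a), act E (snd (k a)) g)"
    if "a \<in> A" "g \<in> carrier G" for a g
    by (rule kc) (use kA[OF that(1)] that(2) in simp_all)
  have "principal_bundle G TG M P"
  proof (rule G.principal_bundleI[where d = "\<lambda>a b. E.tr (snd (k a)) (snd (k b))"])
    show "continuous_map (total_space P) M (proj P)"
      using k1 by (simp add: P_def)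
    have "continuous_map (prod_topology ?P TG) ?P (\<lambda>z. c (fst (k (fst z)), act E (snd (k (fst z))) (snd z)))"
    proof (rule into_P)
      show "continuous_map (prod_topology ?P TG) M (\<lambda>z. fst (k (fst z)))"
        by (rule continuous_map_comp[OF k1 continuous_map_fst])
      show "continuous_map (prod_topology ?P TG) (total_space E) (\<lambda>z. act E (snd (k (fst z))) (snd z))"
        by (rule E.continuous_map_act[OF continuous_map_comp[OF k2 continuous_map_fst] continuous_map_snd])
    qed (auto simp: topP kA G.topspace_eq_carrier)
    then show "continuous_map (prod_topology (total_space P) TG) (total_space P) (\<lambda>(p, g). act P p g)"
      by (simp add: case_prod_unfold)
  next
    fix m assume m: "m \<in> topspace M"
    obtain D s where D: "openin X D" "f m \<in> D" and sc: "continuous_map (subtopology X D) (total_space E) s"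
      and s: "\<forall>u\<in>D. s u \<in> topspace (total_space E) \<and> proj E (s u) = u"
      using E.local_section[OF continuous_map_in[OF f m]] by blast
    let ?U = "{m \<in> topspace M. f m \<in> D}"
    have "openin M ?U" by (rule openin_continuous_map_preimage[OF f D(1)])
    moreover have "continuous_map (subtopology M ?U) ?P (\<lambda>m. c (m, s (f m)))"
      by (rule into_P) (use s in \<open>auto intro: continuous_map_restrict_preimage[OF sc f] continuous_map_from_subtopology\<close>)
    moreover have "\<forall>u\<in>?U. fst (k (c (u, s (f u)))) = u"
      using kc s by auto
    ultimately show "\<exists>U s. openin M U \<and> m \<in> U \<and> continuous_map (subtopology M U) (total_space P) s \<and>
        (\<forall>u\<in>U. proj P (s u) = u)"
      using m D(2) by (intro exI[of _ ?U] exI[of _ "\<lambda>m. c (m, s (f m))"]) simp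
  next
    let ?PP = "subtopology (prod_topology (total_space P) (total_space P)) {z. proj P (fst z) = proj P (snd z)}"
    have "continuous_map ?PP (total_space E) (\<lambda>z. snd (k (fst z)))"
      "continuous_map ?PP (total_space E) (\<lambda>z. snd (k (snd z)))"
      using continuous_map_comp[OF k2 continuous_map_fst[of ?P ?P]] continuous_map_comp[OF k2 continuous_map_snd[of ?P ?P]]
      by (simp_all add: continuous_map_from_subtopology)
    then show "continuous_map ?PP TG (\<lambda>z. E.tr (snd (k (fst z))) (snd (k (snd z))))"
      by (rule E.continuous_map_tr) (auto simp: topP kA)
  next
    fix p q assume p: "p \<in> topspace (total_space P)" and q: "q \<in> topspace (total_space P)"
      and pr: "proj P p = proj P q"
    have "p \<in> A" "q \<in> A" using p q topP by simp_all
    moreover from this have "act E (snd (k p)) (E.tr (snd (k p)) (snd (k q))) = snd (k q)"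
      using pr by (intro E.act_tr(1)) (simp_all add: kA)
    ultimately show "act P p (E.tr (snd (k p)) (snd (k q))) = q"
      using pr ck[of q] by simp
  qed (simp_all add: topP kA ck act_k)
  moreover have "continuous_map (total_space P) TH (structure_map P)"
    using continuous_map_comp[OF \<psi>(1) k2] by (simp add: P_def)
  ultimately have "is_bibundle G TG H TH t M P"
    unfolding is_bibundle_def by (simp add: topP act_k kA \<psi>(3))
  moreover have "equivariant_map G P E (\<lambda>a. snd (k a))"
    using k2 by (simp add: equivariant_map_def topP act_k)
  ultimately show ?thesis
    by (intro exI[of _ P] exI[of _ "\<lambda>a. snd (k a)"]) (simp add: topP kA)
qed

section \<open>The classifying bibundle\<close>

lemma EGH_class_eq_iff:
  assumes "principal G TG BG EG"
    and y: "y \<in> topspace (total_space EG) \<times> carrier H" and y': "y' \<in> topspace (total_space EG) \<times> carrier H"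
  shows "EGH_class G H t EG y = EGH_class G H t EG y' \<longleftrightarrow> (\<exists>g\<in>carrier G. y' = EGH_act H t EG y g)"
proof
  interpret E: principal G TG BG EG by fact
  assume "EGH_class G H t EG y = EGH_class G H t EG y'"
  moreover have "y' = EGH_act H t EG y' \<one>\<^bsub>G\<^esub>"
    using y' by (auto simp: EGH_act_def)
  then have "y' \<in> EGH_class G H t EG y'"
    by (auto simp: EGH_class_def)
  ultimately show "\<exists>g\<in>carrier G. y' = EGH_act H t EG y g"
    by (auto simp: EGH_class_def)
next
  interpret E: principal G TG BG EG by fact
  assume "\<exists>g\<in>carrier G. y' = EGH_act H t EG y g"
  then obtain g where g: "g \<in> carrier G" "y' = EGH_act H t EG y g" by blast
  obtain e h where eh: "y = (e, h)" "e \<in> topspace (total_space EG)" "h \<in> carrier H" using y by auto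
  have 1: "EGH_act H t EG y' x = EGH_act H t EG y (g \<otimes>\<^bsub>G\<^esub> x)" if "x \<in> carrier G" for x
    using that g eh by (simp add: EGH_act_def H.m_assoc)
  have 2: "EGH_act H t EG y x = EGH_act H t EG y' (inv\<^bsub>G\<^esub> g \<otimes>\<^bsub>G\<^esub> x)" if "x \<in> carrier G" for x
    using that g 1[of "inv\<^bsub>G\<^esub> g \<otimes>\<^bsub>G\<^esub> x"] by (simp add: G.m_assoc[symmetric])
  show "EGH_class G H t EG y = EGH_class G H t EG y'"
  proof
    show "EGH_class G H t EG y \<subseteq> EGH_class G H t EG y'"
      unfolding EGH_class_def using 2 g(1) by (auto intro!: image_eqI)
    show "EGH_class G H t EG y' \<subseteq> EGH_class G H t EG y"
      unfolding EGH_class_def using 1 g(1) by (auto intro!: image_eqI)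
  qed
qed

lemma classifying_bibundle_simps [simp]:
  "total_space (classifying_bibundle G H TH t EG) = prod_topology (total_space EG) TH"
  "proj (classifying_bibundle G H TH t EG) = EGH_class G H t EG"
  "act (classifying_bibundle G H TH t EG) = EGH_act H t EG"
  "structure_map (classifying_bibundle G H TH t EG) = snd"
  by (simp_all add: classifying_bibundle_def)

text \<open>EG supplies both ingredients of a principal bundle: G already acts freely on the EG
  component, so division there divides in EG x H, and a local section of EG selects one
  representative in each nearby orbit.\<close>

lemma is_bibundle_classifying_bibundle:
  assumes EG: "principal G TG BG EG"
  shows "is_bibundle G TG H TH t (EGH_quotient G H TH t EG) (classifying_bibundle G H TH t EG)"
proof -
  interpret E: principal G TG BG EG by (rule EG)
  let ?T = "prod_topology (total_space EG) TH"
  let ?X = "EGH_quotient G H TH t EG"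
  let ?q = "EGH_class G H t EG"
  let ?P = "classifying_bibundle G H TH t EG"
  have q: "quotient_map ?T ?X ?q"
    unfolding EGH_quotient_def by (rule quotient_map_quotient_topology)
  have topT: "topspace ?T = topspace (total_space EG) \<times> carrier H"
    by (simp add: H.topspace_eq_carrier)
  have act_in: "EGH_act H t EG y g \<in> topspace ?T"
    and act_act: "g' \<in> carrier G \<Longrightarrow> EGH_act H t EG (EGH_act H t EG y g) g' = EGH_act H t EG y (g \<otimes>\<^bsub>G\<^esub> g')"
    and fst_act: "fst (EGH_act H t EG y g) = act EG (fst y) g"
    if "y \<in> topspace ?T" "g \<in> carrier G" for y g g'
    using that unfolding topT by (auto simp: EGH_act_def H.m_assoc)
  have act_one: "EGH_act H t EG y \<one>\<^bsub>G\<^esub> = y" if "y \<in> topspace ?T" for y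
    using that unfolding topT by (auto simp: EGH_act_def)
  have q_act: "?q (EGH_act H t EG y g) = ?q y" if "y \<in> topspace ?T" "g \<in> carrier G" for y g
    using EGH_class_eq_iff[OF EG, of y "EGH_act H t EG y g"] act_in[OF that] that unfolding topT by auto
  have q_eq: "\<exists>g\<in>carrier G. y' = EGH_act H t EG y g"
    if "y \<in> topspace ?T" "y' \<in> topspace ?T" "?q y = ?q y'" for y y'
    using EGH_class_eq_iff[OF EG, of y y'] that unfolding topT by simp
  have act_c: "continuous_map Z ?T (\<lambda>z. EGH_act H t EG (u z) (v z))"
    if "continuous_map Z ?T u" "continuous_map Z TG v" for Z u v
    unfolding EGH_act_def case_prod_unfold
    by (intro continuous_map_pairedI E.continuous_map_act H.continuous_map_mult
        continuous_map_fst'[OF that(1)] continuous_map_snd'[OF that(1)] that(2)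
        continuous_map_comp[OF t_continuous])
  have "principal_bundle G TG ?X ?P"
  proof (rule G.principal_bundleI[where d = "\<lambda>y y'. E.tr (fst y) (fst y')"])
    show "continuous_map (total_space ?P) ?X (proj ?P)"
      using quotient_imp_continuous_map[OF q] by simp
    show "continuous_map (prod_topology (total_space ?P) TG) (total_space ?P) (\<lambda>(p, g). act ?P p g)"
      using act_c[OF continuous_map_fst continuous_map_snd] by (simp add: case_prod_unfold)
  next
    fix x assume "x \<in> topspace ?X"
    then obtain y where y: "y \<in> topspace ?T" "x = ?q y"
      by (auto simp: EGH_quotient_def)
    have "fst y \<in> topspace (total_space EG)" using y(1) unfolding topT by auto
    then obtain U s where U: "openin BG U" "proj EG (fst y) \<in> U"
      and sc: "continuous_map (subtopology BG U) (total_space EG) s"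
      and s: "\<forall>u\<in>U. s u \<in> topspace (total_space EG) \<and> proj EG (s u) = u"
      using E.local_section[OF E.proj_in] by blast
    let ?D = "{y \<in> topspace ?T. proj EG (fst y) \<in> U}"
    let ?V = "?q ` ?D"
    have pc: "continuous_map ?T BG (\<lambda>y. proj EG (fst y))"
      by (rule E.continuous_map_proj[OF continuous_map_fst])
    have Dop: "openin ?T ?D" by (rule openin_continuous_map_preimage[OF pc U(1)])
    \<comment> \<open>\<open>?D\<close> is a union of orbits. Therefore its image is open, and the
      quotient map restricted to it is again a quotient map.\<close>
    have pre: "{z \<in> topspace ?T. ?q z \<in> ?V} = ?D"
    proof (intro equalityI subsetI)
      fix z assume "z \<in> {z \<in> topspace ?T. ?q z \<in> ?V}"
      then obtain w where z: "z \<in> topspace ?T" and w: "w \<in> topspace ?T" "proj EG (fst w) \<in> U" "?q w = ?q z"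
        by auto
      obtain g where g: "g \<in> carrier G" "z = EGH_act H t EG w g" using q_eq[OF w(1) z w(3)] by blast
      have "fst w \<in> topspace (total_space EG)" using w(1) unfolding topT by auto
      then show "z \<in> ?D" using z w g fst_act[OF w(1) g(1)] by simp
    qed auto
    have "?V \<subseteq> ?q ` topspace ?T" by (rule image_mono) auto
    then have Vop: "openin ?X ?V"
      using Dop unfolding EGH_quotient_def openin_quotient_topology pre by simp
    \<comment> \<open>Moves z within its orbit to the point whose EG component lies on the section
      \<open>s\<close>. By freeness there is only one such point, so \<sigma> is constant on orbits
      and descends to the section \<open>r\<close> below, whatever \<open>inv_into\<close>
      chooses.\<close>
    define \<sigma> where "\<sigma> z = EGH_act H t EG z (E.tr (fst z) (s (proj EG (fst z))))" for z
    have \<sigma>: "E.tr (fst z) (s (proj EG (fst z))) \<in> carrier G" "fst (\<sigma> z) = s (proj EG (fst z))" "\<sigma> z \<in> topspace ?T" "?q (\<sigma> z) = ?q z"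
      if z: "z \<in> ?D" for z
    proof -
      have z': "z \<in> topspace ?T" "proj EG (fst z) \<in> U" "fst z \<in> topspace (total_space EG)"
        using z unfolding topT by auto
      have 1: "s (proj EG (fst z)) \<in> topspace (total_space EG)" "proj EG (fst z) = proj EG (s (proj EG (fst z)))"
        using bspec[OF s z'(2)] by simp_all
      note tr = E.act_tr[OF z'(3) 1]
      show "E.tr (fst z) (s (proj EG (fst z))) \<in> carrier G" by (rule tr(2))
      show "fst (\<sigma> z) = s (proj EG (fst z))" "\<sigma> z \<in> topspace ?T" "?q (\<sigma> z) = ?q z"
        unfolding \<sigma>_def fst_act[OF z'(1) tr(2)] q_act[OF z'(1) tr(2)]
        using tr(1) act_in[OF z'(1) tr(2)] by simp_all
    qed
    have \<sigma>_inv: "\<sigma> z = \<sigma> w" if z: "z \<in> ?D" and w: "w \<in> ?D" and zw: "?q z = ?q w" for z w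
    proof -
      have zw': "z \<in> topspace ?T" "w \<in> topspace ?T" using z w by auto
      obtain g where g: "g \<in> carrier G" "w = EGH_act H t EG z g" using q_eq[OF zw' zw] by blast
      have fz: "fst z \<in> topspace (total_space EG)" using z unfolding topT by auto
      obtain g' where g': "g' \<in> carrier G" "\<sigma> w = EGH_act H t EG (\<sigma> z) g'"
        using q_eq[OF \<sigma>(3)[OF z] \<sigma>(3)[OF w]] \<sigma>(4)[OF z] \<sigma>(4)[OF w] zw by auto
      have "proj EG (fst w) = proj EG (fst z)"
        using g fst_act[OF zw'(1) g(1)] fz by simp
      then have "fst (\<sigma> w) = fst (\<sigma> z)" using \<sigma>(2)[OF z] \<sigma>(2)[OF w] by simp
      moreover have fs: "fst (\<sigma> z) \<in> topspace (total_space EG)" using \<sigma>(3)[OF z] unfolding topT by auto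
      ultimately have "act EG (fst (\<sigma> z)) g' = act EG (fst (\<sigma> z)) \<one>\<^bsub>G\<^esub>"
        using g'(2) fst_act[OF \<sigma>(3)[OF z] g'(1)] by simp
      then have "g' = \<one>\<^bsub>G\<^esub>" using E.act_eq_iff[OF fs g'(1), of "\<one>\<^bsub>G\<^esub>"] by simp
      then show ?thesis using g'(2) act_one[OF \<sigma>(3)[OF z]] by simp
    qed
    have "continuous_map (subtopology ?T ?D) TG (\<lambda>z. E.tr (fst z) (s (proj EG (fst z))))"
      by (rule E.continuous_map_tr[OF continuous_map_from_subtopology[OF continuous_map_fst]
            continuous_map_restrict_preimage[OF sc pc]]) (use s in auto)
    then have \<sigma>c: "continuous_map (subtopology ?T ?D) ?T \<sigma>"
      unfolding \<sigma>_def by (intro act_c) (simp_all add: continuous_map_from_subtopology)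
    define r where "r x = \<sigma> (inv_into ?D ?q x)" for x
    have rq: "r (?q z) = \<sigma> z" if z: "z \<in> ?D" for z
    proof -
      have V: "?q z \<in> ?V" using z by (rule imageI)
      show ?thesis
        unfolding r_def by (rule \<sigma>_inv[OF inv_into_into[OF V] z f_inv_into_f[OF V]])
    qed
    have "quotient_map (subtopology ?T ?D) (subtopology ?X ?V) ?q"
      by (rule quotient_map_restriction[OF q pre]) (rule disjI1[OF Vop])
    moreover have "continuous_map (subtopology ?T ?D) ?T (r \<circ> ?q)"
      by (rule continuous_map_eq[OF \<sigma>c]) (metis (no_types, lifting) Int_iff comp_apply rq topspace_subtopology)
    ultimately have "continuous_map (subtopology ?X ?V) ?T r"
      by (simp add: continuous_compose_quotient_map_eq)
    moreover have "\<forall>u\<in>?V. ?q (r u) = u"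
    proof
      fix u assume "u \<in> ?V"
      then obtain z where z: "z \<in> ?D" "u = ?q z" by (rule imageE)
      show "?q (r u) = u" unfolding z(2) rq[OF z(1)] by (rule \<sigma>(4)[OF z(1)])
    qed
    moreover have "x \<in> ?V" using y U(2) by auto
    ultimately show "\<exists>U s. openin ?X U \<and> x \<in> U \<and> continuous_map (subtopology ?X U) (total_space ?P) s \<and>
        (\<forall>u\<in>U. proj ?P (s u) = u)"
      using Vop by (intro exI[of _ ?V] exI[of _ r]) simp
  next
    let ?PP = "subtopology (prod_topology (total_space ?P) (total_space ?P)) {z. proj ?P (fst z) = proj ?P (snd z)}"
    have "continuous_map ?PP (total_space EG) (\<lambda>z. fst (fst z))" "continuous_map ?PP (total_space EG) (\<lambda>z. fst (snd z))"
      using continuous_map_fst'[OF continuous_map_fst[of ?T ?T]] continuous_map_fst'[OF continuous_map_snd[of ?T ?T]]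
      by (simp_all add: continuous_map_from_subtopology)
    then show "continuous_map ?PP TG (\<lambda>z. E.tr (fst (fst z)) (fst (snd z)))"
    proof (rule E.continuous_map_tr)
      fix z assume "z \<in> topspace ?PP"
      then have z: "fst z \<in> topspace ?T" "snd z \<in> topspace ?T" "?q (fst z) = ?q (snd z)" by auto
      obtain g where g: "g \<in> carrier G" "snd z = EGH_act H t EG (fst z) g" using q_eq[OF z] by blast
      have "fst (fst z) \<in> topspace (total_space EG)" using z(1) unfolding topT by auto
      then show "proj EG (fst (fst z)) = proj EG (fst (snd z))"
        using g fst_act[OF z(1) g(1)] by simp
    qed
  next
    fix y g assume "y \<in> topspace (total_space ?P)" "g \<in> carrier G"
    then show "E.tr (fst y) (fst (act ?P y g)) = g"
      using fst_act[of y g] by (auto simp: EGH_act_def)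
  next
    fix y y' assume y: "y \<in> topspace (total_space ?P)" "y' \<in> topspace (total_space ?P)" "proj ?P y = proj ?P y'"
    then have y': "y \<in> topspace ?T" "y' \<in> topspace ?T" "?q y = ?q y'" by simp_all
    obtain g where g: "g \<in> carrier G" "y' = EGH_act H t EG y g" using q_eq[OF y'] by blast
    have "fst y \<in> topspace (total_space EG)" using y'(1) unfolding topT by auto
    then show "act ?P y (E.tr (fst y) (fst y')) = y'"
      using g fst_act[OF y'(1) g(1)] by simp
  qed (simp_all only: classifying_bibundle_simps act_one act_act q_act G.one_closed)
  moreover have "continuous_map (total_space ?P) TH (structure_map ?P)"
    using continuous_map_snd[of "total_space EG" TH] by (simp add: classifying_bibundle_def)
  ultimately show ?thesis
    by (auto simp: is_bibundle_def EGH_act_def)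
qed

end

section \<open>Homotopy over a map\<close>

lemma homotopic_over_iff:
  "homotopic_over \<Phi> M X f\<^sub>0 f\<^sub>1 \<longleftrightarrow>
     (\<exists>h. continuous_map (prod_topology (top_of_set {0..1::real}) M) X h \<and>
       (\<forall>m\<in>topspace M. h (0, m) = f\<^sub>0 m \<and> h (1, m) = f\<^sub>1 m) \<and>
       (\<forall>r\<in>{0..1}. \<forall>m\<in>topspace M. \<Phi> (h (r, m)) = \<Phi> (f\<^sub>0 m)))"
  unfolding homotopic_over_def by (subst homotopic_with) auto

text \<open>The condition on the intermediate maps is anchored at the starting map. This allows it
  to be anchored anew at the other end, as symmetry and transitivity require.\<close>

lemma homotopic_over_imp_eq:
  "homotopic_over \<Phi> M X f\<^sub>0 f\<^sub>1 \<Longrightarrow> m \<in> topspace M \<Longrightarrow> \<Phi> (f\<^sub>1 m) = \<Phi> (f\<^sub>0 m)"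
  unfolding homotopic_over_def by (drule homotopic_with_imp_property) simp

lemma homotopic_over_sym:
  assumes "homotopic_over \<Phi> M X f\<^sub>0 f\<^sub>1"
  shows "homotopic_over \<Phi> M X f\<^sub>1 f\<^sub>0"
  using homotopic_with_symD[OF assms[unfolded homotopic_over_def]]
  unfolding homotopic_over_def
  by (rule homotopic_with_mono) (simp add: homotopic_over_imp_eq[OF assms])

lemma homotopic_over_trans:
  assumes "homotopic_over \<Phi> M X f\<^sub>0 f\<^sub>1" "homotopic_over \<Phi> M X f\<^sub>1 f\<^sub>2"
  shows "homotopic_over \<Phi> M X f\<^sub>0 f\<^sub>2"
proof -
  have "homotopic_with (\<lambda>k. \<forall>m\<in>topspace M. \<Phi> (k m) = \<Phi> (f\<^sub>0 m)) M X f\<^sub>1 f\<^sub>2"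
    using assms(2)[unfolded homotopic_over_def]
    by (rule homotopic_with_mono) (simp add: homotopic_over_imp_eq[OF assms(1)])
  then show ?thesis
    using assms(1) unfolding homotopic_over_def by (rule homotopic_with_trans[rotated])
qed

lemma equiv_homotopy_rel_over:
  "equiv {f. continuous_map M X f} (homotopy_rel_over \<Phi> M X)"
proof (rule equivI)
  show "homotopy_rel_over \<Phi> M X \<subseteq> {f. continuous_map M X f} \<times> {f. continuous_map M X f}"
    by (auto simp: homotopy_rel_over_def)
  show "refl_on {f. continuous_map M X f} (homotopy_rel_over \<Phi> M X)"
    by (auto simp: refl_on_def homotopy_rel_over_def homotopic_over_def)
  show "sym (homotopy_rel_over \<Phi> M X)"
    by (auto simp: sym_def homotopy_rel_over_def homotopic_over_sym)
  show "trans (homotopy_rel_over \<Phi> M X)"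
    by (rule transI) (auto simp: homotopy_rel_over_def intro: homotopic_over_trans)
qed

text \<open>\<open>C\<close> is a relation because a bibundle has many classifying maps. The
  equivalence \<open>iff\<close>, which covers x' = x with different y and y', makes the assignment
  well defined on classes and injective at once.\<close>

lemma bij_betw_quotients:
  assumes A: "equiv A R" and B: "equiv B S"
    and dom: "\<And>x y. C x y \<Longrightarrow> x \<in> A \<Longrightarrow> y \<in> B"
    and total: "\<And>x. x \<in> A \<Longrightarrow> \<exists>y. C x y" and surj: "\<And>y. y \<in> B \<Longrightarrow> \<exists>x\<in>A. C x y"
    and iff: "\<And>x y x' y'. x \<in> A \<Longrightarrow> x' \<in> A \<Longrightarrow> C x y \<Longrightarrow> C x' y' \<Longrightarrow> (x, x') \<in> R \<longleftrightarrow> (y, y') \<in> S"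
  shows "\<exists>c. bij_betw c (A // R) (B // S) \<and> (\<forall>x\<in>A. \<forall>y. C x y \<longrightarrow> c (R `` {x}) = S `` {y})"
proof -
  obtain \<gamma> where \<gamma>: "\<And>x. x \<in> A \<Longrightarrow> C x (\<gamma> x)" using total by metis
  define c where "c K = S `` {\<gamma> (SOME x. x \<in> K)}" for K
  have c: "c (R `` {x}) = S `` {y}" if x: "x \<in> A" and y: "C x y" for x y
  proof -
    let ?x = "SOME x'. x' \<in> R `` {x}"
    have "x \<in> R `` {x}" by (rule equiv_class_self[OF A x])
    then have "?x \<in> R `` {x}" by (rule someI)
    then have *: "(x, ?x) \<in> R" by simp
    then have x': "?x \<in> A" using equiv_type[OF A] by blast
    have "(y, \<gamma> ?x) \<in> S" using iff[OF x x' y \<gamma>[OF x']] * by simp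
    then show ?thesis unfolding c_def by (rule equiv_class_eq[OF B, symmetric])
  qed
  have "inj_on c (A // R)"
  proof (rule inj_onI)
    fix K K' assume "K \<in> A // R" "K' \<in> A // R" and eq: "c K = c K'"
    then obtain x x' where x: "x \<in> A" "K = R `` {x}" and x': "x' \<in> A" "K' = R `` {x'}"
      by (auto elim!: quotientE)
    have "S `` {\<gamma> x} = S `` {\<gamma> x'}"
      using eq c[OF x(1) \<gamma>[OF x(1)]] c[OF x'(1) \<gamma>[OF x'(1)]] x(2) x'(2) by simp
    then have "(\<gamma> x, \<gamma> x') \<in> S"
      by (rule eq_equiv_class[OF _ B dom[OF \<gamma>[OF x'(1)] x'(1)]])
    then have "(x, x') \<in> R"
      using iff[OF x(1) x'(1) \<gamma>[OF x(1)] \<gamma>[OF x'(1)]] by simp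
    then show "K = K'" unfolding x(2) x'(2) by (rule equiv_class_eq[OF A])
  qed
  moreover have "c ` (A // R) = B // S"
  proof (intro equalityI subsetI)
    fix Z assume "Z \<in> c ` (A // R)"
    then obtain x where x: "x \<in> A" "Z = c (R `` {x})" by (auto elim!: quotientE)
    have "Z = S `` {\<gamma> x}" unfolding x(2) by (rule c[OF x(1) \<gamma>[OF x(1)]])
    then show "Z \<in> B // S" using quotientI[OF dom[OF \<gamma>[OF x(1)] x(1)]] by simp
  next
    fix Z assume "Z \<in> B // S"
    then obtain y where y: "y \<in> B" "Z = S `` {y}" by (auto elim!: quotientE)
    obtain x where x: "x \<in> A" "C x y" using surj[OF y(1)] by blast
    have "Z = c (R `` {x})" using c[OF x] y(2) by simp
    then show "Z \<in> c ` (A // R)" using quotientI[OF x(1), of R] by blast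
  qed
  ultimately have "bij_betw c (A // R) (B // S)" by (simp add: bij_betw_def)
  then show ?thesis using c by blast
qed

context admissible_crossed_module
begin

section \<open>Classification\<close>

text \<open>A pair of maps into EG and H is one map into EG x H, whose second component is forced to
  be the structure map. The map to BG carries no further information: it is recovered by descent
  from the equivariant map.\<close>

lemma classifies_iff:
  assumes EG: "principal G TG BG EG" and P: "is_bibundle G TG H TH t M P"
  shows "classifies G H t BG EG M P \<Gamma> \<longleftrightarrow>
    (\<exists>A. equivariant_map G P (classifying_bibundle G H TH t EG) A \<and>
      (\<forall>p\<in>topspace (total_space P). EGH_class G H t EG (A p) = \<Gamma> (proj P p) \<and>
        snd (A p) = structure_map P p))" (is "_ \<longleftrightarrow> ?R")
proof
  note \<psi> = bibundleD(2-4)[OF P]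
  assume "classifies G H t BG EG M P \<Gamma>"
  then obtain f F where F: "equivariant_map G P EG F"
    and \<Gamma>: "\<forall>p\<in>topspace (total_space P). proj EG (F p) = f (proj P p) \<and>
           \<Gamma> (proj P p) = EGH_class G H t EG (F p, structure_map P p)"
    unfolding classifies_def by blast
  have "equivariant_map G P (classifying_bibundle G H TH t EG) (\<lambda>p. (F p, structure_map P p))"
    using F unfolding equivariant_map_def
    by (simp add: continuous_map_pairedI \<psi>(1) \<psi>(3) EGH_act_def)
  then show ?R using \<Gamma> by (intro exI[of _ "\<lambda>p. (F p, structure_map P p)"]) simp
next
  interpret E: principal G TG BG EG by (rule EG)
  interpret P: principal G TG M P by (rule bibundleD(1)[OF P])
  assume ?R
  then obtain A where A: "equivariant_map G P (classifying_bibundle G H TH t EG) A"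
    and \<Gamma>: "\<forall>p\<in>topspace (total_space P). EGH_class G H t EG (A p) = \<Gamma> (proj P p) \<and>
        snd (A p) = structure_map P p" by blast
  define F where "F p = fst (A p)" for p
  have A_pair: "A p = (F p, structure_map P p)" if "p \<in> topspace (total_space P)" for p
    using bspec[OF \<Gamma> that] by (simp add: F_def prod_eq_iff)
  have "continuous_map (total_space P) (prod_topology (total_space EG) TH) A"
    using A by (simp add: equivariant_map_def)
  then have Fc: "continuous_map (total_space P) (total_space EG) F"
    unfolding F_def by (rule continuous_map_fst')
  have F_act: "F (act P p g) = act EG (F p) g" if "p \<in> topspace (total_space P)" "g \<in> carrier G" for p g
  proof -
    have "A (act P p g) = EGH_act H t EG (A p) g"
      using A that by (simp add: equivariant_map_def)
    then show ?thesis by (simp add: F_def EGH_act_def case_prod_unfold)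
  qed
  \<comment> \<open>Any point of the fibre serves: by equivariance \<open>F\<close> stays within one
    fibre of EG as p runs through a fibre of P.\<close>
  define f where "f m = proj EG (F (SOME p. p \<in> topspace (total_space P) \<and> proj P p = m))" for m
  have f: "f (proj P p) = proj EG (F p)" if p: "p \<in> topspace (total_space P)" for p
  proof -
    let ?p = "SOME q. q \<in> topspace (total_space P) \<and> proj P q = proj P p"
    have *: "?p \<in> topspace (total_space P) \<and> proj P ?p = proj P p"
      by (rule someI[of _ p]) (simp add: p)
    then have tr: "act P ?p (P.tr ?p p) = p" "P.tr ?p p \<in> carrier G"
      using P.act_tr[of ?p p] p by simp_all
    have "F p = act EG (F ?p) (P.tr ?p p)"
      using F_act[OF conjunct1[OF *] tr(2)] tr(1) by simp
    then show ?thesis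
      using tr(2) continuous_map_in[OF Fc conjunct1[OF *]] by (simp add: f_def)
  qed
  have "continuous_map M BG f"
    by (rule P.proj_descends'[OF E.continuous_map_proj[OF Fc] f])
  moreover have "equivariant_map G P EG F"
    using Fc F_act by (simp add: equivariant_map_def)
  ultimately show "classifies G H t BG EG M P \<Gamma>"
    unfolding classifies_def using \<Gamma> f A_pair by (intro exI[of _ f] exI[of _ F]) simp
qed

lemma classifies_continuous:
  assumes EG: "principal G TG BG EG" and P: "is_bibundle G TG H TH t M P"
    and cl: "classifies G H t BG EG M P \<Gamma>"
  shows "continuous_map M (EGH_quotient G H TH t EG) \<Gamma>"
proof -
  interpret P: principal G TG M P by (rule bibundleD(1)[OF P])
  interpret C: principal G TG "EGH_quotient G H TH t EG" "classifying_bibundle G H TH t EG"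
    by (rule bibundleD(1)[OF is_bibundle_classifying_bibundle[OF EG]])
  obtain A where A: "equivariant_map G P (classifying_bibundle G H TH t EG) A"
    and \<Gamma>: "\<forall>p\<in>topspace (total_space P). EGH_class G H t EG (A p) = \<Gamma> (proj P p) \<and>
        snd (A p) = structure_map P p"
    using cl unfolding classifies_iff[OF EG P] by blast
  have "continuous_map (total_space P) (EGH_quotient G H TH t EG) (\<lambda>p. EGH_class G H t EG (A p))"
    using C.continuous_map_proj[of "total_space P" A] A by (simp add: equivariant_map_def)
  then show ?thesis
    by (rule P.proj_descends') (use \<Gamma> in simp)
qed

lemma universal_bundleD:
  assumes "universal_bundle G TG BG EG"
  shows "principal G TG BG EG" "contractible_space (total_space EG)"
    "\<exists>e. e \<in> topspace (total_space EG)"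
proof -
  show "principal G TG BG EG"
    using assms by unfold_locales (simp add: universal_bundle_def)
  show "contractible_space (total_space EG)" "\<exists>e. e \<in> topspace (total_space EG)"
    using assms unfolding universal_bundle_def by blast+
qed

text \<open>The contraction \<open>K\<close> is run over P. Its end gives an equivariant map to EG,
  and starting it at any other equivariant map gives an equivariant homotopy to that one. So a
  single \<Gamma> is homotopic over the type to all choices.\<close>

lemma ex_classifies:
  assumes M: "paracompact_space M" and EG: "universal_bundle G TG BG EG"
    and P: "is_bibundle G TG H TH t M P"
  shows "\<exists>\<Gamma>. classifies G H t BG EG M P \<Gamma> \<and> (\<forall>\<Gamma>'. classifies G H t BG EG M P \<Gamma>' \<longrightarrow>
    homotopic_over type_map M (EGH_quotient G H TH t EG) \<Gamma>' \<Gamma>)"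
proof -
  interpret E: principal G TG BG EG by (rule universal_bundleD(1)[OF EG])
  interpret P: principal G TG M P by (rule bibundleD(1)[OF P])
  let ?C = "classifying_bibundle G H TH t EG" and ?X = "EGH_quotient G H TH t EG"
  let ?I = "top_of_set {0..1::real}"
  interpret C: principal G TG ?X ?C
    by (rule bibundleD(1)[OF is_bibundle_classifying_bibundle[OF E.principal_axioms]])
  note \<psi> = bibundleD(2-4)[OF P]
  obtain e0 where e0: "e0 \<in> topspace (total_space EG)" using universal_bundleD(3)[OF EG] by blast
  obtain K where Kc: "continuous_map (prod_topology (total_space P) (prod_topology (total_space EG) ?I))
       (total_space EG) K"
    and K0: "\<And>p e. p \<in> topspace (total_space P) \<Longrightarrow> e \<in> topspace (total_space EG) \<Longrightarrow> K (p, e, 0) = e"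
    and K1: "\<And>p e e'. p \<in> topspace (total_space P) \<Longrightarrow> e \<in> topspace (total_space EG) \<Longrightarrow>
        e' \<in> topspace (total_space EG) \<Longrightarrow> K (p, e, 1) = K (p, e', 1)"
    and K_act: "\<And>p e r g. p \<in> topspace (total_space P) \<Longrightarrow> e \<in> topspace (total_space EG) \<Longrightarrow> r \<in> {0..1} \<Longrightarrow>
        g \<in> carrier G \<Longrightarrow> K (act P p g, act EG e g, r) = act EG (K (p, e, r)) g"
    by (rule equivariant_contraction[OF M P.principal_axioms E.principal_axioms universal_bundleD(2)[OF EG]])
      (rule that)
  have K_in: "K (p, e, r) \<in> topspace (total_space EG)"
    if "p \<in> topspace (total_space P)" "e \<in> topspace (total_space EG)" "r \<in> {0..1}" for p e r
    using continuous_map_in[OF Kc, of "(p, e, r)"] that by simp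
  \<comment> \<open>The constant map to \<open>e0\<close> is not equivariant. But at time 1 the
    second argument is irrelevant, so \<open>e0\<close> may be replaced by its translate by g, and
    equivariance of \<open>K\<close> applies.\<close>
  have K1_act: "K (act P p g, e0, 1) = act EG (K (p, e0, 1)) g"
    if p: "p \<in> topspace (total_space P)" and g: "g \<in> carrier G" for p g
  proof -
    have "K (act P p g, e0, 1) = K (act P p g, act EG e0 g, 1)"
      using p g e0 by (intro K1) simp_all
    also have "\<dots> = act EG (K (p, e0, 1)) g"
      by (rule K_act) (use p g e0 in simp_all)
    finally show ?thesis .
  qed
  define \<Gamma> where "\<Gamma> m = (let p = (SOME p. p \<in> topspace (total_space P) \<and> proj P p = m)
    in EGH_class G H t EG (K (p, e0, 1), structure_map P p))" for m
  define A where "A p = (K (p, e0, 1), structure_map P p)" for p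
  have "continuous_map (total_space P) (total_space EG) (\<lambda>p. K (p, e0, 1))"
    by (rule continuous_map_comp[OF Kc]) (use e0 in \<open>auto intro!: continuous_map_pairedI\<close>)
  then have A_equi: "equivariant_map G P ?C A"
    unfolding equivariant_map_def A_def
    by (simp add: continuous_map_pairedI \<psi>(1) \<psi>(3) K1_act EGH_act_def)
  have A_act: "A (act P q g) = act ?C (A q) g" if "q \<in> topspace (total_space P)" "g \<in> carrier G" for q g
    using A_equi that unfolding equivariant_map_def by blast
  have \<Gamma>A: "EGH_class G H t EG (A p) = \<Gamma> (proj P p)" if p: "p \<in> topspace (total_space P)" for p
  proof -
    let ?p = "SOME q. q \<in> topspace (total_space P) \<and> proj P q = proj P p"
    have *: "?p \<in> topspace (total_space P) \<and> proj P ?p = proj P p"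
      by (rule someI[of _ p]) (simp add: p)
    then have tr: "act P ?p (P.tr ?p p) = p" "P.tr ?p p \<in> carrier G"
      using P.act_tr[of ?p p] p by simp_all
    have A_in: "A ?p \<in> topspace (total_space ?C)"
      using continuous_map_in[of "total_space P" "total_space ?C" A ?p] A_equi *
      by (simp only: equivariant_map_def)
    have "A p = act ?C (A ?p) (P.tr ?p p)"
      using A_act[OF conjunct1[OF *] tr(2)] unfolding tr(1) .
    then have "EGH_class G H t EG (A p) = EGH_class G H t EG (A ?p)"
      using C.proj_act[OF A_in tr(2)] by simp
    then show ?thesis by (simp add: \<Gamma>_def A_def Let_def)
  qed
  have cl: "classifies G H t BG EG M P \<Gamma>"
    unfolding classifies_iff[OF E.principal_axioms P]
    by (rule exI[of _ A]) (simp add: A_equi \<Gamma>A, simp add: A_def)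
  have "homotopic_over type_map M ?X \<Gamma>' \<Gamma>" if cl': "classifies G H t BG EG M P \<Gamma>'" for \<Gamma>'
  proof -
    obtain f F where F: "equivariant_map G P EG F"
      and \<Gamma>': "\<forall>p\<in>topspace (total_space P). proj EG (F p) = f (proj P p) \<and>
             \<Gamma>' (proj P p) = EGH_class G H t EG (F p, structure_map P p)"
      using cl' unfolding classifies_def by blast
    have Fc: "continuous_map (total_space P) (total_space EG) F"
      and F_act: "\<And>p g. p \<in> topspace (total_space P) \<Longrightarrow> g \<in> carrier G \<Longrightarrow> F (act P p g) = act EG (F p) g"
      using F by (simp_all add: equivariant_map_def)
    note F_in = continuous_map_in[OF Fc]
    \<comment> \<open>Contracts \<open>F\<close> while leaving the structure map alone, so all
      stages have the same type; at r = 1 the dependence on \<open>F\<close> is gone and every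
      \<Gamma>' arrives at the same \<Gamma>.\<close>
    define B where "B = (\<lambda>(r, p). (K (p, F p, r), structure_map P p))"
    have Bc: "continuous_map (prod_topology ?I (total_space P)) (total_space ?C) B"
    proof -
      have "continuous_map (prod_topology ?I (total_space P)) (total_space EG) (\<lambda>z. K (snd z, F (snd z), fst z))"
        by (rule continuous_map_comp[OF Kc]) (intro continuous_map_pairedI continuous_map_snd
            continuous_map_fst continuous_map_comp[OF Fc continuous_map_snd])
      then show ?thesis
        unfolding B_def case_prod_unfold classifying_bibundle_simps
        by (intro continuous_map_pairedI continuous_map_comp[OF \<psi>(1) continuous_map_snd])
    qed
    have B_in: "B (r, p) \<in> topspace (total_space ?C)" if "r \<in> {0..1}" "p \<in> topspace (total_space P)" for r p
      using continuous_map_in[OF Bc, of "(r, p)"] that by simp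
    have B_act: "B (r, act P p g) = act ?C (B (r, p)) g"
      if "r \<in> {0..1}" "p \<in> topspace (total_space P)" "g \<in> carrier G" for r p g
      using that F_in by (simp add: B_def F_act K_act EGH_act_def \<psi>(3))
    define h where "h = (\<lambda>(r, m). EGH_class G H t EG (B (r, SOME p. p \<in> topspace (total_space P) \<and> proj P p = m)))"
    have h: "h (r, proj P p) = EGH_class G H t EG (B (r, p))"
      if r: "r \<in> topspace ?I" and p: "p \<in> topspace (total_space P)" for r p
    proof -
      let ?p = "SOME q. q \<in> topspace (total_space P) \<and> proj P q = proj P p"
      have *: "?p \<in> topspace (total_space P) \<and> proj P ?p = proj P p"
        by (rule someI[of _ p]) (simp add: p)
      then have tr: "act P ?p (P.tr ?p p) = p" "P.tr ?p p \<in> carrier G"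
        using P.act_tr[of ?p p] p by simp_all
      have r': "r \<in> {0..1}" using r by simp
      have "EGH_class G H t EG (B (r, p)) = EGH_class G H t EG (B (r, ?p))"
        using B_act[OF r' conjunct1[OF *] tr(2)] C.proj_act[OF B_in[OF r' conjunct1[OF *]] tr(2)] tr(1)
        by simp
      then show ?thesis by (simp add: h_def)
    qed
    have "continuous_map (prod_topology ?I (total_space P)) ?X (\<lambda>z. EGH_class G H t EG (B z))"
      using C.continuous_map_proj[OF Bc] by simp
    then have "continuous_map (prod_topology ?I M) ?X h"
      by (rule P.proj_descends) (rule h)
    moreover have "h (0, m) = \<Gamma>' m \<and> h (1, m) = \<Gamma> m" "\<And>r. r \<in> {0..1} \<Longrightarrow> type_map (h (r, m)) = type_map (\<Gamma>' m)"
      if m: "m \<in> topspace M" for m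
    proof -
      obtain p where p: "p \<in> topspace (total_space P)" "m = proj P p"
        using P.ex_point_over[OF m] by blast
      have "B (0, p) = (F p, structure_map P p)" "B (1, p) = A p"
        using K0[OF p(1) F_in[OF p(1)]] K1[OF p(1) F_in[OF p(1)] e0] by (simp_all add: B_def A_def)
      then show "h (0, m) = \<Gamma>' m \<and> h (1, m) = \<Gamma> m"
        using h[of 0 p] h[of 1 p] bspec[OF \<Gamma>' p(1)] \<Gamma>A[OF p(1)] p by simp
      show "type_map (h (r, m)) = type_map (\<Gamma>' m)" if "r \<in> {0..1}" for r
        using h[of r p] bspec[OF \<Gamma>' p(1)] p that by (simp add: B_def type_map_EGH_class)
    qed
    ultimately show ?thesis
      unfolding homotopic_over_iff by (intro exI[of _ h]) simp
  qed
  with cl show ?thesis by blast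
qed

text \<open>Equality of the cosets of h and h' puts h^-1 h' into t(G). This is the bridge from
  homotopy over the type map to the hypothesis of transport.\<close>

lemma constant_type_classifying_bibundle:
  assumes "\<And>r m. r \<in> {0..1} \<Longrightarrow> m \<in> topspace M \<Longrightarrow> type_map (h (r, m)) = type_map (\<Gamma> m)"
  shows "constant_type (classifying_bibundle G H TH t EG) M h"
  unfolding constant_type_def
proof (intro ballI impI)
  let ?C = "classifying_bibundle G H TH t EG"
  fix m r r' y y'
  assume m: "m \<in> topspace M" and r: "r \<in> {0..1::real}" "r' \<in> {0..1::real}"
    and y: "y \<in> topspace (total_space ?C)" "y' \<in> topspace (total_space ?C)"
    and p: "proj ?C y = h (r, m)" "proj ?C y' = h (r', m)"
  have y_in: "snd y \<in> carrier H" "snd y' \<in> carrier H"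
    using y by (auto simp: H.topspace_eq_carrier)
  have "type_map (EGH_class G H t EG y) = type_map (EGH_class G H t EG y')"
    using p assms[OF r(1) m] assms[OF r(2) m] by simp
  then have "snd y <#\<^bsub>H\<^esub> (t ` carrier G) = snd y' <#\<^bsub>H\<^esub> (t ` carrier G)"
    using type_map_EGH_class[of G H t EG "fst y" "snd y"] type_map_EGH_class[of G H t EG "fst y'" "snd y'"]
    by simp
  moreover have "snd y' \<in> snd y' <#\<^bsub>H\<^esub> (t ` carrier G)"
    using y_in by (force simp: l_coset_def intro: bexI[of _ "\<one>\<^bsub>G\<^esub>"])
  ultimately obtain g where g: "g \<in> carrier G" "snd y' = snd y \<otimes>\<^bsub>H\<^esub> t g"
    by (auto simp: l_coset_def)
  have "inv\<^bsub>H\<^esub> snd y \<otimes>\<^bsub>H\<^esub> snd y' = t g"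
    using g y_in by (simp add: H.m_assoc[symmetric])
  then show "inv\<^bsub>H\<^esub> structure_map ?C y \<otimes>\<^bsub>H\<^esub> structure_map ?C y' \<in> t ` carrier G"
    using g(1) by simp
qed

lemma equiv_Bibun_iso_rel:
  fixes M :: "'m topology"
  shows "equiv (Bibun G TG H TH t M :: ('u, 'g, 'm, 'h) bibundle set) (Bibun_iso_rel G TG H TH t M)"
proof (rule equivI)
  let ?R = "Bibun_iso_rel G TG H TH t M :: ('u, 'g, 'm, 'h) bibundle rel"
  have id: "equivariant_map G P P (\<lambda>p. p)" for P :: "('u, 'g, 'm, 'h) bibundle"
    by (simp add: equivariant_map_def)
  show "?R \<subseteq> Bibun G TG H TH t M \<times> Bibun G TG H TH t M"
    by (auto simp: Bibun_iso_rel_def)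
  have "bibundle_iso G P P (\<lambda>p. p)" for P :: "('u, 'g, 'm, 'h) bibundle"
    using id[of P] homeomorphic_map_id[of "total_space P" "total_space P"]
    by (simp add: bibundle_iso_def id_def)
  then show "refl_on (Bibun G TG H TH t M) ?R"
    by (auto simp: refl_on_def Bibun_iso_rel_def)
  show "sym ?R"
  proof (rule symI)
    fix P Q assume "(P, Q) \<in> ?R"
    then obtain f where PQ: "is_bibundle G TG H TH t M P" "is_bibundle G TG H TH t M Q"
      and f: "bibundle_iso G P Q f"
      by (auto simp: Bibun_iso_rel_def Bibun_def)
    \<comment> \<open>The inverse isomorphism is obtained by comparing the identity of Q and f as
      two maps into the common target Q.\<close>
    have "\<exists>g. bibundle_iso G Q P g"
      by (rule bibundle_iso_of_common_target[OF PQ(2) PQ(2) PQ(1) id, where B = f and k = "\<lambda>m. m"])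
        (use f in \<open>simp_all add: bibundle_iso_def\<close>)
    then show "(Q, P) \<in> ?R" using PQ by (simp add: Bibun_iso_rel_def Bibun_def)
  qed
  show "trans ?R"
  proof (rule transI)
    fix P Q R assume "(P, Q) \<in> ?R" "(Q, R) \<in> ?R"
    then obtain f g where PR: "P \<in> Bibun G TG H TH t M" "R \<in> Bibun G TG H TH t M"
      and f: "bibundle_iso G P Q f" and g: "bibundle_iso G Q R g"
      by (auto simp: Bibun_iso_rel_def)
    have fin: "f p \<in> topspace (total_space Q)" if "p \<in> topspace (total_space P)" for p
      using f continuous_map_in[OF _ that] by (auto simp: bibundle_iso_def equivariant_map_def)
    have "bibundle_iso G P R (\<lambda>p. g (f p))"
      using f g fin homeomorphic_map_compose[of "total_space P" "total_space Q" f "total_space R" g]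
      unfolding bibundle_iso_def equivariant_map_def
      by (auto simp: o_def intro: continuous_map_comp)
    then show "(P, R) \<in> ?R" using PR by (auto simp: Bibun_iso_rel_def)
  qed
qed

text \<open>Composing with an isomorphism from P to Q turns classifying data of Q into data of P, so
  \<Gamma>' also classifies P and uniqueness up to homotopy applies. Conversely, a homotopy over the
  type has constant type, so transport along it yields the isomorphism.\<close>

lemma Bibun_iso_rel_iff_homotopy_rel_over:
  assumes M: "paracompact_space M" and EG: "universal_bundle G TG BG EG"
    and P: "P \<in> Bibun G TG H TH t M" and Q: "Q \<in> Bibun G TG H TH t M"
    and \<Gamma>: "classifies G H t BG EG M P \<Gamma>" and \<Gamma>': "classifies G H t BG EG M Q \<Gamma>'"
  shows "(P, Q) \<in> Bibun_iso_rel G TG H TH t M \<longleftrightarrow>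
    (\<Gamma>, \<Gamma>') \<in> homotopy_rel_over type_map M (EGH_quotient G H TH t EG)"
proof
  note E = universal_bundleD(1)[OF EG]
  have P': "is_bibundle G TG H TH t M P" and Q': "is_bibundle G TG H TH t M Q"
    using P Q by (simp_all add: Bibun_def)
  let ?C = "classifying_bibundle G H TH t EG" and ?X = "EGH_quotient G H TH t EG"
  have cont: "continuous_map M ?X \<Gamma>" "continuous_map M ?X \<Gamma>'"
    using classifies_continuous[OF E P' \<Gamma>] classifies_continuous[OF E Q' \<Gamma>'] .
  obtain A where A: "equivariant_map G P ?C A"
    and \<Gamma>A: "\<forall>p\<in>topspace (total_space P). EGH_class G H t EG (A p) = \<Gamma> (proj P p) \<and>
      snd (A p) = structure_map P p"
    using \<Gamma> unfolding classifies_iff[OF E P'] by blast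
  obtain B where B: "equivariant_map G Q ?C B"
    and \<Gamma>B: "\<forall>q\<in>topspace (total_space Q). EGH_class G H t EG (B q) = \<Gamma>' (proj Q q) \<and>
      snd (B q) = structure_map Q q"
    using \<Gamma>' unfolding classifies_iff[OF E Q'] by blast
  {
    assume "(P, Q) \<in> Bibun_iso_rel G TG H TH t M"
    then obtain f where f: "bibundle_iso G P Q f" by (auto simp: Bibun_iso_rel_def)
    have fc: "continuous_map (total_space P) (total_space Q) f"
      using f by (simp add: bibundle_iso_def equivariant_map_def)
    have "equivariant_map G P ?C (\<lambda>p. B (f p))"
      using f B continuous_map_in[OF fc]
      unfolding bibundle_iso_def equivariant_map_def by (auto intro: continuous_map_comp)
    moreover have "EGH_class G H t EG (B (f p)) = \<Gamma>' (proj P p) \<and> snd (B (f p)) = structure_map P p"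
      if p: "p \<in> topspace (total_space P)" for p
      using bspec[OF \<Gamma>B continuous_map_in[OF fc p]] f p by (simp add: bibundle_iso_def)
    ultimately have "classifies G H t BG EG M P \<Gamma>'"
      unfolding classifies_iff[OF E P'] by blast
    then have "homotopic_over type_map M ?X \<Gamma> \<Gamma>'"
      using ex_classifies[OF M EG P'] \<Gamma> homotopic_over_sym homotopic_over_trans by metis
    then show "(\<Gamma>, \<Gamma>') \<in> homotopy_rel_over type_map M ?X"
      using cont by (simp add: homotopy_rel_over_def)
  next
    assume "(\<Gamma>, \<Gamma>') \<in> homotopy_rel_over type_map M ?X"
    then obtain h where h: "continuous_map (prod_topology (top_of_set {0..1::real}) M) ?X h"
      and h01: "\<forall>m\<in>topspace M. h (0, m) = \<Gamma> m \<and> h (1, m) = \<Gamma>' m"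
      and type: "\<forall>r\<in>{0..1}. \<forall>m\<in>topspace M. type_map (h (r, m)) = type_map (\<Gamma> m)"
      by (auto simp: homotopy_rel_over_def homotopic_over_iff)
    interpret P: principal G TG M P by (rule bibundleD(1)[OF P'])
    interpret Q: principal G TG M Q by (rule bibundleD(1)[OF Q'])
    have "\<exists>f. bibundle_iso G P Q f"
    proof (rule bibundle_iso_of_homotopy[OF M is_bibundle_classifying_bibundle[OF E] P' Q' A B h])
      show "constant_type ?C M h"
        by (rule constant_type_classifying_bibundle[where \<Gamma> = \<Gamma>]) (simp add: type)
    qed (simp_all add: \<Gamma>A \<Gamma>B h01)
    then show "(P, Q) \<in> Bibun_iso_rel G TG H TH t M"
      using P Q by (simp add: Bibun_iso_rel_def)
  }
qed

lemma classification:
  fixes M :: "'m topology" and \<iota> :: "'m \<times> 'g \<Rightarrow> 'u" and EG :: "('e, 'g, 'b) gbundle"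
  assumes M: "paracompact_space M" and EG: "universal_bundle G TG BG EG"
    and \<iota>: "inj_on \<iota> (topspace M \<times> carrier G)"
  shows "\<exists>c. bij_betw c
           (pi0_Bibun G TG H TH t M :: ('u, 'g, 'm, 'h) bibundle set set)
           (homotopy_classes_over type_map M (EGH_quotient G H TH t EG)) \<and>
         (\<forall>P \<in> Bibun G TG H TH t M. \<forall>\<Gamma>. classifies G H t BG EG M P \<Gamma> \<longrightarrow>
            c (Bibun_iso_rel G TG H TH t M `` {P}) = homotopy_rel_over type_map M (EGH_quotient G H TH t EG) `` {\<Gamma>})"
  unfolding pi0_Bibun_def homotopy_classes_over_def
proof (rule bij_betw_quotients[OF equiv_Bibun_iso_rel equiv_homotopy_rel_over])
  note E = universal_bundleD(1)[OF EG]
  fix P :: "('u, 'g, 'm, 'h) bibundle" assume P: "P \<in> Bibun G TG H TH t M"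
  then have P': "is_bibundle G TG H TH t M P" by (simp add: Bibun_def)
  show "\<exists>\<Gamma>. classifies G H t BG EG M P \<Gamma>"
    using ex_classifies[OF M EG P'] by blast
  fix \<Gamma> assume \<Gamma>: "classifies G H t BG EG M P \<Gamma>"
  show "\<Gamma> \<in> {f. continuous_map M (EGH_quotient G H TH t EG) f}"
    using classifies_continuous[OF E P' \<Gamma>] by simp
  fix Q :: "('u, 'g, 'm, 'h) bibundle" and \<Gamma>'
  assume Q: "Q \<in> Bibun G TG H TH t M" and \<Gamma>': "classifies G H t BG EG M Q \<Gamma>'"
  show "(P, Q) \<in> Bibun_iso_rel G TG H TH t M \<longleftrightarrow>
      (\<Gamma>, \<Gamma>') \<in> homotopy_rel_over type_map M (EGH_quotient G H TH t EG)"
    by (rule Bibun_iso_rel_iff_homotopy_rel_over[OF M EG P Q \<Gamma> \<Gamma>'])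
next
  note E = universal_bundleD(1)[OF EG]
  fix \<Gamma> assume "\<Gamma> \<in> {f. continuous_map M (EGH_quotient G H TH t EG) f}"
  then have c: "continuous_map M (EGH_quotient G H TH t EG) \<Gamma>" by simp
  \<comment> \<open>Surjectivity: the pullback of EG x H along \<Gamma> has \<Gamma> among its
    classifying maps, and the labelling \<iota> realises it with points in the prescribed
    type.\<close>
  obtain P :: "('u, 'g, 'm, 'h) bibundle" and F where P: "is_bibundle G TG H TH t M P"
    and F: "equivariant_map G P (classifying_bibundle G H TH t EG) F"
    and \<Gamma>: "\<forall>p\<in>topspace (total_space P). proj (classifying_bibundle G H TH t EG) (F p) = \<Gamma> (proj P p) \<and>
      structure_map (classifying_bibundle G H TH t EG) (F p) = structure_map P p"
    using pullback_bibundle[OF is_bibundle_classifying_bibundle[OF E] c \<iota>] by blast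
  have "classifies G H t BG EG M P \<Gamma>"
    unfolding classifies_iff[OF E P] using F \<Gamma> by (intro exI[of _ F]) simp
  then show "\<exists>P\<in>(Bibun G TG H TH t M :: ('u, 'g, 'm, 'h) bibundle set). classifies G H t BG EG M P \<Gamma>"
    using P by (auto simp: Bibun_def)
qed

end

theorem theorem3p12:
  fixes G :: "('g, 'x) monoid_scheme" and TG :: "'g topology"
    and H :: "('h, 'y) monoid_scheme" and TH :: "'h topology"
    and t :: "'g \<Rightarrow> 'h" and \<alpha> :: "'h \<Rightarrow> 'g \<Rightarrow> 'g"
    and BG :: "'b topology" and EG :: "('e, 'g, 'b) gbundle"
    and M :: "'m topology" and \<iota> :: "'m \<times> 'g \<Rightarrow> 'u"
  assumes "admissible_crossed_module G TG H TH t \<alpha>"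
    and "universal_bundle G TG BG EG"
    and "paracompact_space M"
    and "inj_on \<iota> (topspace M \<times> carrier G)"
  shows "is_bibundle G TG H TH t (EGH_quotient G H TH t EG) (classifying_bibundle G H TH t EG) \<and>
    (\<forall>P \<in> (Bibun G TG H TH t M :: ('u, 'g, 'm, 'h) bibundle set).
       \<exists>\<Gamma>. classifies G H t BG EG M P \<Gamma>) \<and>
    (\<exists>c. bij_betw c
           (pi0_Bibun G TG H TH t M :: ('u, 'g, 'm, 'h) bibundle set set)
           (homotopy_classes_over type_map M (EGH_quotient G H TH t EG)) \<and>
         (\<forall>P \<in> Bibun G TG H TH t M. \<forall>\<Gamma>. classifies G H t BG EG M P \<Gamma> \<longrightarrow>
            c (Bibun_iso_rel G TG H TH t M `` {P}) = homotopy_rel_over type_map M (EGH_quotient G H TH t EG) `` {\<Gamma>}))"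
proof -
  interpret admissible_crossed_module G TG H TH t \<alpha> by fact
  have "\<exists>\<Gamma>. classifies G H t BG EG M P \<Gamma>"
    if "P \<in> (Bibun G TG H TH t M :: ('u, 'g, 'm, 'h) bibundle set)" for P
    using ex_classifies[OF assms(3,2), of P] that by (auto simp: Bibun_def)
  then show ?thesis
    using is_bibundle_classifying_bibundle[OF universal_bundleD(1)[OF assms(2)]]
      classification[OF assms(3,2,4)] by blast
qed

end
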